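(* Suppose the interaction kernel $R$ is Hilbert–Schmidt, i.e. $\int_{\mathcal X\times\mathcal X}R(x,y)^2\,\mu(dx)\mu(dy)<\infty$. Then the CEStGM process $\{X_t\}_{t\in\mathbb Z}$ (see context) is geometrically $\beta$-mixing, and hence ergodic.
   Context: Setting. Let $p\ge 1$, $[p]=\{1,\ldots,p\}$. For each $a\in[p]$ let $\mathcal X^{(a)}\subseteq\mathbb R$ be measurable with a sigma-finite measure $\mu_a$; $\mathcal X=\prod_{a}\mathcal X^{(a)}$, $\mu=\otimes_{a}\mu_a$. Let $s_a,c_a:\mathcal X^{(a)}\to\mathbb R$ be measurable, $\theta\in\mathbb R^p$, and $\Phi_0,\Phi_1$ real $p\times p$ matrices, $\Phi_0$ symmetric with zero diagonal. With $\mathbf s(x)=(s_a(x^{(a)}))_a$, $\mathbf c(x)=(c_a(x^{(a)}))_a$, put $G(x)=\exp\big(\theta^\top\mathbf s(x)+\mathbf 1_p^\top\mathbf c(x)+\tfrac12x^\top\Phi_0x\big)$, $H(x,y)=\exp(x^\top\Phi_1y)$, and let the interaction kernel be $R(x,y)=G(x)^{1/2}H(x,y)G(y)^{1/2}>0$. Let $T(f)[y]=\int R(x,y)f(x)\mu(dx)$ on $L^2(\mathcal X,\mu)$ (compact under the Hilbert–Schmidt condition). CEStGM process: when $T$ is compact, the unique (in law) strictly stationary process $\{X_t\}_{t\in\mathbb Z}$ with values in $\mathcal X$ whose joint density for $(X_m,\ldots,X_{m+n-1})$ (any $m\in\mathbb Z$, $n\ge1$) with respect to the $n$-fold product of $\mu$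 is $r^{-(n-1)}v(x_1)\prod_{t=2}^nR(x_{t-1},x_t)\,w(x_n)$, where $r>0$ is the spectral radius of $T$ and $v,w$ are the a.e. positive eigenfunctions of $T$ and $T^*$ for the eigenvalue $r$ (unique up to scaling, by Krein–Rutman), scaled so that $\langle v,w\rangle=1$. Geometric $\beta$-mixing: for sub-sigma-algebras $\mathcal A,\mathcal B$ let $\beta(\mathcal A,\mathcal B)=\sup\tfrac12\sum_{i=1}^I\sum_{j=1}^J|P(A_i\cap B_j)-P(A_i)P(B_j)|$, the supremum over all pairs of finite partitions $\{A_i\}\subseteq\mathcal A$, $\{B_j\}\subseteq\mathcal B$ of the sample space. A stationary $\{X_t\}$ is geometrically $\beta$-mixing if there are $\rho\in(0,1)$, $C>0$ with $\beta\big(\sigma(X_t:t\le0),\sigma(X_t:t\ge n+1)\big)\le C\rho^n$ for all $n\in\mathbb N$. *)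

theory Defs
  imports "HOL-Probability.Probability"
begin

text \<open>
  A point of the product of the spaces \<open>\<X> a\<close> is a function \<open>x :: 'p \<Rightarrow> real\<close>; the finite index
  type \<open>'p\<close> plays the role of \<open>{1..p}\<close>.
\<close>

definition suff_stat :: "('p::finite \<Rightarrow> real \<Rightarrow> real) \<Rightarrow> ('p \<Rightarrow> real) \<Rightarrow> real ^ 'p" where
  "suff_stat s x = (\<chi> a. s a (x a))"

definition G_fun ::
  "('p::finite \<Rightarrow> real \<Rightarrow> real) \<Rightarrow> ('p \<Rightarrow> real \<Rightarrow> real) \<Rightarrow> real ^ 'p \<Rightarrow> real ^ 'p ^ 'p \<Rightarrow> ('p \<Rightarrow> real) \<Rightarrow> real"
  where
  "G_fun s c \<theta> \<Phi>0 x =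
     exp (\<theta> \<bullet> suff_stat s x + (\<Sum>a\<in>UNIV. c a (x a)) + 1 / 2 * (vec_lambda x \<bullet> (\<Phi>0 *v vec_lambda x)))"

definition H_fun :: "real ^ 'p ^ 'p \<Rightarrow> ('p::finite \<Rightarrow> real) \<Rightarrow> ('p \<Rightarrow> real) \<Rightarrow> real" where
  "H_fun \<Phi>1 x y = exp (vec_lambda x \<bullet> (\<Phi>1 *v vec_lambda y))"

definition interaction_kernel ::
  "('p::finite \<Rightarrow> real \<Rightarrow> real) \<Rightarrow> ('p \<Rightarrow> real \<Rightarrow> real) \<Rightarrow> real ^ 'p \<Rightarrow> real ^ 'p ^ 'p \<Rightarrow> real ^ 'p ^ 'p
    \<Rightarrow> ('p \<Rightarrow> real) \<Rightarrow> ('p \<Rightarrow> real) \<Rightarrow> real"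
  where
  "interaction_kernel s c \<theta> \<Phi>0 \<Phi>1 x y =
     sqrt (G_fun s c \<theta> \<Phi>0 x) * H_fun \<Phi>1 x y * sqrt (G_fun s c \<theta> \<Phi>0 y)"

text \<open>
  Elements of \<open>L\<^sup>2(M)\<close> are represented by functions, and identities between them are stated almost
  everywhere. The codomain is left polymorphic: the eigenfunctions are real, whereas the spectrum
  is, as usual for a real operator, that of its complexification, i.e. of the operator with the
  same kernel on complex \<open>L\<^sup>2\<close>.
\<close>

definition L2 :: "'x measure \<Rightarrow> ('x \<Rightarrow> 'b::{banach, second_countable_topology}) set" where
  "L2 M = {f \<in> borel_measurable M. integrable M (\<lambda>x. (norm (f x))\<^sup>2)}"

definition L2_norm :: "'x measure \<Rightarrow> ('x \<Rightarrow> 'b::{banach, second_countable_topology}) \<Rightarrow> real" where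
  "L2_norm M f = sqrt (\<integral>x. (norm (f x))\<^sup>2 \<partial>M)"

text \<open>The first argument of the kernel is integrated out.\<close>

definition integral_operator ::
  "'x measure \<Rightarrow> ('x \<Rightarrow> 'x \<Rightarrow> real) \<Rightarrow> ('x \<Rightarrow> 'b::{banach, second_countable_topology}) \<Rightarrow> 'x \<Rightarrow> 'b"
  where
  "integral_operator M K f y = (\<integral>x. K x y *\<^sub>R f x \<partial>M)"

text \<open>For a real Hilbert--Schmidt kernel this is the adjoint operator, by the lemma below.\<close>

definition adjoint_integral_operator ::
  "'x measure \<Rightarrow> ('x \<Rightarrow> 'x \<Rightarrow> real) \<Rightarrow> ('x \<Rightarrow> 'b::{banach, second_countable_topology}) \<Rightarrow> 'x \<Rightarrow> 'b"
  where
  "adjoint_integral_operator M K = integral_operator M (\<lambda>x y. K y x)"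

lemma adjoint_integral_operator:
  fixes K :: "'x \<Rightarrow> 'x \<Rightarrow> real" and f g :: "'x \<Rightarrow> real"
  assumes "sigma_finite_measure M"
    and K[measurable]: "(\<lambda>(x, y). K x y) \<in> borel_measurable (M \<Otimes>\<^sub>M M)"
    and HS: "(\<integral>\<^sup>+ (x, y). ennreal ((K x y)\<^sup>2) \<partial>(M \<Otimes>\<^sub>M M)) < \<infinity>"
    and f: "f \<in> L2 M" and g: "g \<in> L2 M"
  shows "(\<integral>y. integral_operator M K f y * g y \<partial>M) = (\<integral>x. f x * adjoint_integral_operator M K g x \<partial>M)"
proof -
  interpret sigma_finite_measure M by fact
  interpret pair_sigma_finite M M by standard
  have [measurable]: "f \<in> borel_measurable M" "g \<in> borel_measurable M"
    and f2: "integrable M (\<lambda>x. (f x)\<^sup>2)" and g2: "integrable M (\<lambda>x. (g x)\<^sup>2)"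
    using f g by (auto simp: L2_def)
  have K2: "integrable (M \<Otimes>\<^sub>M M) (\<lambda>(x, y). (K x y)\<^sup>2)"
    using HS by (intro integrableI_bounded) (simp_all add: case_prod_beta')
  have fg2: "integrable (M \<Otimes>\<^sub>M M) (\<lambda>(x, y). (f x)\<^sup>2 * (g y)\<^sup>2)"
    using f2 g2 by (intro Fubini_integrable) (auto simp: abs_mult)
  have int: "integrable (M \<Otimes>\<^sub>M M) (\<lambda>(x, y). K x y * f x * g y)"
  proof (rule Bochner_Integration.integrable_bound[OF Bochner_Integration.integrable_add[OF K2 fg2]])
    have "\<bar>a * b * c\<bar> \<le> \<bar>a\<^sup>2 + b\<^sup>2 * c\<^sup>2\<bar>" for a b c :: real
    proof -
      have "0 \<le> (\<bar>a\<bar> - \<bar>b * c\<bar>)\<^sup>2" by simp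
      then have "2 * (\<bar>a\<bar> * \<bar>b * c\<bar>) \<le> a\<^sup>2 + (b * c)\<^sup>2"
        by (simp add: power2_diff)
      moreover have "0 \<le> \<bar>a\<bar> * \<bar>b * c\<bar>" by simp
      ultimately have "\<bar>a\<bar> * \<bar>b * c\<bar> \<le> a\<^sup>2 + (b * c)\<^sup>2" by linarith
      then show ?thesis
        by (simp add: abs_mult power_mult_distrib mult.assoc)
    qed
    then show "AE p in M \<Otimes>\<^sub>M M. norm (case p of (x, y) \<Rightarrow> K x y * f x * g y)
        \<le> norm ((case p of (x, y) \<Rightarrow> (K x y)\<^sup>2) + (case p of (x, y) \<Rightarrow> (f x)\<^sup>2 * (g y)\<^sup>2))"
      by (auto simp: case_prod_beta)
  qed measurable
  have "(\<integral>y. integral_operator M K f y * g y \<partial>M) = (\<integral>y. (\<integral>x. K x y * f x * g y \<partial>M) \<partial>M)"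
    by (simp add: integral_operator_def)
  also have "\<dots> = (\<integral>x. (\<integral>y. K x y * f x * g y \<partial>M) \<partial>M)"
    by (rule Fubini_integral[OF int])
  also have "\<dots> = (\<integral>x. f x * adjoint_integral_operator M K g x \<partial>M)"
    by (simp add: adjoint_integral_operator_def integral_operator_def mult.assoc mult.left_commute[of _ "f _"])
  finally show ?thesis .
qed

text \<open>
  \<open>z\<close> is in the resolvent set iff \<open>T - z\<close> is onto \<open>L\<^sup>2\<close>, injective, and has a bounded inverse; the
  lower bound on \<open>T - z\<close> expresses the last two properties together.
\<close>

definition L2_resolvent_set :: "'x measure \<Rightarrow> (('x \<Rightarrow> complex) \<Rightarrow> 'x \<Rightarrow> complex) \<Rightarrow> complex set" where
  "L2_resolvent_set M T = {z.
     (\<forall>g\<in>L2 M. \<exists>f\<in>L2 M. AE x in M. T f x - z * f x = g x) \<and>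
     (\<exists>C. \<forall>f\<in>L2 M. L2_norm M f \<le> C * L2_norm M (\<lambda>x. T f x - z * f x))}"

definition L2_spectral_radius :: "'x measure \<Rightarrow> (('x \<Rightarrow> complex) \<Rightarrow> 'x \<Rightarrow> complex) \<Rightarrow> real" where
  "L2_spectral_radius M T = (SUP z\<in>- L2_resolvent_set M T. cmod z)"

definition strictly_stationary :: "'w measure \<Rightarrow> 'x measure \<Rightarrow> (int \<Rightarrow> 'w \<Rightarrow> 'x) \<Rightarrow> bool" where
  "strictly_stationary P M X \<longleftrightarrow>
     (\<forall>t. X t \<in> P \<rightarrow>\<^sub>M M) \<and>
     (\<forall>k. distr P (\<Pi>\<^sub>M t\<in>UNIV. M) (\<lambda>\<omega> t. X (t + k) \<omega>) = distr P (\<Pi>\<^sub>M t\<in>UNIV. M) (\<lambda>\<omega> t. X t \<omega>))"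

text \<open>
  The block \<open>(X m, \<dots>, X (m + n - 1))\<close> is indexed from \<open>0\<close>, as an element of the product over \<open>{..<n}\<close>.
  The process takes values in \<open>space M\<close>, and its law does not depend on the choice of \<open>v\<close> and \<open>w\<close>,
  which are unique up to reciprocal scaling.
\<close>

definition CEStGM_process ::
  "'x measure \<Rightarrow> ('x \<Rightarrow> 'x \<Rightarrow> real) \<Rightarrow> 'w measure \<Rightarrow> (int \<Rightarrow> 'w \<Rightarrow> 'x) \<Rightarrow> bool"
  where
  "CEStGM_process M R P X \<longleftrightarrow>
     prob_space P \<and> strictly_stationary P M X \<and>
     (\<exists>r v w.
        r = L2_spectral_radius M (integral_operator M R) \<and> 0 < r \<and>
        v \<in> L2 M \<and> w \<in> L2 M \<and>
        (AE x in M. 0 < v x) \<and> (AE x in M. 0 < w x) \<and>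
        (AE x in M. integral_operator M R v x = r * v x) \<and>
        (AE x in M. adjoint_integral_operator M R w x = r * w x) \<and>
        (\<integral>x. v x * w x \<partial>M) = 1 \<and>
        (\<forall>(m::int) (n::nat). 1 \<le> n \<longrightarrow>
           distributed P (\<Pi>\<^sub>M t\<in>{..<n}. M) (\<lambda>\<omega>. \<lambda>t\<in>{..<n}. X (m + int t) \<omega>)
             (\<lambda>x. ennreal (inverse (r ^ (n - 1)) * v (x 0) * (\<Prod>t\<in>{1..<n}. R (x (t - 1)) (x t)) * w (x (n - 1))))))"

definition sigma_generated ::
  "'w measure \<Rightarrow> 'x measure \<Rightarrow> (int \<Rightarrow> 'w \<Rightarrow> 'x) \<Rightarrow> int set \<Rightarrow> 'w set set" where
  "sigma_generated P M X I =
     sigma_sets (space P) (\<Union>t\<in>I. {X t -` B \<inter> space P | B. B \<in> sets M})"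

text \<open>
  \<open>partition_on\<close> excludes empty blocks; these would contribute \<open>0\<close>. All the sums are at most \<open>1\<close>,
  so the real-valued supremum is a genuine one.
\<close>

definition beta_coeff :: "'w measure \<Rightarrow> 'w set set \<Rightarrow> 'w set set \<Rightarrow> real" where
  "beta_coeff P \<A> \<B> =
     Sup {1 / 2 * (\<Sum>A\<in>U. \<Sum>B\<in>V. \<bar>measure P (A \<inter> B) - measure P A * measure P B\<bar>) | U V.
            finite U \<and> U \<subseteq> \<A> \<and> partition_on (space P) U \<and>
            finite V \<and> V \<subseteq> \<B> \<and> partition_on (space P) V}"

definition geometrically_beta_mixing :: "'w measure \<Rightarrow> 'x measure \<Rightarrow> (int \<Rightarrow> 'w \<Rightarrow> 'x) \<Rightarrow> bool" where
  "geometrically_beta_mixing P M X \<longleftrightarrow>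
     strictly_stationary P M X \<and>
     (\<exists>\<rho> C. 0 < \<rho> \<and> \<rho> < 1 \<and> 0 < C \<and>
        (\<forall>n::nat. beta_coeff P (sigma_generated P M X {..0}) (sigma_generated P M X {int n + 1..})
                    \<le> C * \<rho> ^ n))"

definition ergodic_process :: "'w measure \<Rightarrow> 'x measure \<Rightarrow> (int \<Rightarrow> 'w \<Rightarrow> 'x) \<Rightarrow> bool" where
  "ergodic_process P M X \<longleftrightarrow>
     strictly_stationary P M X \<and>
     (\<forall>A\<in>sets (\<Pi>\<^sub>M t\<in>(UNIV::int set). M).
        {\<xi> \<in> space (\<Pi>\<^sub>M t\<in>(UNIV::int set). M). (\<lambda>t. \<xi> (t + 1)) \<in> A} = A \<longrightarrow>
        measure P {\<omega> \<in> space P. (\<lambda>t. X t \<omega>) \<in> A} \<in> {0, 1})"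

end

theory Submission
  imports Defs
begin

text \<open>
  With \<open>K = R / r\<close>, \<open>v\<close> and \<open>w\<close> are left and right eigenfunctions for the eigenvalue \<open>1\<close>, and the process
  is the Markov chain with transition density \<open>K x y * w y / w x\<close> and stationary density \<open>v * w\<close>.
  No spectral theory is needed: Harris' theorem applies. The Lyapunov function is \<open>h / w\<close> with \<open>h\<close> in
  \<open>L\<^sup>2\<close>. Outside a large enough set the Hilbert--Schmidt norm of \<open>K\<close> is small, so that \<open>h\<close> can be found there
  by a Neumann iteration; inside, the drift is controlled by \<open>K * h \<le> K\<^sup>2 / w + w * h\<^sup>2\<close>. The iteration
  starts from \<open>w\<close> times a function that is unbounded along an exhaustion by small sets,
  so that all sublevel sets of \<open>h / w\<close> are small. The resulting contraction gives \<open>L\<^sup>1\<close>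
  convergence of the \<open>n\<close>-step kernel to \<open>w x * v y\<close> at a geometric rate, and by the Markov property the law of
  (past, future) has density \<open>iter_kernel n x y / (w x * v y)\<close> with respect to the product of its marginals,
  evaluated at \<open>x = X 0\<close> and \<open>y = X (n + 1)\<close>.
\<close>

text \<open>A minorization \<open>K x y \<ge> w x * \<eta> y\<close> over the whole space would give
  a contraction at once, but in general \<open>K\<close> is bounded below only locally, so a drift
  towards a small set is needed as well. The demands on the Lyapunov function pull against each
  other. The level of \<open>h / w\<close> below which the minorization must hold is 16 * \<kappa>,
  and \<kappa> contains the squared norm of \<open>h\<close>: the level is known only after
  \<open>h\<close> has been built. Hence every sublevel set has to be small, while \<open>h\<close>
  must stay square integrable for \<kappa> and the integral of v * h to be finite. The distance is
  of \<open>L\<^sup>1\<close> type because the mixing coefficient is bounded through the integral of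
  |ratio - 1| against the product of the marginal laws. All integrals are taken in
  \<open>ennreal\<close>, so that Tonelli needs no integrability and infinite values on null sets do
  no harm. The price is the loss of signed differences: a difference of densities is carried as a
  common part and two excesses.\<close>

section \<open>Harris contraction\<close>

text \<open>Truncated subtraction leaves at most one nonzero summand as soon as one argument is
  finite, so this is the distance |a - b|; at a = b = top its value is top.\<close>

definition absdiff :: "ennreal \<Rightarrow> ennreal \<Rightarrow> ennreal" where
  "absdiff a b = (a - b) + (b - a)"

lemma absdiff_measurable[measurable (raw)]:
  assumes [measurable]: "f \<in> borel_measurable M" "g \<in> borel_measurable M"
  shows "(\<lambda>x. absdiff (f x) (g x)) \<in> borel_measurable M"
  unfolding absdiff_def by measurable

lemma le_add_absdiff: "a \<le> b + absdiff a b" "b \<le> a + absdiff a b"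
  unfolding absdiff_def
  by (metis add.assoc add_increasing2 add_diff_self_ennreal le_cases order_refl zero_le)
     (metis add.assoc add.commute add_increasing2 add_diff_self_ennreal le_cases order_refl zero_le)

lemma absdiff_le_add: "absdiff a b \<le> a + b"
  unfolding absdiff_def by (intro add_mono) auto

text \<open>Common part plus excess: used in both orders of the arguments, this takes the place of
  the Jordan decomposition of a - b.\<close>

lemma min_plus_diff_ennreal: "min a b + (a - b) = (a::ennreal)"
  by (cases "a \<le> b") (auto simp: min_def add_diff_self_ennreal not_le diff_eq_0_iff_ennreal top.not_eq_extremum
    dest: order_le_less_trans intro: antisym)

lemma absdiff_ennreal:
  assumes "0 \<le> x" "0 \<le> y"
  shows "absdiff (ennreal x) (ennreal y) = ennreal \<bar>x - y\<bar>"
  using assms by (auto simp: absdiff_def ennreal_minus abs_if ennreal_neg)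

text \<open>The common part c cancels. Both p and q contain t, which cancels too, so the distance
  falls short of p + q by at least 2 * t. Here a minorization becomes a gain.\<close>

lemma absdiff_add_left_le:
  assumes "c + p < top" "c + q < top" "t \<le> p" "t \<le> q"
  shows "absdiff (c + p) (c + q) + 2 * t \<le> p + q"
proof -
  have "p < top" "q < top" "c < top" "t < top"
    using assms by (auto simp: less_top dest: le_less_trans)
  then obtain p' q' c' t' where "p = ennreal p'" "q = ennreal q'" "c = ennreal c'" "t = ennreal t'"
    "0 \<le> p'" "0 \<le> q'" "0 \<le> c'" "0 \<le> t'"
    by (metis ennreal_cases less_top)
  note [simp] = this
  have le: "t' \<le> p'" "t' \<le> q'" using assms(3,4) by simp_all
  have "absdiff (c + p) (c + q) + 2 * t = ennreal (\<bar>p' - q'\<bar> + 2 * t')"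
    by (subst ennreal_plus) (auto simp: absdiff_ennreal ennreal_mult simp flip: ennreal_plus)
  also have "\<dots> \<le> ennreal (p' + q')"
    using le by (intro ennreal_leI) auto
  finally show ?thesis by simp
qed

lemma absdiff_mult_left:
  assumes "c < top"
  shows "c * absdiff a b = absdiff (c * a) (c * b)"
  using assms unfolding absdiff_def
  by (simp add: distrib_left ennreal_right_diff_distrib less_top[symmetric])

locale positive_kernel = sigma_finite_measure M
  for M :: "'x measure" and K :: "'x \<Rightarrow> 'x \<Rightarrow> ennreal" and v w :: "'x \<Rightarrow> ennreal" +
  assumes kernel_measurable: "case_prod K \<in> borel_measurable (M \<Otimes>\<^sub>M M)"
    and v_measurable[measurable]: "v \<in> borel_measurable M"
    and w_measurable[measurable]: "w \<in> borel_measurable M"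
    and v_pos: "AE x in M. 0 < v x \<and> v x < top"
    and w_pos: "AE x in M. 0 < w x \<and> w x < top"
    and v_eigen: "AE y in M. (\<integral>\<^sup>+x. v x * K x y \<partial>M) = v y"
    and w_eigen: "AE x in M. (\<integral>\<^sup>+y. K x y * w y \<partial>M) = w x"
    and vw: "(\<integral>\<^sup>+x. v x * w x \<partial>M) = 1"
begin

lemma K_measurable[measurable (raw)]:
  assumes [measurable]: "f \<in> N \<rightarrow>\<^sub>M M" "g \<in> N \<rightarrow>\<^sub>M M"
  shows "(\<lambda>x. K (f x) (g x)) \<in> borel_measurable N"
  using measurable_compose[OF measurable_Pair[OF assms] kernel_measurable] by simp

text \<open>For \<open>K = R / r\<close> this is T divided by its eigenvalue, moving densities
  forward in time. \<open>pull\<close> is its adjoint, moving test functions backward.\<close>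

definition push :: "('x \<Rightarrow> ennreal) \<Rightarrow> 'x \<Rightarrow> ennreal" where
  "push f y = (\<integral>\<^sup>+x. f x * K x y \<partial>M)"

definition pull :: "('x \<Rightarrow> ennreal) \<Rightarrow> 'x \<Rightarrow> ennreal" where
  "pull g x = (\<integral>\<^sup>+y. K x y * g y \<partial>M)"

lemma push_measurable[measurable]:
  assumes [measurable]: "f \<in> borel_measurable M"
  shows "push f \<in> borel_measurable M"
  unfolding push_def by measurable

lemma pull_measurable[measurable]:
  assumes [measurable]: "g \<in> borel_measurable M"
  shows "pull g \<in> borel_measurable M"
  unfolding pull_def by measurable

lemma push_v: "AE x in M. push v x = v x"
  using v_eigen by (simp add: push_def)

lemma pull_w: "AE x in M. pull w x = w x"
  using w_eigen by (simp add: pull_def)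

lemma Tonelli:
  assumes "case_prod f \<in> borel_measurable (M \<Otimes>\<^sub>M M)"
  shows "(\<integral>\<^sup>+y. \<integral>\<^sup>+x. f x y \<partial>M \<partial>M) = (\<integral>\<^sup>+x. \<integral>\<^sup>+y. f x y \<partial>M \<partial>M)"
  by (rule pair_sigma_finite.Fubini'[OF _ assms]) (unfold_locales)

lemma push_pull:
  assumes [measurable]: "f \<in> borel_measurable M" "g \<in> borel_measurable M"
  shows "(\<integral>\<^sup>+y. push f y * g y \<partial>M) = (\<integral>\<^sup>+x. f x * pull g x \<partial>M)"
proof -
  have "(\<integral>\<^sup>+y. push f y * g y \<partial>M) = (\<integral>\<^sup>+y. \<integral>\<^sup>+x. f x * K x y * g y \<partial>M \<partial>M)"
    unfolding push_def by (intro nn_integral_cong) (simp add: nn_integral_multc)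
  also have "\<dots> = (\<integral>\<^sup>+x. \<integral>\<^sup>+y. f x * K x y * g y \<partial>M \<partial>M)"
    by (rule Tonelli) measurable
  also have "\<dots> = (\<integral>\<^sup>+x. f x * pull g x \<partial>M)"
    unfolding pull_def
    by (intro nn_integral_cong) (simp add: nn_integral_cmult[symmetric] mult.assoc)
  finally show ?thesis .
qed

text \<open>Mass with weight \<open>w\<close> is preserved because \<open>w\<close> is fixed by
  \<open>pull\<close>.\<close>

lemma integral_push_w:
  assumes [measurable]: "f \<in> borel_measurable M"
  shows "(\<integral>\<^sup>+y. push f y * w y \<partial>M) = (\<integral>\<^sup>+x. f x * w x \<partial>M)"
  using pull_w by (subst push_pull) (auto intro!: nn_integral_cong_AE)

lemma finite_AE_of_integral_w:
  assumes [measurable]: "f \<in> borel_measurable M" and "(\<integral>\<^sup>+y. f y * w y \<partial>M) < top"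
  shows "AE y in M. f y < top"
proof -
  have "AE y in M. f y * w y \<noteq> \<infinity>"
    using assms(2) by (intro nn_integral_PInf_AE) auto
  then show ?thesis
    using w_pos by eventually_elim (auto simp: ennreal_mult_eq_top_iff less_top)
qed

text \<open>
  The Hairer--Mattingly form of Harris' theorem, dual to the usual one: drift and minorization make
  \<open>push\<close> a strict contraction of the \<open>L\<^sup>1\<close> distance with weight \<open>w + \<beta> h\<close> between densities of equal mass.
\<close>

lemma push_contraction:
  fixes \<alpha> \<beta> \<kappa> :: real
  assumes [measurable]: "h \<in> borel_measurable M" "\<eta> \<in> borel_measurable M"
    and \<kappa>: "0 < \<kappa>"
    and drift: "AE x in M. pull h x \<le> ennreal (1 / 2) * h x + ennreal \<kappa> * w x"
    and minor: "AE x in M. h x \<le> ennreal (16 * \<kappa>) * w x \<longrightarrow> (\<forall>y\<in>space M. w x * \<eta> y \<le> K x y)"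
    and \<alpha>: "0 < \<alpha>" "\<alpha> \<le> 1 / 2" "ennreal \<alpha> \<le> (\<integral>\<^sup>+y. \<eta> y * w y \<partial>M)"
    and \<beta>: "\<beta> = \<alpha> / (2 * \<kappa>)"
    and [measurable]: "f1 \<in> borel_measurable M" "f2 \<in> borel_measurable M"
    and eq: "(\<integral>\<^sup>+x. f1 x * w x \<partial>M) = (\<integral>\<^sup>+x. f2 x * w x \<partial>M)"
    and fin: "(\<integral>\<^sup>+x. f2 x * w x \<partial>M) < top"
  shows "(\<integral>\<^sup>+y. absdiff (push f1 y) (push f2 y) * (w y + ennreal \<beta> * h y) \<partial>M)
     \<le> ennreal (1 - \<alpha> / 2) * (\<integral>\<^sup>+x. absdiff (f1 x) (f2 x) * (w x + ennreal \<beta> * h x) \<partial>M)"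
    (is "?Z \<le> _ * ?D")
proof (cases "?D < top")
  case False
  then have "?D = top" using less_top by blast
  moreover have "0 < 1 - \<alpha> / 2" using \<alpha> by simp
  ultimately show ?thesis by (simp add: ennreal_mult_top)
next
  case True
  have \<beta>0: "0 < \<beta>" using \<alpha> \<kappa> \<beta> by simp
  define W where "W y = w y + ennreal \<beta> * h y" for y
  have [measurable]: "W \<in> borel_measurable M" unfolding W_def by measurable
  define g1 where "g1 x = f1 x - f2 x" for x
  define g2 where "g2 x = f2 x - f1 x" for x
  define mn where "mn x = min (f1 x) (f2 x)" for x
  have [measurable]: "g1 \<in> borel_measurable M" "g2 \<in> borel_measurable M" "mn \<in> borel_measurable M"
    unfolding g1_def g2_def mn_def by measurable
  have f1: "f1 x = mn x + g1 x" and f2: "f2 x = mn x + g2 x" for x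
    unfolding g1_def g2_def mn_def
    using min_plus_diff_ennreal[of "f1 x" "f2 x"] min_plus_diff_ennreal[of "f2 x" "f1 x"]
    by (simp_all add: min.commute)
  define S where "S = {x \<in> space M. h x \<le> ennreal (16 * \<kappa>) * w x}"
  have [measurable]: "S \<in> sets M" unfolding S_def by measurable
  define a where "a g = (\<integral>\<^sup>+x. g x * w x * indicator S x \<partial>M)" for g
  define I where "I g = (\<integral>\<^sup>+x. g x * w x \<partial>M)" for g
  define J where "J g = (\<integral>\<^sup>+x. g x * h x \<partial>M)" for g
  \<comment> \<open>\<open>a g1\<close> and \<open>a g2\<close> are the masses of the two excesses
    on the small set. By the minorization each is pushed to at least that multiple of
    \<open>\<eta>\<close>, so \<open>t * \<eta>\<close> is common to both images and
    cancels.\<close>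
  define t where "t = min (a g1) (a g2)"
  have push_minor: "a g * \<eta> y \<le> push g y" if "y \<in> space M" and [measurable]: "g \<in> borel_measurable M" for g y
  proof -
    have "a g * \<eta> y = (\<integral>\<^sup>+x. g x * w x * indicator S x * \<eta> y \<partial>M)"
      unfolding a_def by (simp add: nn_integral_multc)
    also have "\<dots> \<le> push g y"
      unfolding push_def
    proof (rule nn_integral_mono_AE)
      show "AE x in M. g x * w x * indicator S x * \<eta> y \<le> g x * K x y"
        using minor
      proof eventually_elim
        case (elim x)
        then show ?case
          using that(1) mult_left_mono[of "w x * \<eta> y" "K x y" "g x"]
          by (cases "x \<in> S") (auto simp: S_def mult.assoc)
      qed
    qed
    finally show ?thesis .
  qed
  have push_add: "push (\<lambda>x. f x + g x) y = push f y + push g y"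
    if [measurable]: "f \<in> borel_measurable M" "g \<in> borel_measurable M" and "y \<in> space M" for f g y
    unfolding push_def using that by (simp add: distrib_right nn_integral_add)
  have fin1: "I f1 < top" and fin2: "I f2 < top"
    using fin eq by (auto simp: I_def)
  have fin_push: "AE y in M. push f1 y < top" "AE y in M. push f2 y < top"
    using fin eq by (auto intro!: finite_AE_of_integral_w simp: integral_push_w)
  have main: "AE y in M. absdiff (push f1 y) (push f2 y) * W y + 2 * t * (\<eta> y * W y)
      \<le> (push g1 y + push g2 y) * W y"
    using fin_push AE_space
  proof eventually_elim
    case (elim y)
    have p1: "push f1 y = push mn y + push g1 y"
      by (subst push_add[symmetric]) (auto simp: elim f1[symmetric])
    have p2: "push f2 y = push mn y + push g2 y"
      by (subst push_add[symmetric]) (auto simp: elim f2[symmetric])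
    have "t * \<eta> y \<le> push g1 y" "t * \<eta> y \<le> push g2 y"
      using push_minor[OF elim(3), of g1] push_minor[OF elim(3), of g2]
      by (auto simp: t_def intro: order_trans[OF mult_right_mono[OF min.cobounded1]]
          order_trans[OF mult_right_mono[OF min.cobounded2]])
    then have "absdiff (push f1 y) (push f2 y) + 2 * (t * \<eta> y) \<le> push g1 y + push g2 y"
      using elim unfolding p1 p2 by (intro absdiff_add_left_le) auto
    from mult_right_mono[OF this, of "W y"] show ?case
      by (simp add: distrib_left distrib_right mult_ac)
  qed
  have pullW: "AE x in M. pull W x \<le> ennreal (1 + \<beta> * \<kappa>) * w x + ennreal (\<beta> / 2) * h x"
    using drift pull_w AE_space
  proof eventually_elim
    case (elim x)
    have "pull W x = pull w x + ennreal \<beta> * pull h x"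
      using elim(3) unfolding pull_def W_def
      by (simp add: distrib_left nn_integral_add nn_integral_cmult[symmetric] mult_ac)
    also have "\<dots> \<le> w x + ennreal \<beta> * (ennreal (1 / 2) * h x + ennreal \<kappa> * w x)"
      using elim by (intro add_mono mult_left_mono) auto
    also have "\<dots> = ennreal (1 + \<beta> * \<kappa>) * w x + ennreal (\<beta> / 2) * h x"
    proof -
      have e1: "ennreal (1 + \<beta> * \<kappa>) = 1 + ennreal \<beta> * ennreal \<kappa>"
        using \<beta>0 \<kappa> by (subst ennreal_plus) (auto simp: ennreal_mult)
      have e2: "ennreal (\<beta> / 2) = ennreal \<beta> * ennreal (1 / 2)"
        using \<beta>0 by (subst ennreal_mult[symmetric]) auto
      show ?thesis unfolding e1 e2 by (simp add: distrib_left distrib_right mult_ac add_ac)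
    qed
    finally show ?case .
  qed
  define g where "g x = g1 x + g2 x" for x
  have [measurable]: "g \<in> borel_measurable M" unfolding g_def by measurable
  have g: "absdiff (f1 x) (f2 x) = g x" for x by (simp add: g_def g1_def g2_def absdiff_def)
  \<comment> \<open>\<open>W\<close> dominates \<open>w\<close>, so the integral of
    \<open>\<eta> * W\<close> is at least \<alpha>: the cancelled part is worth 2 * t *
    \<alpha>.\<close>
  have "?Z + 2 * t * ennreal \<alpha> \<le> ?Z + 2 * t * (\<integral>\<^sup>+y. \<eta> y * W y \<partial>M)"
  proof (intro add_left_mono mult_left_mono order_trans[OF \<alpha>(3)] nn_integral_mono)
    show "w y \<le> W y" for y by (simp add: W_def)
  qed auto
  also have "\<dots> = (\<integral>\<^sup>+y. absdiff (push f1 y) (push f2 y) * W y + 2 * t * (\<eta> y * W y) \<partial>M)"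
    by (simp add: nn_integral_add nn_integral_cmult W_def)
  also have "\<dots> \<le> (\<integral>\<^sup>+y. (push g1 y + push g2 y) * W y \<partial>M)"
    using main by (rule nn_integral_mono_AE)
  also have "\<dots> = (\<integral>\<^sup>+y. push g y * W y \<partial>M)"
    unfolding g_def by (intro nn_integral_cong) (simp add: push_add)
  also have "\<dots> = (\<integral>\<^sup>+x. g x * pull W x \<partial>M)"
    by (rule push_pull) auto
  also have "\<dots> \<le> (\<integral>\<^sup>+x. g x * (ennreal (1 + \<beta> * \<kappa>) * w x + ennreal (\<beta> / 2) * h x) \<partial>M)"
    by (rule nn_integral_mono_AE, use pullW in eventually_elim, rule mult_left_mono) auto
  also have "\<dots> = ennreal (1 + \<beta> * \<kappa>) * I g + ennreal (\<beta> / 2) * J g"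
    unfolding I_def J_def
    by (simp add: distrib_left nn_integral_add nn_integral_cmult[symmetric] mult_ac)
  finally have Z: "?Z + 2 * t * ennreal \<alpha> \<le> ennreal (1 + \<beta> * \<kappa>) * I g + ennreal (\<beta> / 2) * J g" .
  have D: "?D = I g + ennreal \<beta> * J g"
    unfolding I_def J_def g
    by (simp add: distrib_left nn_integral_add nn_integral_cmult[symmetric] mult_ac)
  have finIJ: "I g < top" "J g < top"
    using True \<beta>0 unfolding D by (auto simp: ennreal_mult_less_top)
  have Ig: "I g = I g1 + I g2" and Jg: "J g = J g1 + J g2"
    unfolding I_def J_def g_def by (simp_all add: distrib_right nn_integral_add)
  \<comment> \<open>\<open>f1\<close> and \<open>f2\<close> have equal mass; once their common part,
    whose mass is finite, is cancelled, so have the excesses.\<close>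
  have "I mn + I g1 = I mn + I g2"
    using eq unfolding I_def f1 f2 by (simp add: distrib_right nn_integral_add)
  moreover have "I mn < top"
    using fin1 unfolding I_def f1 by (simp add: distrib_right nn_integral_add less_top)
  ultimately have I12: "I g1 = I g2"
    by (auto simp: ennreal_add_left_cancel)
  \<comment> \<open>Markov's inequality: off \<open>S\<close> the weight \<open>w\<close> is at most
    \<open>h / (16 * \<kappa>)\<close>, so mass outside the small set is paid for by the integral
    against \<open>h\<close>.\<close>
  have level: "I u \<le> a u + ennreal (1 / (16 * \<kappa>)) * J u" if [measurable]: "u \<in> borel_measurable M" for u
  proof -
    have "I u \<le> (\<integral>\<^sup>+x. u x * w x * indicator S x + ennreal (1 / (16 * \<kappa>)) * (u x * h x) \<partial>M)"
      unfolding I_def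
    proof (rule nn_integral_mono)
      fix x assume x: "x \<in> space M"
      show "u x * w x \<le> u x * w x * indicator S x + ennreal (1 / (16 * \<kappa>)) * (u x * h x)"
      proof (cases "x \<in> S")
        case False
        then have "ennreal (16 * \<kappa>) * w x \<le> h x" using x by (simp add: S_def)
        then have "ennreal (1 / (16 * \<kappa>)) * (ennreal (16 * \<kappa>) * w x) \<le> ennreal (1 / (16 * \<kappa>)) * h x"
          by (rule mult_left_mono) simp
        moreover have "ennreal (1 / (16 * \<kappa>)) * (ennreal (16 * \<kappa>) * w x) = w x"
          using \<kappa> by (simp add: mult.assoc[symmetric] ennreal_mult[symmetric])
        ultimately have "w x \<le> ennreal (1 / (16 * \<kappa>)) * h x" by simp
        from mult_left_mono[OF this, of "u x"] show ?thesis using False by (simp add: mult_ac)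
      qed simp
    qed
    also have "\<dots> = a u + ennreal (1 / (16 * \<kappa>)) * J u"
      unfolding a_def J_def by (simp add: nn_integral_add nn_integral_cmult)
    finally show ?thesis .
  qed
  \<comment> \<open>The closing arithmetic subtracts and is therefore done in the reals:
    \<open>i\<close> is the mass of each excess, \<open>j\<close> the integral of both against
    \<open>h\<close>, \<open>s\<close> the value of \<open>t\<close>.\<close>
  define i where "i = enn2real (I g1)"
  define j where "j = enn2real (J g)"
  define z where "z = enn2real ?Z"
  define s where "s = enn2real t"
  have fins: "I g1 < top" "a g1 < top" "a g2 < top"
  proof -
    show i1: "I g1 < top" using finIJ(1) Ig by (auto simp: less_top)
    have le: "a u \<le> I u" for u
      unfolding a_def I_def by (intro nn_integral_mono) (auto simp: indicator_def)
    show "a g1 < top" using le i1 by (rule le_less_trans)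
    show "a g2 < top" using le i1[unfolded I12] by (rule le_less_trans)
  qed
  have i0: "0 \<le> i" by (simp add: i_def)
  have i1: "I g1 = ennreal i" using fins by (simp add: i_def)
  have "I g = ennreal (i + i)"
    using i0 by (subst ennreal_plus) (auto simp: Ig I12[symmetric] i1)
  then have i: "I g1 = ennreal i" "I g2 = ennreal i" "I g = ennreal (2 * i)"
    using i1 I12 by simp_all
  have j: "J g = ennreal j" "0 \<le> j" using finIJ by (auto simp: j_def)
  have ts: "t = ennreal s" "0 \<le> s" using fins by (auto simp: s_def t_def min_def)
  have tl: "i \<le> s + 1 / (16 * \<kappa>) * j"
  proof -
    have "I g1 \<le> a u + ennreal (1 / (16 * \<kappa>)) * J g" if "u = g1 \<or> u = g2" for u
    proof -
      have "I g1 = I u" using that I12 by auto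
      also have "I u \<le> a u + ennreal (1 / (16 * \<kappa>)) * J u" using that by (intro level) auto
      also have "J u \<le> J g" using that Jg by auto
      finally show ?thesis by (simp add: mult_left_mono)
    qed
    then have "I g1 \<le> t + ennreal (1 / (16 * \<kappa>)) * J g" by (auto simp: t_def min_def)
    then show ?thesis
      using i0 j ts \<kappa> unfolding i ts j
      by (simp add: ennreal_mult[symmetric] ennreal_plus[symmetric] del: ennreal_plus)
  qed
  have Z': "?Z + ennreal (2 * s * \<alpha>) \<le> ennreal ((1 + \<beta> * \<kappa>) * (2 * i) + \<beta> / 2 * j)"
  proof -
    have "2 * t * ennreal \<alpha> = ennreal (2 * s * \<alpha>)"
      using ts \<alpha> by (simp add: ennreal_mult)
    moreover have "ennreal (1 + \<beta> * \<kappa>) * I g + ennreal (\<beta> / 2) * J g = ennreal ((1 + \<beta> * \<kappa>) * (2 * i) + \<beta> / 2 * j)"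
      using i0 j \<beta>0 \<kappa> unfolding i(3) j
      by (subst ennreal_plus) (auto simp: ennreal_mult[symmetric] simp del: ennreal_plus)
    ultimately show ?thesis using Z by simp
  qed
  have "?Z \<le> ?Z + ennreal (2 * s * \<alpha>)" by simp
  also note Z'
  also have "ennreal ((1 + \<beta> * \<kappa>) * (2 * i) + \<beta> / 2 * j) < top" by simp
  finally have "?Z < top" .
  then have z: "?Z = ennreal z" "0 \<le> z" by (auto simp: z_def)
  \<comment> \<open>The choice \<beta> = \<alpha> / (2 * \<kappa>) makes the surplus mass caused by
    the drift equal to \<alpha> * i, half of the gain 2 * \<alpha> * i obtained next.\<close>
  have "(1 + \<beta> * \<kappa>) * (2 * i) = 2 * i + \<alpha> * i"
    using \<beta> \<kappa> by (simp add: field_simps)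
  then have "z + 2 * s * \<alpha> \<le> 2 * i + \<alpha> * i + \<beta> / 2 * j"
    using Z' z ts i0 j \<alpha> \<beta>0 \<kappa> unfolding z(1)
    by (simp add: ennreal_plus[symmetric] del: ennreal_plus)
  \<comment> \<open>The level 16 * \<kappa> leaves an error of \<beta> / 4 * j, so the coefficient
    of j becomes 3 / 4 * \<beta>, and 3 / 4 \<le> 1 - \<alpha> / 2 because \<alpha> \<le> 1 /
    2.\<close>
  moreover have "2 * \<alpha> * (s + 1 / (16 * \<kappa>) * j) = 2 * s * \<alpha> + \<beta> / 4 * j"
    using \<beta> \<kappa> by (simp add: field_simps)
  then have "2 * \<alpha> * i \<le> 2 * s * \<alpha> + \<beta> / 4 * j"
    using mult_left_mono[OF tl, of "2 * \<alpha>"] \<alpha> by simp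
  ultimately have "z \<le> (1 - \<alpha> / 2) * (2 * i) + (\<beta> / 2 + \<beta> / 4) * j"
    by (simp add: algebra_simps)
  also have "\<dots> \<le> (1 - \<alpha> / 2) * (2 * i) + (1 - \<alpha> / 2) * \<beta> * j"
    using \<alpha> \<beta>0 j(2) by (intro add_left_mono mult_right_mono) auto
  also have "\<dots> = (1 - \<alpha> / 2) * (2 * i + \<beta> * j)" by (simp add: algebra_simps)
  finally have "ennreal z \<le> ennreal ((1 - \<alpha> / 2) * (2 * i + \<beta> * j))" by (rule ennreal_leI)
  also have "\<dots> = ennreal (1 - \<alpha> / 2) * ?D"
    unfolding D i(3) j(1) using \<alpha> i0 j(2) \<beta>0 by (simp add: ennreal_mult[symmetric] ennreal_plus[symmetric] del: ennreal_plus)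
  finally show ?thesis using z by simp
qed

end

section \<open>Iterated kernels and their rate of convergence\<close>

context positive_kernel
begin

text \<open>Counted from 0: \<open>iter_kernel n\<close> is the (n + 1)-fold composition of
  \<open>K\<close>, the passage from \<open>X 0\<close> to \<open>X (n + 1)\<close>, which matches
  the time gap in the mixing coefficient.\<close>

primrec iter_kernel :: "nat \<Rightarrow> 'x \<Rightarrow> 'x \<Rightarrow> ennreal" where
  "iter_kernel 0 = K"
| "iter_kernel (Suc n) = (\<lambda>x. push (iter_kernel n x))"

lemma iter_kernel_measurable[measurable (raw)]:
  assumes [measurable]: "f \<in> N \<rightarrow>\<^sub>M M" "g \<in> N \<rightarrow>\<^sub>M M"
  shows "(\<lambda>x. iter_kernel n (f x) (g x)) \<in> borel_measurable N"
proof -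
  have "case_prod (iter_kernel n) \<in> borel_measurable (M \<Otimes>\<^sub>M M)"
  proof (induction n)
    case 0
    show ?case using kernel_measurable by simp
  next
    case (Suc n)
    note [measurable] = Suc
    \<comment> \<open>The integrand of \<open>push\<close> lives on a triple product; the induction
      hypothesis is restated there, composed with arbitrary measurable maps.\<close>
    have [measurable]: "(\<lambda>p. iter_kernel n (f' p) (g' p)) \<in> borel_measurable L"
      if [measurable]: "f' \<in> L \<rightarrow>\<^sub>M M" "g' \<in> L \<rightarrow>\<^sub>M M" for f' g' and L :: "(('x \<times> 'x) \<times> 'x) measure"
      using measurable_compose[OF measurable_Pair[OF that] Suc] by simp
    show ?case
      unfolding iter_kernel.simps push_def case_prod_beta' by measurable
  qed
  from measurable_compose[OF measurable_Pair[OF assms] this] show ?thesis by simp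
qed

lemma iter_kernel_w: "AE x in M. \<forall>n. (\<integral>\<^sup>+y. iter_kernel n x y * w y \<partial>M) = w x"
  using w_eigen AE_space
proof eventually_elim
  case (elim x)
  have "(\<integral>\<^sup>+y. iter_kernel n x y * w y \<partial>M) = w x" for n
    using elim by (induction n) (auto simp: integral_push_w)
  then show ?case by blast
qed

text \<open>
  Started from \<open>K x\<close> and \<open>w x * v\<close>, which have the same mass, the contraction gives the rate; the
  integrated initial distance is at most \<open>2 * \<integral> v W\<close>, \<open>W = w + \<beta> h\<close> being the contracted weight.
\<close>

lemma geometric_convergence:
  fixes \<kappa> :: real
  assumes [measurable]: "h \<in> borel_measurable M"
    and vh: "(\<integral>\<^sup>+x. v x * h x \<partial>M) < top"
    and \<kappa>: "0 < \<kappa>"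
    and drift: "AE x in M. pull h x \<le> ennreal (1 / 2) * h x + ennreal \<kappa> * w x"
    and minor: "\<And>B. 0 < B \<Longrightarrow> \<exists>\<eta>\<in>borel_measurable M. 0 < (\<integral>\<^sup>+y. \<eta> y * w y \<partial>M) \<and>
      (AE x in M. h x \<le> ennreal B * w x \<longrightarrow> (\<forall>y\<in>space M. w x * \<eta> y \<le> K x y))"
  shows "\<exists>\<rho> C. 0 < \<rho> \<and> \<rho> < 1 \<and> 0 < C \<and>
    (\<forall>n. (\<integral>\<^sup>+x. \<integral>\<^sup>+y. v x * absdiff (iter_kernel n x y) (w x * v y) * w y \<partial>M \<partial>M) \<le> ennreal (C * \<rho> ^ n))"
proof -
  obtain \<eta> where [measurable]: "\<eta> \<in> borel_measurable M" and \<eta>: "0 < (\<integral>\<^sup>+y. \<eta> y * w y \<partial>M)"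
    and \<eta>_minor: "AE x in M. h x \<le> ennreal (16 * \<kappa>) * w x \<longrightarrow> (\<forall>y\<in>space M. w x * \<eta> y \<le> K x y)"
    using minor[of "16 * \<kappa>"] \<kappa> by auto
  \<comment> \<open>The contraction asks for \<alpha> \<le> 1 / 2, whereas the integral of
    \<open>\<eta> * w\<close> may be larger or infinite; it is cut down accordingly.\<close>
  obtain \<alpha> where \<alpha>: "0 < \<alpha>" "\<alpha> \<le> 1 / 2" "ennreal \<alpha> \<le> (\<integral>\<^sup>+y. \<eta> y * w y \<partial>M)"
  proof (cases "(\<integral>\<^sup>+y. \<eta> y * w y \<partial>M)")
    case (real a)
    then show ?thesis using \<eta> by (intro that[of "min (1 / 2) a"]) (auto intro!: ennreal_leI)
  next
    case top
    then show ?thesis by (intro that[of "1 / 2"]) auto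
  qed
  define \<beta> where "\<beta> = \<alpha> / (2 * \<kappa>)"
  define \<rho> where "\<rho> = 1 - \<alpha> / 2"
  have \<rho>: "0 < \<rho>" "\<rho> < 1" using \<alpha> by (auto simp: \<rho>_def)
  define W where "W y = w y + ennreal \<beta> * h y" for y
  have [measurable]: "W \<in> borel_measurable M" unfolding W_def by measurable
  have wW: "w y \<le> W y" for y by (simp add: W_def)
  define D where "D n x = (\<integral>\<^sup>+y. absdiff (iter_kernel n x y) (w x * v y) * W y \<partial>M)" for n x
  have D_bound: "AE x in M. \<forall>n. D n x \<le> ennreal (\<rho> ^ n) * D 0 x"
    using iter_kernel_w w_pos AE_space
  proof eventually_elim
    case (elim x)
    note [measurable] = elim(3)
    have "D n x \<le> ennreal (\<rho> ^ n) * D 0 x" for n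
    proof (induction n)
      case (Suc n)
      \<comment> \<open>\<open>w x * v\<close> is fixed by \<open>push\<close> and has mass
        \<open>w x\<close>, like every \<open>iter_kernel n x\<close>. Comparing with it at each
        step, the contraction can be iterated.\<close>
      have push_wv: "AE y in M. push (\<lambda>y. w x * v y) y = w x * v y"
        using v_eigen AE_space
      proof eventually_elim
        case (elim y)
        note [measurable] = elim(2)
        show ?case using elim(1) by (simp add: push_def mult.assoc nn_integral_cmult)
      qed
      have int: "(\<integral>\<^sup>+y. w x * v y * w y \<partial>M) = w x"
        using vw by (simp add: mult.assoc nn_integral_cmult)
      have "D (Suc n) x = (\<integral>\<^sup>+y. absdiff (push (iter_kernel n x) y) (push (\<lambda>y. w x * v y) y) * W y \<partial>M)"
        unfolding D_def using push_wv by (intro nn_integral_cong_AE) auto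
      also have "\<dots> \<le> ennreal \<rho> * D n x"
        unfolding D_def W_def \<rho>_def
        by (rule push_contraction[OF _ _ \<kappa> drift \<eta>_minor \<alpha> \<beta>_def])
          (use elim in \<open>auto simp: int\<close>)
      also have "\<dots> \<le> ennreal \<rho> * (ennreal (\<rho> ^ n) * D 0 x)"
        using Suc by (rule mult_left_mono) simp
      finally show ?case using \<rho> by (simp add: ennreal_mult mult.assoc)
    qed simp
    then show ?case by blast
  qed
  have [measurable]: "D n \<in> borel_measurable M" for n
    unfolding D_def by measurable
  have vW: "(\<integral>\<^sup>+y. v y * W y \<partial>M) < top"
  proof -
    have "(\<integral>\<^sup>+y. v y * W y \<partial>M) = (\<integral>\<^sup>+y. v y * w y \<partial>M) + ennreal \<beta> * (\<integral>\<^sup>+y. v y * h y \<partial>M)"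
      unfolding W_def by (simp add: distrib_left nn_integral_add nn_integral_cmult[symmetric] mult_ac)
    also have "\<dots> < top" using vh vw by (simp add: ennreal_mult_less_top)
    finally show ?thesis .
  qed
  \<comment> \<open>The initial distance is bounded by \<open>K x y + w x * v y\<close>. Integrated
    against \<open>v\<close>, the first summand gives the integral of \<open>v * W\<close> because
    \<open>push\<close> fixes \<open>v\<close>, the second because v * w has integral 1.\<close>
  have D0: "(\<integral>\<^sup>+x. v x * D 0 x \<partial>M) \<le> 2 * (\<integral>\<^sup>+y. v y * W y \<partial>M)"
  proof -
    have "(\<integral>\<^sup>+x. v x * D 0 x \<partial>M)
        \<le> (\<integral>\<^sup>+x. v x * pull W x + v x * w x * (\<integral>\<^sup>+y. v y * W y \<partial>M) \<partial>M)"
    proof (intro nn_integral_mono)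
      fix x assume [measurable]: "x \<in> space M"
      have "D 0 x \<le> (\<integral>\<^sup>+y. (K x y + w x * v y) * W y \<partial>M)"
        unfolding D_def by (intro nn_integral_mono mult_right_mono) (auto intro: absdiff_le_add)
      also have "\<dots> = pull W x + w x * (\<integral>\<^sup>+y. v y * W y \<partial>M)"
        unfolding pull_def
        by (simp add: distrib_left distrib_right nn_integral_add nn_integral_cmult[symmetric] mult_ac)
      finally show "v x * D 0 x \<le> v x * pull W x + v x * w x * (\<integral>\<^sup>+y. v y * W y \<partial>M)"
        by (metis distrib_left mult.assoc mult_left_mono zero_le)
    qed
    also have "\<dots> = (\<integral>\<^sup>+y. push v y * W y \<partial>M) + (\<integral>\<^sup>+y. v y * W y \<partial>M)"
      using vw by (simp add: nn_integral_add nn_integral_multc push_pull)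
    also have "(\<integral>\<^sup>+y. push v y * W y \<partial>M) = (\<integral>\<^sup>+y. v y * W y \<partial>M)"
      using push_v by (intro nn_integral_cong_AE) auto
    finally show ?thesis by (simp add: mult_2)
  qed
  define C where "C = enn2real (2 * (\<integral>\<^sup>+y. v y * W y \<partial>M)) + 1"
  have C: "0 < C" "(\<integral>\<^sup>+x. v x * D 0 x \<partial>M) \<le> ennreal C"
  proof -
    show "0 < C" by (simp add: C_def add_nonneg_pos)
    have "2 * (\<integral>\<^sup>+y. v y * W y \<partial>M) < top" using vW by (simp add: ennreal_mult_less_top)
    then have "2 * (\<integral>\<^sup>+y. v y * W y \<partial>M) = ennreal (enn2real (2 * (\<integral>\<^sup>+y. v y * W y \<partial>M)))" by simp
    also have "\<dots> \<le> ennreal C" unfolding C_def by (intro ennreal_leI) simp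
    finally show "(\<integral>\<^sup>+x. v x * D 0 x \<partial>M) \<le> ennreal C" using D0 by (rule order_trans[rotated])
  qed
  have "(\<integral>\<^sup>+x. \<integral>\<^sup>+y. v x * absdiff (iter_kernel n x y) (w x * v y) * w y \<partial>M \<partial>M) \<le> ennreal (C * \<rho> ^ n)" for n
  proof -
    have "(\<integral>\<^sup>+x. \<integral>\<^sup>+y. v x * absdiff (iter_kernel n x y) (w x * v y) * w y \<partial>M \<partial>M)
        \<le> (\<integral>\<^sup>+x. ennreal (\<rho> ^ n) * (v x * D 0 x) \<partial>M)"
    proof (rule nn_integral_mono_AE)
      show "AE x in M. (\<integral>\<^sup>+y. v x * absdiff (iter_kernel n x y) (w x * v y) * w y \<partial>M)
          \<le> ennreal (\<rho> ^ n) * (v x * D 0 x)"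
        using D_bound AE_space
      proof eventually_elim
        case (elim x)
        note [measurable] = elim(2)
        have "(\<integral>\<^sup>+y. v x * absdiff (iter_kernel n x y) (w x * v y) * w y \<partial>M) \<le> v x * D n x"
          unfolding D_def
          by (subst nn_integral_cmult[symmetric])
            (auto intro!: nn_integral_mono mult_left_mono wW simp: mult.assoc)
        also have "\<dots> \<le> v x * (ennreal (\<rho> ^ n) * D 0 x)"
          using elim by (intro mult_left_mono) auto
        finally show ?case by (simp add: mult_ac)
      qed
    qed
    also have "\<dots> = ennreal (\<rho> ^ n) * (\<integral>\<^sup>+x. v x * D 0 x \<partial>M)"
      by (rule nn_integral_cmult) measurable
    also have "\<dots> \<le> ennreal (\<rho> ^ n) * ennreal C"
      using C(2) by (rule mult_left_mono) simp
    finally show ?thesis using \<rho> C(1) by (simp add: ennreal_mult[symmetric] mult.commute)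
  qed
  then show ?thesis using \<rho> C(1) by blast
qed

end

section \<open>Lyapunov functions for Hilbert--Schmidt kernels\<close>

lemma ennreal_mult_le_power2: "a * b \<le> a\<^sup>2 + (b::ennreal)\<^sup>2"
proof (cases "a \<le> b")
  case True
  then have "a * b \<le> b\<^sup>2" unfolding power2_eq_square by (rule mult_right_mono) simp
  then show ?thesis by (rule add_increasing[OF zero_le])
next
  case False
  then have "a * b \<le> a\<^sup>2" unfolding power2_eq_square by (intro mult_left_mono) auto
  then show ?thesis by (rule add_increasing2[OF zero_le])
qed

lemma ennreal_power2_add_le: "(a + b)\<^sup>2 \<le> 2 * a\<^sup>2 + 2 * (b::ennreal)\<^sup>2"
proof -
  have "2 * a * b = a * b + a * b" by (simp add: mult_2 distrib_right)
  then have "(a + b)\<^sup>2 = a\<^sup>2 + b\<^sup>2 + 2 * a * b"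
    by (simp add: power2_eq_square distrib_left distrib_right mult_ac add_ac)
  also have "\<dots> \<le> a\<^sup>2 + b\<^sup>2 + (a\<^sup>2 + b\<^sup>2)"
    by (intro add_left_mono sum_of_squares_ge_ennreal)
  finally show ?thesis by (simp add: mult_2 add_ac)
qed

text \<open>The square of the supremum is a double supremum over \<open>f n * f m\<close>, dominated
  by its diagonal.\<close>

lemma ennreal_SUP_power2_le:
  fixes f :: "nat \<Rightarrow> ennreal"
  assumes "incseq f"
  shows "(SUP n. f n)\<^sup>2 \<le> (SUP n. (f n)\<^sup>2)"
proof -
  have "(SUP n. f n)\<^sup>2 = (SUP m. SUP n. f n * f m)"
    by (simp add: power2_eq_square SUP_mult_left_ennreal SUP_mult_right_ennreal)
  also have "\<dots> \<le> (SUP n. (f n)\<^sup>2)"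
  proof (intro SUP_least)
    fix m n
    have "f n * f m \<le> (f (max m n))\<^sup>2"
      unfolding power2_eq_square using assms by (intro mult_mono) (auto simp: incseq_def)
    also have "\<dots> \<le> (SUP n. (f n)\<^sup>2)" by (rule SUP_upper) simp
    finally show "f n * f m \<le> (SUP n. (f n)\<^sup>2)" .
  qed
  finally show ?thesis .
qed

text \<open>Continuity from above along the complements, whose intersection is a null set.\<close>

lemma emeasure_exhaustion:
  assumes fin: "emeasure N (space N) < top"
    and [measurable]: "\<And>k::nat. C k \<in> sets N"
    and inc: "incseq C" and exh: "AE x in N. \<exists>k. x \<in> C k" and "0 < \<epsilon>"
  shows "\<exists>k. emeasure N (space N - C k) < \<epsilon>"
proof -
  have "(\<lambda>k. emeasure N (space N - C k)) \<longlonglongrightarrow> emeasure N (\<Inter>k. space N - C k)"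
  proof (rule Lim_emeasure_decseq)
    show "decseq (\<lambda>k. space N - C k)" using inc by (auto simp: decseq_def incseq_def)
    show "emeasure N (space N - C k) \<noteq> \<infinity>" for k
      using fin emeasure_mono[of "space N - C k" "space N" N] by (auto simp: less_top top_unique)
  qed auto
  also have "emeasure N (\<Inter>k. space N - C k) = 0"
  proof -
    have "(\<Inter>k. space N - C k) = {x \<in> space N. \<forall>k. x \<notin> C k}" by auto
    then show ?thesis using exh by (simp add: emeasure_eq_0_AE)
  qed
  finally have "\<forall>\<^sub>F k in sequentially. emeasure N (space N - C k) < \<epsilon>"
    using \<open>0 < \<epsilon>\<close> by (rule order_tendstoD(2))
  then show ?thesis by (auto dest: eventually_happens)
qed

text \<open>\<open>\<tau>\<close> counts to how many complements of selected sets
  \<open>C (n j)\<close> a point belongs. The j-th complement is selected with measure below 2^(-j),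
  so \<open>\<tau>\<close> is integrable. A point outside \<open>C k\<close>, where k is the maximum
  of n 0, ..., n m, lies in at least m + 1 of the complements, so a bound on \<open>\<tau>\<close>
  confines it to one \<open>C k\<close>.\<close>

lemma moderate_exhaustion_function:
  assumes fin: "emeasure N (space N) < top"
    and C[measurable]: "\<And>k::nat. C k \<in> sets N"
    and inc: "incseq C" and exh: "AE x in N. \<exists>k. x \<in> C k"
  shows "\<exists>\<tau>\<in>borel_measurable N. (\<integral>\<^sup>+x. \<tau> x \<partial>N) < top \<and>
    (\<forall>B::real. \<exists>k. \<forall>x\<in>space N. \<tau> x \<le> ennreal B \<longrightarrow> x \<in> C k)"
proof -
  have "\<exists>k. emeasure N (space N - C k) < ennreal ((1 / 2) ^ j)" for j :: nat
    by (rule emeasure_exhaustion[OF assms]) simp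
  then obtain n where n: "emeasure N (space N - C (n j)) < ennreal ((1 / 2) ^ j)" for j :: nat
    by metis
  define \<tau> where "\<tau> x = (\<Sum>j. indicator (space N - C (n j)) x :: ennreal)" for x
  have [measurable]: "\<tau> \<in> borel_measurable N" unfolding \<tau>_def by measurable
  have "(\<integral>\<^sup>+x. \<tau> x \<partial>N) = (\<Sum>j. emeasure N (space N - C (n j)))"
    unfolding \<tau>_def by (subst nn_integral_suminf) auto
  also have "\<dots> \<le> (\<Sum>j. ennreal ((1 / 2) ^ j))"
    by (intro suminf_le less_imp_le n) auto
  also have "\<dots> = ennreal (\<Sum>j. (1 / 2) ^ j)"
    by (intro suminf_ennreal2 summable_geometric) auto
  finally have int: "(\<integral>\<^sup>+x. \<tau> x \<partial>N) < top" by (auto intro: le_less_trans)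
  have "\<exists>k. \<forall>x\<in>space N. \<tau> x \<le> ennreal B \<longrightarrow> x \<in> C k" for B :: real
  proof -
    obtain m :: nat where m: "B < real m" using reals_Archimedean2 by blast
    define k where "k = Max (n ` {..m})"
    have "x \<in> C k" if x: "x \<in> space N" and le: "\<tau> x \<le> ennreal B" for x
    proof (rule ccontr)
      assume nx: "x \<notin> C k"
      have "x \<notin> C (n j)" if "j \<in> {..m}" for j
      proof -
        have "n j \<le> k" using that by (simp add: k_def)
        with inc have "C (n j) \<subseteq> C k" by (simp add: incseq_def)
        with nx show ?thesis by blast
      qed
      then have "(\<Sum>j\<in>{..m}. indicator (space N - C (n j)) x :: ennreal) = (\<Sum>j\<in>{..m}. 1)"
        using x by (intro sum.cong) auto
      moreover have "(\<Sum>j\<in>{..m}. indicator (space N - C (n j)) x :: ennreal) \<le> \<tau> x"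
        unfolding \<tau>_def by (rule sum_le_suminf) auto
      ultimately have "ennreal (real (Suc m)) \<le> \<tau> x"
        by (simp add: ennreal_of_nat_eq_real_of_nat)
      with le have "ennreal (real (Suc m)) \<le> ennreal B" by (rule order_trans[rotated])
      with m show False by (simp only: ennreal_le_iff2) auto
    qed
    then show ?thesis by blast
  qed
  with int show ?thesis by (intro bexI[of _ \<tau>]) auto
qed

section \<open>Drift and minorization for Hilbert--Schmidt kernels\<close>

context positive_kernel
begin

text \<open>
  The iteration \<open>f \<mapsto> h0 + 2 * indicator E * pull f\<close> stays bounded in \<open>L\<^sup>2\<close> because the
  Hilbert--Schmidt norm of \<open>2 * indicator E * K\<close> is at most \<open>1 / 2\<close>; \<open>h\<close> is its monotone limit.
\<close>

lemma lyapunov_on_small_norm_set: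
  assumes [measurable]: "h0 \<in> borel_measurable M" "E \<in> sets M"
    and small: "(\<integral>\<^sup>+x. (\<integral>\<^sup>+y. (K x y)\<^sup>2 \<partial>M) * indicator E x \<partial>M) \<le> ennreal (1 / 16)"
    and h0: "(\<integral>\<^sup>+x. (h0 x)\<^sup>2 \<partial>M) < top"
  shows "\<exists>h\<in>borel_measurable M. (\<integral>\<^sup>+x. (h x)\<^sup>2 \<partial>M) < top \<and> (\<forall>x. h0 x \<le> h x) \<and>
    (\<forall>x\<in>E. pull h x \<le> ennreal (1 / 2) * h x)"
proof -
  \<comment> \<open>The factor 2 makes \<open>T h \<le> h\<close> say that \<open>pull h\<close> is
    at most half of \<open>h\<close> on \<open>E\<close>, the drift rate of the contraction.\<close>
  define T where "T f x = 2 * pull f x * indicator E x" for f x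
  define H where "H = rec_nat h0 (\<lambda>_ f x. h0 x + T f x)"
  have H0: "H 0 = h0" and HS: "H (Suc n) = (\<lambda>x. h0 x + T (H n) x)" for n
    by (simp_all add: H_def)
  have [measurable]: "T f \<in> borel_measurable M" if [measurable]: "f \<in> borel_measurable M" for f
    unfolding T_def by measurable
  have [measurable]: "H n \<in> borel_measurable M" for n
    by (induction n) (simp_all add: H0 HS)
  have T_mono: "T f x \<le> T g x" if "\<And>x. f x \<le> g x" for f g x
    unfolding T_def pull_def using that
    by (intro mult_right_mono mult_left_mono nn_integral_mono) auto
  have "H n x \<le> H (Suc n) x" for n x
  proof (induction n arbitrary: x)
    case (Suc n)
    then show ?case by (simp add: HS T_mono)
  qed (simp add: H0 HS)
  then have inc: "incseq (\<lambda>n. H n x)" for x by (rule incseq_SucI)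
  \<comment> \<open>Cauchy--Schwarz in y. The constant is 4 * 1 / 16: the factor 2 squared times the
    assumed bound on the kernel.\<close>
  have T_norm: "(\<integral>\<^sup>+x. (T f x)\<^sup>2 \<partial>M) \<le> ennreal (1 / 4) * (\<integral>\<^sup>+x. (f x)\<^sup>2 \<partial>M)"
    if [measurable]: "f \<in> borel_measurable M" for f
  proof -
    have "(\<integral>\<^sup>+x. (T f x)\<^sup>2 \<partial>M)
        \<le> (\<integral>\<^sup>+x. (4 * (\<integral>\<^sup>+x. (f x)\<^sup>2 \<partial>M)) * ((\<integral>\<^sup>+y. (K x y)\<^sup>2 \<partial>M) * indicator E x) \<partial>M)"
    proof (rule nn_integral_mono)
      fix x assume [measurable]: "x \<in> space M"
      have "(pull f x)\<^sup>2 \<le> (\<integral>\<^sup>+y. (K x y)\<^sup>2 \<partial>M) * (\<integral>\<^sup>+x. (f x)\<^sup>2 \<partial>M)"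
        unfolding pull_def by (rule Cauchy_Schwarz_nn_integral) measurable
      then have "4 * (pull f x)\<^sup>2 * indicator E x
          \<le> 4 * ((\<integral>\<^sup>+y. (K x y)\<^sup>2 \<partial>M) * (\<integral>\<^sup>+x. (f x)\<^sup>2 \<partial>M)) * indicator E x"
        by (intro mult_left_mono mult_right_mono) auto
      moreover have "(T f x)\<^sup>2 = 4 * (pull f x)\<^sup>2 * indicator E x"
        by (simp add: T_def power_mult_distrib split: split_indicator)
      ultimately show "(T f x)\<^sup>2 \<le> (4 * (\<integral>\<^sup>+x. (f x)\<^sup>2 \<partial>M)) * ((\<integral>\<^sup>+y. (K x y)\<^sup>2 \<partial>M) * indicator E x)"
        by (simp only: mult_ac)
    qed
    also have "\<dots> = (4 * (\<integral>\<^sup>+x. (f x)\<^sup>2 \<partial>M)) * (\<integral>\<^sup>+x. (\<integral>\<^sup>+y. (K x y)\<^sup>2 \<partial>M) * indicator E x \<partial>M)"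
      by (rule nn_integral_cmult) measurable
    also have "\<dots> \<le> (4 * (\<integral>\<^sup>+x. (f x)\<^sup>2 \<partial>M)) * ennreal (1 / 16)"
      using small by (rule mult_left_mono) simp
    also have "\<dots> = ennreal (1 / 4) * (\<integral>\<^sup>+x. (f x)\<^sup>2 \<partial>M)"
    proof -
      have "(4 * A) * c = (4 * c) * A" for A c :: ennreal by (simp only: mult_ac)
      moreover have "4 * ennreal (1 / 16) = ennreal (1 / 4)"
        using ennreal_mult[of 4 "1 / 16"] by simp
      ultimately show ?thesis by simp
    qed
    finally show ?thesis .
  qed
  let ?A = "\<integral>\<^sup>+x. (h0 x)\<^sup>2 \<partial>M"
  \<comment> \<open>\<open>4 * ?A\<close> is the fixed point of the map that sends a to 2 * ?A + a /
    2, which is the recursion that the squared norms obey.\<close>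
  have H_norm: "(\<integral>\<^sup>+x. (H n x)\<^sup>2 \<partial>M) \<le> 4 * ?A" for n
  proof (induction n)
    case 0
    have "1 * ?A \<le> 4 * ?A" by (rule mult_right_mono) auto
    then show ?case by (simp add: H0)
  next
    case (Suc n)
    have "(\<integral>\<^sup>+x. (H (Suc n) x)\<^sup>2 \<partial>M) \<le> (\<integral>\<^sup>+x. 2 * (h0 x)\<^sup>2 + 2 * (T (H n) x)\<^sup>2 \<partial>M)"
      unfolding HS by (intro nn_integral_mono ennreal_power2_add_le)
    also have "\<dots> = 2 * ?A + 2 * (\<integral>\<^sup>+x. (T (H n) x)\<^sup>2 \<partial>M)"
      by (simp add: nn_integral_add nn_integral_cmult)
    also have "\<dots> \<le> 2 * ?A + 2 * (ennreal (1 / 4) * (4 * ?A))"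
      by (intro add_left_mono mult_left_mono order_trans[OF T_norm] Suc) auto
    also have "\<dots> = 4 * ?A"
    proof -
      have q: "2 * (c * (4 * A)) = 2 * (4 * c * A)" "2 * A + 2 * A = 4 * A" for c A :: ennreal
        by (simp only: mult_ac) (simp add: distrib_right[symmetric])
      have "4 * ennreal (1 / 4) = 1" using ennreal_mult[of 4 "1 / 4"] by simp
      then show ?thesis by (simp only: q mult_1)
    qed
    finally show ?case .
  qed
  define h where "h x = (SUP n. H n x)" for x
  have [measurable]: "h \<in> borel_measurable M" unfolding h_def by measurable
  have "(\<integral>\<^sup>+x. (h x)\<^sup>2 \<partial>M) \<le> (\<integral>\<^sup>+x. (SUP n. (H n x)\<^sup>2) \<partial>M)"
    unfolding h_def by (intro nn_integral_mono ennreal_SUP_power2_le inc)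
  also have "\<dots> = (SUP n. \<integral>\<^sup>+x. (H n x)\<^sup>2 \<partial>M)"
    using inc by (intro nn_integral_monotone_convergence_SUP)
      (auto simp: incseq_def le_fun_def intro!: power_mono)
  also have "\<dots> \<le> 4 * ?A" by (intro SUP_least H_norm)
  also have "\<dots> < top" using h0 by (simp add: ennreal_mult_less_top)
  finally have hL2: "(\<integral>\<^sup>+x. (h x)\<^sup>2 \<partial>M) < top" .
  have "pull h x \<le> ennreal (1 / 2) * h x" if x: "x \<in> E" for x
  proof -
    have [measurable]: "x \<in> space M" using x sets.sets_into_space[OF assms(2)] by auto
    \<comment> \<open>Monotone convergence takes \<open>pull\<close> through the supremum; each
      \<open>T (H n)\<close> is then bounded by the next iterate, hence by \<open>h\<close>.\<close>
    have "pull h x = (\<integral>\<^sup>+y. (SUP n. K x y * H n y) \<partial>M)"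
      unfolding pull_def h_def by (simp add: SUP_mult_left_ennreal)
    also have "\<dots> = (SUP n. pull (H n) x)"
      unfolding pull_def using inc by (intro nn_integral_monotone_convergence_SUP)
        (auto simp: incseq_def le_fun_def intro!: mult_left_mono)
    finally have "2 * pull h x = (SUP n. T (H n) x)"
      using x by (simp add: T_def SUP_mult_left_ennreal)
    also have "\<dots> \<le> h x"
    proof (rule SUP_least)
      fix n
      have "T (H n) x \<le> H (Suc n) x" by (simp add: HS)
      also have "\<dots> \<le> h x" unfolding h_def by (rule SUP_upper) simp
      finally show "T (H n) x \<le> h x" .
    qed
    finally have "ennreal (1 / 2) * (2 * pull h x) \<le> ennreal (1 / 2) * h x"
      by (rule mult_left_mono) simp
    moreover have "ennreal (1 / 2) * 2 = 1" using ennreal_mult[of "1 / 2" 2] by simp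
    ultimately show ?thesis by (simp add: mult.assoc[symmetric])
  qed
  moreover have "h0 x \<le> h x" for x
    unfolding h_def H0[symmetric] by (rule SUP_upper) simp
  ultimately show ?thesis using hL2 by (intro bexI[of _ h]) auto
qed

text \<open>\<open>q x * g k y\<close> is a rank-one lower bound of the kernel on each set of an
  exhaustion. It is formulated without \<open>w\<close>, of which nothing explicit is known in
  applications; the comparison of \<open>q\<close> with \<open>w\<close> takes place inside, on
  smaller sets.\<close>

lemma geometric_convergence_Hilbert_Schmidt:
  fixes D :: "nat \<Rightarrow> 'x set" and q :: "'x \<Rightarrow> ennreal" and g :: "nat \<Rightarrow> 'x \<Rightarrow> ennreal"
  assumes HS: "(\<integral>\<^sup>+x. \<integral>\<^sup>+y. (K x y)\<^sup>2 \<partial>M \<partial>M) < top"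
    and v2: "(\<integral>\<^sup>+x. (v x)\<^sup>2 \<partial>M) < top" and w2: "(\<integral>\<^sup>+x. (w x)\<^sup>2 \<partial>M) < top"
    and [measurable]: "\<And>k. D k \<in> sets M" and D_inc: "incseq D" and D_exh: "(\<Union>k. D k) = space M"
    and [measurable]: "q \<in> borel_measurable M" and q: "\<And>x. 0 < q x" "\<And>x. q x < top"
    and [measurable]: "\<And>k. g k \<in> borel_measurable M" and g: "\<And>k y. 0 < g k y"
    and qg: "\<And>k x y. x \<in> D k \<Longrightarrow> y \<in> space M \<Longrightarrow> q x * g k y \<le> K x y"
  shows "\<exists>\<rho> C. 0 < \<rho> \<and> \<rho> < 1 \<and> 0 < C \<and>
    (\<forall>n. (\<integral>\<^sup>+x. \<integral>\<^sup>+y. v x * absdiff (iter_kernel n x y) (w x * v y) * w y \<partial>M \<partial>M) \<le> ennreal (C * \<rho> ^ n))"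
proof -
  define S where "S x = (\<integral>\<^sup>+y. (K x y)\<^sup>2 \<partial>M)" for x
  have [measurable]: "S \<in> borel_measurable M" unfolding S_def by measurable
  have S_fin: "AE x in M. S x < top"
  proof -
    have "(\<integral>\<^sup>+x. S x \<partial>M) \<noteq> \<infinity>" using HS by (simp add: S_def)
    then show ?thesis using nn_integral_PInf_AE[of S M] by (simp add: less_top)
  qed
  \<comment> \<open>Three bounds at once: the rank-one minorization on \<open>D k\<close>, a
    comparison that replaces \<open>q\<close> by \<open>w\<close> in it, and one that yields
    \<open>S x / w x \<le> (k + 1)^2 * w x\<close> for the drift. At almost every point all three
    hold for large k.\<close>
  define C where "C k = {x \<in> space M. x \<in> D k \<and> w x \<le> of_nat (Suc k) * q x \<and>
    S x \<le> (of_nat (Suc k))\<^sup>2 * (w x)\<^sup>2}" for k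
  have [measurable]: "C k \<in> sets M" for k unfolding C_def by measurable
  have C_inc: "incseq C"
  proof (rule incseq_SucI, safe)
    fix k x assume x: "x \<in> C k"
    have le: "(of_nat (Suc k) :: ennreal) \<le> of_nat (Suc (Suc k))" by (subst of_nat_le_iff) simp
    have "w x \<le> of_nat (Suc (Suc k)) * q x"
      using x by (auto simp: C_def simp del: of_nat_Suc intro: order_trans[OF _ mult_right_mono[OF le]])
    moreover have "S x \<le> (of_nat (Suc (Suc k)))\<^sup>2 * (w x)\<^sup>2"
      using x by (auto simp: C_def simp del: of_nat_Suc intro: order_trans[OF _ mult_right_mono[OF power_mono[OF le]]])
    moreover have "x \<in> D (Suc k)" using x D_inc by (auto simp: C_def incseq_Suc_iff)
    ultimately show "x \<in> C (Suc k)" using x by (auto simp: C_def)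
  qed
  have C_exh: "AE x in M. \<exists>k. x \<in> C k"
    using S_fin w_pos AE_space
  proof eventually_elim
    case (elim x)
    obtain k1 where k1: "x \<in> D k1" using elim D_exh by auto
    have "w x / q x < top" using elim q(1)[of x] by (auto simp: ennreal_divide_eq_top_iff less_top[symmetric])
    then obtain k2 where k2: "w x / q x < of_nat k2" using ennreal_Ex_less_of_nat by blast
    have "S x / (w x)\<^sup>2 < top"
      using elim by (auto simp: ennreal_divide_eq_top_iff less_top[symmetric] power2_eq_square)
    then obtain k3 where k3: "S x / (w x)\<^sup>2 < of_nat k3" using ennreal_Ex_less_of_nat by blast
    define k where "k = max k1 (max k2 k3)"
    have "D k1 \<subseteq> D k" using D_inc by (auto simp: k_def incseq_def)
    then have "x \<in> D k" using k1 by blast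
    moreover have "w x \<le> of_nat (Suc k) * q x"
    proof -
      have "w x = w x / q x * q x"
        using q[of x] by (simp add: ennreal_divide_times)
      also have "\<dots> \<le> of_nat (Suc k) * q x"
        by (intro mult_right_mono order_trans[OF less_imp_le[OF k2]]) (auto simp: k_def simp del: of_nat_Suc)
      finally show ?thesis .
    qed
    moreover have "S x \<le> (of_nat (Suc k))\<^sup>2 * (w x)\<^sup>2"
    proof -
      have "S x = S x / (w x)\<^sup>2 * (w x)\<^sup>2"
        using elim by (subst ennreal_divide_times, subst ennreal_divide_self)
          (auto simp: power2_eq_square ennreal_mult_less_top)
      also have "\<dots> \<le> of_nat (Suc k) * (w x)\<^sup>2"
        by (intro mult_right_mono order_trans[OF less_imp_le[OF k3]]) (auto simp: k_def simp del: of_nat_Suc)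
      also have "\<dots> \<le> (of_nat (Suc k))\<^sup>2 * (w x)\<^sup>2"
      proof (intro mult_right_mono)
        have "(of_nat (Suc k) :: ennreal) = of_nat (Suc k * 1)" by simp
        also have "\<dots> \<le> of_nat (Suc k * Suc k)" by (subst of_nat_le_iff) simp
        finally show "of_nat (Suc k) \<le> (of_nat (Suc k) :: ennreal)\<^sup>2"
          by (simp only: power2_eq_square of_nat_mult)
      qed simp
      finally show ?thesis .
    qed
    ultimately show ?case using elim by (auto simp: C_def simp del: of_nat_Suc)
  qed
  \<comment> \<open>The Hilbert--Schmidt condition makes the measure with density \<open>S\<close>
    finite, so outside a large \<open>C k0\<close> the squared norm of \<open>K\<close> falls below
    the 1 / 16 required by the Neumann iteration.\<close>
  obtain k0 where k0: "emeasure (density M S) (space (density M S) - C k0) < ennreal (1 / 16)"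
  proof -
    have "\<exists>k. emeasure (density M S) (space (density M S) - C k) < ennreal (1 / 16)"
    proof (rule emeasure_exhaustion)
      show "emeasure (density M S) (space (density M S)) < top"
        using HS by (simp add: emeasure_density S_def cong: nn_integral_cong_simp)
      show "AE x in density M S. \<exists>k. x \<in> C k"
        using C_exh by (subst AE_density) auto
    qed (use C_inc in auto)
    then show ?thesis using that by blast
  qed
  \<comment> \<open>Taken with respect to the measure with density \<open>w^2\<close>, so that
    \<open>w\<close> times the square root of \<open>\<tau>\<close> is square integrable.\<close>
  obtain \<tau> where [measurable]: "\<tau> \<in> borel_measurable M"
    and \<tau>_int: "(\<integral>\<^sup>+x. \<tau> x \<partial>density M (\<lambda>x. (w x)\<^sup>2)) < top"
    and \<tau>: "\<And>B::real. \<exists>k. \<forall>x\<in>space M. \<tau> x \<le> ennreal B \<longrightarrow> x \<in> C k"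
  proof -
    have "\<exists>\<tau>\<in>borel_measurable (density M (\<lambda>x. (w x)\<^sup>2)). (\<integral>\<^sup>+x. \<tau> x \<partial>density M (\<lambda>x. (w x)\<^sup>2)) < top \<and>
      (\<forall>B::real. \<exists>k. \<forall>x\<in>space (density M (\<lambda>x. (w x)\<^sup>2)). \<tau> x \<le> ennreal B \<longrightarrow> x \<in> C k)"
    proof (rule moderate_exhaustion_function)
      show "emeasure (density M (\<lambda>x. (w x)\<^sup>2)) (space (density M (\<lambda>x. (w x)\<^sup>2))) < top"
        using w2 by (simp add: emeasure_density cong: nn_integral_cong_simp)
      show "AE x in density M (\<lambda>x. (w x)\<^sup>2). \<exists>k. x \<in> C k"
        using C_exh by (subst AE_density) auto
    qed (use C_inc in auto)
    then show ?thesis using that by auto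
  qed
  have w2\<tau>: "(\<integral>\<^sup>+x. (w x)\<^sup>2 * \<tau> x \<partial>M) < top"
    using \<tau>_int by (simp add: nn_integral_density)
  have \<tau>_fin: "AE x in M. \<tau> x < top"
  proof -
    have "AE x in M. (w x)\<^sup>2 * \<tau> x \<noteq> \<infinity>"
      using w2\<tau> by (intro nn_integral_PInf_AE) auto
    then show ?thesis
      using w_pos by eventually_elim (auto simp: ennreal_mult_eq_top_iff less_top)
  qed
  \<comment> \<open>Since \<open>h0 \<le> h\<close>, a bound on \<open>h / w\<close> bounds the
    square root of \<open>\<tau>\<close>. \<open>enn2real\<close> sends an infinite value to 0,
    which by \<open>\<tau>_fin\<close> happens on a null set only.\<close>
  define h0 where "h0 x = w x * ennreal (sqrt (enn2real (\<tau> x)))" for x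
  have [measurable]: "h0 \<in> borel_measurable M" unfolding h0_def by measurable
  have "(\<integral>\<^sup>+x. (h0 x)\<^sup>2 \<partial>M) \<le> (\<integral>\<^sup>+x. (w x)\<^sup>2 * \<tau> x \<partial>M)"
  proof (intro nn_integral_mono)
    fix x
    have "(ennreal (sqrt (enn2real (\<tau> x))))\<^sup>2 \<le> \<tau> x"
      by (simp add: ennreal_power ennreal_enn2real_if)
    then show "(h0 x)\<^sup>2 \<le> (w x)\<^sup>2 * \<tau> x"
      unfolding h0_def power_mult_distrib by (rule mult_left_mono) simp
  qed
  then have h0L2: "(\<integral>\<^sup>+x. (h0 x)\<^sup>2 \<partial>M) < top" using w2\<tau> by (rule le_less_trans)
  have "(\<integral>\<^sup>+x. (\<integral>\<^sup>+y. (K x y)\<^sup>2 \<partial>M) * indicator (space M - C k0) x \<partial>M) \<le> ennreal (1 / 16)"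
    using k0 by (simp add: emeasure_density S_def less_imp_le)
  from lyapunov_on_small_norm_set[OF _ _ this h0L2] obtain h where [measurable]: "h \<in> borel_measurable M"
    and hL2: "(\<integral>\<^sup>+x. (h x)\<^sup>2 \<partial>M) < top" and h0h: "\<And>x. h0 x \<le> h x"
    and off: "\<And>x. x \<in> space M - C k0 \<Longrightarrow> pull h x \<le> ennreal (1 / 2) * h x"
    by auto
  \<comment> \<open>On \<open>C k0\<close>, \<open>pull h\<close> is at most \<open>S / w\<close>
    plus \<open>w\<close> times the squared norm of \<open>h\<close>, and \<open>S / w\<close> is at
    most \<open>(k0 + 1)^2 * w\<close>: these are the two summands.\<close>
  define \<kappa> where "\<kappa> = (real (Suc k0))\<^sup>2 + enn2real (\<integral>\<^sup>+x. (h x)\<^sup>2 \<partial>M)"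
  have \<kappa>: "0 < \<kappa>" by (simp add: \<kappa>_def add_pos_nonneg)
  have \<kappa>_eq: "ennreal \<kappa> = (of_nat (Suc k0))\<^sup>2 + (\<integral>\<^sup>+x. (h x)\<^sup>2 \<partial>M)"
    using hL2 by (simp add: \<kappa>_def ennreal_of_nat_eq_real_of_nat ennreal_power del: of_nat_Suc)
  show ?thesis
  proof (rule geometric_convergence[OF _ _ \<kappa>])
    have "(\<integral>\<^sup>+x. v x * h x \<partial>M) \<le> (\<integral>\<^sup>+x. (v x)\<^sup>2 + (h x)\<^sup>2 \<partial>M)"
      by (intro nn_integral_mono ennreal_mult_le_power2)
    also have "\<dots> = (\<integral>\<^sup>+x. (v x)\<^sup>2 \<partial>M) + (\<integral>\<^sup>+x. (h x)\<^sup>2 \<partial>M)"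
      by (rule nn_integral_add) auto
    also have "\<dots> < top" using v2 hL2 by simp
    finally show "(\<integral>\<^sup>+x. v x * h x \<partial>M) < top" .
    show "AE x in M. pull h x \<le> ennreal (1 / 2) * h x + ennreal \<kappa> * w x"
      using w_pos AE_space
    proof eventually_elim
      case (elim x)
      note [measurable] = elim(2)
      show ?case
      proof (cases "x \<in> C k0")
        case False
        then show ?thesis using off[of x] elim by (auto intro: add_increasing2)
      next
        case True
        \<comment> \<open>a * b \<le> a^2 + b^2 for a = K x y / w x and b = h y, multiplied by w x.
          After integration both terms are multiples of \<open>w x\<close> on
          \<open>C k0\<close>.\<close>
        have "pull h x \<le> (\<integral>\<^sup>+y. (K x y)\<^sup>2 / w x + w x * (h y)\<^sup>2 \<partial>M)"
          unfolding pull_def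
        proof (rule nn_integral_mono)
          fix y
          have Kw: "w x * (K x y / w x) = K x y"
            using elim ennreal_divide_times[of "K x y" "w x" "w x"] by (auto simp: mult.commute zero_less_iff_neq_zero)
          show "K x y * h y \<le> (K x y)\<^sup>2 / w x + w x * (h y)\<^sup>2"
          proof -
            have "K x y * h y = w x * (K x y / w x * h y)"
              by (simp only: mult.assoc[symmetric] Kw)
            also have "\<dots> \<le> w x * ((K x y / w x)\<^sup>2 + (h y)\<^sup>2)"
              by (intro mult_left_mono ennreal_mult_le_power2) simp
            also have "\<dots> = w x * (K x y / w x)\<^sup>2 + w x * (h y)\<^sup>2" by (rule distrib_left)
            also have "w x * (K x y / w x)\<^sup>2 = (K x y)\<^sup>2 / w x"
              by (simp only: power2_eq_square mult.assoc[symmetric] Kw) (rule ennreal_times_divide)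
            finally show ?thesis .
          qed
        qed
        also have "\<dots> = S x / w x + w x * (\<integral>\<^sup>+y. (h y)\<^sup>2 \<partial>M)"
          unfolding S_def by (simp add: nn_integral_add nn_integral_cmult nn_integral_divide)
        also have "\<dots> \<le> (of_nat (Suc k0))\<^sup>2 * w x + w x * (\<integral>\<^sup>+y. (h y)\<^sup>2 \<partial>M)"
        proof (intro add_right_mono)
          have "S x / w x \<le> (of_nat (Suc k0))\<^sup>2 * (w x)\<^sup>2 / w x"
            using True by (auto simp: C_def intro: divide_right_mono_ennreal)
          also have "\<dots> = (of_nat (Suc k0))\<^sup>2 * w x"
            using elim by (auto simp: power2_eq_square[of "w x"] ennreal_times_divide[symmetric] mult.assoc
              zero_less_iff_neq_zero simp del: of_nat_Suc)
          finally show "S x / w x \<le> (of_nat (Suc k0))\<^sup>2 * w x" .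
        qed
        also have "\<dots> = ennreal \<kappa> * w x"
          unfolding \<kappa>_eq by (simp add: distrib_right mult.commute[of "w x"] del: of_nat_Suc)
        finally show ?thesis by (auto intro: add_increasing)
      qed
    qed
    fix B :: real assume B: "0 < B"
    \<comment> \<open>\<open>h \<le> B * w\<close> forces the square root of \<open>\<tau>\<close>
      below B, hence the level B^2. Up to a null set the whole sublevel set then lies in one
      \<open>C k\<close>.\<close>
    obtain k where k: "\<And>x. x \<in> space M \<Longrightarrow> \<tau> x \<le> ennreal (B\<^sup>2) \<Longrightarrow> x \<in> C k"
      using \<tau> by blast
    \<comment> \<open>On \<open>C k\<close> only \<open>w x \<le> (k + 1) * q x\<close> is known;
      the division by k + 1 absorbs this factor.\<close>
    define \<eta> where "\<eta> y = g k y / of_nat (Suc k)" for y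
    have [measurable]: "\<eta> \<in> borel_measurable M" unfolding \<eta>_def by measurable
    have \<eta>_pos: "0 < \<eta> y" for y
      using g[of k y] by (auto simp: \<eta>_def zero_less_iff_neq_zero simp del: of_nat_Suc)
    show "\<exists>\<eta>\<in>borel_measurable M. 0 < (\<integral>\<^sup>+y. \<eta> y * w y \<partial>M) \<and>
      (AE x in M. h x \<le> ennreal B * w x \<longrightarrow> (\<forall>y\<in>space M. w x * \<eta> y \<le> K x y))"
    proof (intro bexI[of _ \<eta>] conjI)
      show "0 < (\<integral>\<^sup>+y. \<eta> y * w y \<partial>M)"
      proof (rule ccontr)
        assume "\<not> 0 < (\<integral>\<^sup>+y. \<eta> y * w y \<partial>M)"
        then have "AE y in M. \<eta> y * w y = 0" by (simp add: nn_integral_0_iff_AE)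
        then have "AE y in M. False"
          using w_pos
        proof eventually_elim
          case (elim y)
          then show ?case using \<eta>_pos[of y] by (auto simp: zero_less_iff_neq_zero)
        qed
        then have "(\<integral>\<^sup>+x. v x * w x \<partial>M) = (\<integral>\<^sup>+x. 0 \<partial>M)"
          by (intro nn_integral_cong_AE) auto
        then show False using vw by simp
      qed
      show "AE x in M. h x \<le> ennreal B * w x \<longrightarrow> (\<forall>y\<in>space M. w x * \<eta> y \<le> K x y)"
        using w_pos \<tau>_fin AE_space
      proof (eventually_elim, intro impI ballI)
        fix x y
        assume wx: "0 < w x \<and> w x < top" and "\<tau> x < top" and x: "x \<in> space M" and y: "y \<in> space M"
          and "h x \<le> ennreal B * w x"
        then have "w x * ennreal (sqrt (enn2real (\<tau> x))) \<le> w x * ennreal B"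
          using h0h[of x] by (simp add: h0_def mult.commute)
        then have "ennreal (sqrt (enn2real (\<tau> x))) \<le> ennreal B"
          using wx by (subst (asm) ennreal_mult_le_mult_iff) auto
        then have "sqrt (enn2real (\<tau> x)) \<le> B" using B by simp
        then have "enn2real (\<tau> x) \<le> B\<^sup>2" by (rule sqrt_le_D)
        then have "\<tau> x \<le> ennreal (B\<^sup>2)"
          using \<open>\<tau> x < top\<close> by (metis ennreal_enn2real ennreal_leI)
        then have xC: "x \<in> C k" using k x by blast
        have "w x * \<eta> y \<le> of_nat (Suc k) * q x * \<eta> y"
          using xC by (intro mult_right_mono) (auto simp: C_def)
        also have "\<dots> = q x * g k y"
        proof -
          have "of_nat (Suc k) * \<eta> y = g k y"
            unfolding \<eta>_def using ennreal_divide_times[of "g k y" "of_nat (Suc k)" "of_nat (Suc k)"]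
            by (simp add: mult.commute of_nat_less_top del: of_nat_Suc)
          then have "q x * (of_nat (Suc k) * \<eta> y) = q x * g k y" by simp
          then show ?thesis by (simp only: mult_ac)
        qed
        also have "\<dots> \<le> K x y" using xC y by (intro qg) (auto simp: C_def)
        finally show "w x * \<eta> y \<le> K x y" .
      qed
    qed simp
  qed simp
qed

end

section \<open>Factorization of past and future\<close>

text \<open>Dynkin's argument with finiteness assumed of \<open>N1\<close> alone:
  \<open>\<Omega> \<in> G\<close> transfers the total mass to \<open>N2\<close>. In the
  factorization below, \<open>N2\<close> has a density defined by an integral whose finiteness is
  not known beforehand.\<close>

lemma emeasure_eq_on_sigma_sets:
  assumes G: "Int_stable G" "G \<subseteq> Pow \<Omega>" "\<Omega> \<in> G"
    and sets: "G \<subseteq> sets N1" "sets N2 = sets N1" "space N1 = \<Omega>"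
    and eq: "\<And>A. A \<in> G \<Longrightarrow> emeasure N1 A = emeasure N2 A"
    and fin: "emeasure N1 \<Omega> < top"
    and A: "A \<in> sigma_sets \<Omega> G"
  shows "emeasure N1 A = emeasure N2 A"
proof -
  have meas: "sigma_sets \<Omega> G \<subseteq> sets N1"
    using sets.sigma_sets_subset[of G N1] sets by simp
  have sp: "space N2 = \<Omega>" using sets_eq_imp_space_eq[OF sets(2)] sets(3) by simp
  show ?thesis
    using G(1,2) A
  proof (induction rule: sigma_sets_induct_disjoint)
    case (compl A)
    have mA: "A \<in> sets N1" "A \<in> sets N2" using compl(1) meas sets(2) by auto
    have "emeasure N1 A \<le> emeasure N1 \<Omega>" "emeasure N2 A \<le> emeasure N2 \<Omega>"
      using mA emeasure_space[of N1 A] emeasure_space[of N2 A] sets(3) sp by simp_all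
    then have "emeasure N1 A \<noteq> \<infinity>" "emeasure N2 A \<noteq> \<infinity>"
      using fin eq[OF G(3)] by (auto simp: top_unique)
    then show ?case
      using emeasure_compl[OF mA(1)] emeasure_compl[OF mA(2)] compl(2) eq[OF G(3)] sets(3) sp by simp
  next
    case (union A)
    have "range A \<subseteq> sets N1" "range A \<subseteq> sets N2" using union(2) meas sets(2) by auto
    then show ?case
      using union(1,3) by (simp add: suminf_emeasure[symmetric])
  qed (use eq in auto)
qed

text \<open>The pi-system from which identities are extended to
  \<open>sigma_generated P M X I\<close>.\<close>

definition rectangles :: "'w measure \<Rightarrow> 'x measure \<Rightarrow> (int \<Rightarrow> 'w \<Rightarrow> 'x) \<Rightarrow> int set \<Rightarrow> 'w set set" where
  "rectangles P M X I =
    {{\<omega> \<in> space P. \<forall>t\<in>J. X t \<omega> \<in> a t} | J a. finite J \<and> J \<subseteq> I \<and> (\<forall>t. a t \<in> sets M)}"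

lemma Int_stable_rectangles:
  assumes X: "\<And>t \<omega>. \<omega> \<in> space P \<Longrightarrow> X t \<omega> \<in> space M"
  shows "Int_stable (rectangles P M X I)"
proof (rule Int_stableI)
  fix A B assume "A \<in> rectangles P M X I" "B \<in> rectangles P M X I"
  then obtain J a J' a' where A: "A = {\<omega> \<in> space P. \<forall>t\<in>J. X t \<omega> \<in> a t}" "finite J" "J \<subseteq> I" "\<forall>t. a t \<in> sets M"
    and B: "B = {\<omega> \<in> space P. \<forall>t\<in>J'. X t \<omega> \<in> a' t}" "finite J'" "J' \<subseteq> I" "\<forall>t. a' t \<in> sets M"
    unfolding rectangles_def by blast
  \<comment> \<open>A time missing from one of the index sets is unconstrained in that event, so it
    receives \<open>space M\<close> there; both events can then be read over the union of the index
    sets.\<close>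
  define b where "b t = (if t \<in> J then a t else space M) \<inter> (if t \<in> J' then a' t else space M)" for t
  have "X t \<omega> \<in> b t \<longleftrightarrow> (t \<in> J \<longrightarrow> X t \<omega> \<in> a t) \<and> (t \<in> J' \<longrightarrow> X t \<omega> \<in> a' t)"
    if "\<omega> \<in> space P" for t \<omega>
    using X[OF that] by (simp add: b_def)
  then have "A \<inter> B = {\<omega> \<in> space P. \<forall>t\<in>J \<union> J'. X t \<omega> \<in> b t}"
    unfolding A(1) B(1) by blast
  moreover have "b t \<in> sets M" for t using A(4) B(4) by (auto simp: b_def)
  ultimately show "A \<inter> B \<in> rectangles P M X I"
    using A(2,3) B(2,3) unfolding rectangles_def
    by (intro CollectI exI[of _ "J \<union> J'"] exI[of _ b]) auto
qed

lemma space_in_rectangles: "space P \<in> rectangles P M X I"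
  unfolding rectangles_def by (intro CollectI exI[of _ "{}"] exI[of _ "\<lambda>_. {}"]) auto

lemma rectangles_subset_Pow: "rectangles P M X I \<subseteq> Pow (space P)"
  unfolding rectangles_def by auto

lemma rectangles_measurable:
  assumes [measurable]: "\<And>t. X t \<in> P \<rightarrow>\<^sub>M M" and "A \<in> rectangles P M X I"
  shows "A \<in> sets P"
proof -
  obtain J a where A: "A = {\<omega> \<in> space P. \<forall>t\<in>J. X t \<omega> \<in> a t}" "finite J" and [measurable]: "\<And>t. a t \<in> sets M"
    using assms(2) unfolding rectangles_def by blast
  show ?thesis unfolding A(1) using A(2) by measurable
qed

lemma sigma_generated_eq_rectangles:
  "sigma_generated P M X I = sigma_sets (space P) (rectangles P M X I)"
  unfolding sigma_generated_def
proof (rule sigma_sets_eqI)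
  fix A assume "A \<in> (\<Union>t\<in>I. {X t -` B \<inter> space P |B. B \<in> sets M})"
  then obtain t B where "t \<in> I" "B \<in> sets M" "A = X t -` B \<inter> space P" by blast
  then have "A \<in> rectangles P M X I"
    unfolding rectangles_def by (intro CollectI exI[of _ "{t}"] exI[of _ "\<lambda>_. B"]) auto
  then show "A \<in> sigma_sets (space P) (rectangles P M X I)" by (rule sigma_sets.Basic)
next
  fix A assume "A \<in> rectangles P M X I"
  then obtain J a where A: "A = {\<omega> \<in> space P. \<forall>t\<in>J. X t \<omega> \<in> a t}" "finite J" "J \<subseteq> I" "\<forall>t. a t \<in> sets M"
    unfolding rectangles_def by blast
  define G where "G = (\<Union>t\<in>I. {X t -` B \<inter> space P |B. B \<in> sets M})"
  interpret sigma_algebra "space P" "sigma_sets (space P) G"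
    by (rule sigma_algebra_sigma_sets) (unfold G_def, blast)
  have "{\<omega> \<in> space P. \<forall>t\<in>J. X t \<omega> \<in> a t} \<in> sigma_sets (space P) G"
    using A(2,3)
  proof (induction J)
    case (insert t J)
    have "t \<in> I" using insert(4) by simp
    moreover have "X t -` a t \<inter> space P \<in> {X t -` B \<inter> space P |B. B \<in> sets M}"
      using A(4) by (intro CollectI exI[of _ "a t"]) simp
    ultimately have "X t -` a t \<inter> space P \<in> G" unfolding G_def by (rule UN_I)
    then have "X t -` a t \<inter> space P \<in> sigma_sets (space P) G" by (rule sigma_sets.Basic)
    moreover have "{\<omega> \<in> space P. \<forall>t\<in>J. X t \<omega> \<in> a t} \<in> sigma_sets (space P) G"
      using insert(3,4) by simp
    moreover have "{\<omega> \<in> space P. \<forall>t\<in>insert t J. X t \<omega> \<in> a t}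
        = (X t -` a t \<inter> space P) \<inter> {\<omega> \<in> space P. \<forall>t\<in>J. X t \<omega> \<in> a t}" by auto
    ultimately show ?case using Int by simp
  qed (simp add: sigma_sets_top)
  then show "A \<in> sigma_sets (space P) (\<Union>t\<in>I. {X t -` B \<inter> space P |B. B \<in> sets M})"
    unfolding A(1) G_def .
qed

lemma sigma_generated_measurable:
  assumes "\<And>t. X t \<in> P \<rightarrow>\<^sub>M M" and "A \<in> sigma_generated P M X I"
  shows "A \<in> sets P"
proof -
  have "rectangles P M X I \<subseteq> sets P" using rectangles_measurable[of X, OF assms(1)] by blast
  then show ?thesis
    using assms(2) subsetD[OF sets.sigma_sets_subset] unfolding sigma_generated_eq_rectangles by metis
qed

section \<open>Expectations along a path: forward and backward recursions\<close>

context positive_kernel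
begin

text \<open>A Feynman--Kac recursion: \<open>forward u n y * w y\<close> is the density at y of the
  n-th position of the path weighted by the n + 1 factors u 0, ..., u n. The factor \<open>w\<close>
  is left out so that the recursion can go on.\<close>

primrec forward :: "(nat \<Rightarrow> 'x \<Rightarrow> ennreal) \<Rightarrow> nat \<Rightarrow> 'x \<Rightarrow> ennreal" where
  "forward u 0 = (\<lambda>y. v y * u 0 y)"
| "forward u (Suc n) = (\<lambda>y. push (forward u n) y * u (Suc n) y)"

text \<open>The dual recursion: \<open>backward u n g x\<close> accounts for the present position x
  and the n steps after it, with terminal function \<open>g\<close>. Shifting \<open>u\<close> keeps
  the present at index 0.\<close>

primrec backward :: "(nat \<Rightarrow> 'x \<Rightarrow> ennreal) \<Rightarrow> nat \<Rightarrow> ('x \<Rightarrow> ennreal) \<Rightarrow> 'x \<Rightarrow> ennreal" where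
  "backward u 0 g = (\<lambda>x. u 0 x * g x)"
| "backward u (Suc n) g = (\<lambda>x. u 0 x * pull (backward (\<lambda>t. u (Suc t)) n g) x)"

lemma forward_measurable[measurable]:
  assumes [measurable]: "\<And>t. u t \<in> borel_measurable M"
  shows "forward u n \<in> borel_measurable M"
  by (induction n) simp_all

lemma backward_measurable[measurable]:
  assumes "\<And>t. u t \<in> borel_measurable M" and [measurable]: "g \<in> borel_measurable M"
  shows "backward u n g \<in> borel_measurable M"
  using assms(1) by (induction n arbitrary: u) simp_all

lemma forward_cong: "(\<And>t. t \<le> n \<Longrightarrow> u t = u' t) \<Longrightarrow> forward u n = forward u' n"
  by (induction n) simp_all

text \<open>Each use of \<open>push_pull\<close> moves the pairing of past and future back by one
  step; here it stops between the times k and k + 1.\<close>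

lemma forward_backward:
  assumes [measurable]: "\<And>t. u t \<in> borel_measurable M" "g \<in> borel_measurable M"
  shows "(\<integral>\<^sup>+y. forward u (k + Suc n) y * g y \<partial>M)
    = (\<integral>\<^sup>+y. push (forward u k) y * backward (\<lambda>t. u (k + Suc t)) n g y \<partial>M)"
proof (induction n arbitrary: k)
  case 0
  show ?case by (simp add: mult.assoc)
next
  case (Suc n)
  have "(\<integral>\<^sup>+y. forward u (k + Suc (Suc n)) y * g y \<partial>M)
      = (\<integral>\<^sup>+y. push (forward u (Suc k)) y * backward (\<lambda>t. u (Suc k + Suc t)) n g y \<partial>M)"
    using Suc[of "Suc k"] by simp
  also have "\<dots> = (\<integral>\<^sup>+y. forward u (Suc k) y * pull (backward (\<lambda>t. u (Suc k + Suc t)) n g) y \<partial>M)"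
    by (rule push_pull) measurable
  also have "\<dots> = (\<integral>\<^sup>+y. push (forward u k) y * backward (\<lambda>t. u (k + Suc t)) (Suc n) g y \<partial>M)"
    by (simp add: mult.assoc)
  finally show ?case .
qed

text \<open>The pairing moved back to the first time, where all that remains of the past is
  \<open>v\<close>.\<close>

lemma forward_eq_backward:
  assumes [measurable]: "\<And>t. u t \<in> borel_measurable M" "g \<in> borel_measurable M"
  shows "(\<integral>\<^sup>+y. forward u n y * g y \<partial>M) = (\<integral>\<^sup>+y. v y * backward u n g y \<partial>M)"
proof (cases n)
  case 0
  then show ?thesis by (simp add: mult.assoc)
next
  case (Suc j)
  have "(\<integral>\<^sup>+y. forward u n y * g y \<partial>M) = (\<integral>\<^sup>+y. push (forward u 0) y * backward (\<lambda>t. u (0 + Suc t)) j g y \<partial>M)"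
    unfolding Suc using forward_backward[of u g 0 j] by simp
  also have "\<dots> = (\<integral>\<^sup>+y. forward u 0 y * pull (backward (\<lambda>t. u (0 + Suc t)) j g) y \<partial>M)"
    by (rule push_pull) measurable
  finally show ?thesis by (simp add: Suc mult.assoc)
qed

text \<open>Across n unconstrained times the recursion is n + 1 applications of \<open>push\<close>,
  which by Tonelli amount to one integration against \<open>iter_kernel n\<close>.\<close>

lemma forward_gap:
  assumes [measurable]: "\<And>t. u t \<in> borel_measurable M"
    and gap: "\<And>t. k < t \<Longrightarrow> t \<le> k + n \<Longrightarrow> u t = (\<lambda>_. 1)" and y: "y \<in> space M"
  shows "push (forward u (k + n)) y = (\<integral>\<^sup>+x. forward u k x * iter_kernel n x y \<partial>M)"
  using gap y
proof (induction n arbitrary: y)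
  case 0
  show ?case by (simp add: push_def)
next
  case (Suc n)
  note [measurable] = Suc.prems(2)
  have "push (forward u (k + Suc n)) y = (\<integral>\<^sup>+z. push (forward u (k + n)) z * K z y \<partial>M)"
    using Suc.prems(1)[of "Suc (k + n)"] by (simp add: push_def)
  also have "\<dots> = (\<integral>\<^sup>+z. (\<integral>\<^sup>+x. forward u k x * iter_kernel n x z \<partial>M) * K z y \<partial>M)"
    using Suc by (intro nn_integral_cong) simp
  also have "\<dots> = (\<integral>\<^sup>+z. \<integral>\<^sup>+x. forward u k x * iter_kernel n x z * K z y \<partial>M \<partial>M)"
    by (intro nn_integral_cong) (simp add: nn_integral_multc)
  also have "\<dots> = (\<integral>\<^sup>+x. \<integral>\<^sup>+z. forward u k x * iter_kernel n x z * K z y \<partial>M \<partial>M)"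
    by (rule Tonelli) measurable
  also have "\<dots> = (\<integral>\<^sup>+x. forward u k x * iter_kernel (Suc n) x y \<partial>M)"
    by (intro nn_integral_cong) (simp add: push_def nn_integral_cmult[symmetric] mult.assoc)
  finally show ?case .
qed

text \<open>Density of the law of \<open>(X 0, X (n + 1))\<close> with respect to the product of its marginals.\<close>

definition ratio :: "nat \<Rightarrow> 'x \<Rightarrow> 'x \<Rightarrow> ennreal" where
  "ratio n x y = iter_kernel n x y / (w x * v y)"

lemma ratio_measurable[measurable (raw)]:
  assumes [measurable]: "f \<in> N \<rightarrow>\<^sub>M M" "g \<in> N \<rightarrow>\<^sub>M M"
  shows "(\<lambda>x. ratio n (f x) (g x)) \<in> borel_measurable N"
  unfolding ratio_def by measurable

lemma ratio_times:
  assumes "0 < w x" "w x < top" "0 < v y" "v y < top"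
  shows "w x * v y * ratio n x y = iter_kernel n x y"
proof -
  have "0 < w x * v y" "w x * v y < top"
    using assms by (auto simp: ennreal_zero_less_mult_iff ennreal_mult_less_top)
  then show ?thesis
    unfolding ratio_def using ennreal_divide_times[of "iter_kernel n x y" "w x * v y" "w x * v y"]
    by (auto simp: mult.commute zero_less_iff_neq_zero)
qed

end

text \<open>\<open>law\<close> describes windows m, ..., m + n, with n + 1 factors. Its right-hand
  side is free of m, so it includes the stationarity of the finite-dimensional laws.\<close>

locale kernel_process = positive_kernel M K v w + P: prob_space P
  for M :: "'x measure" and K v w and P :: "'w measure" +
  fixes X :: "int \<Rightarrow> 'w \<Rightarrow> 'x"
  assumes X_measurable[measurable]: "\<And>t. X t \<in> P \<rightarrow>\<^sub>M M"
    and law: "\<And>u n m. (\<And>t. u t \<in> borel_measurable M) \<Longrightarrow>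
      (\<integral>\<^sup>+\<omega>. (\<Prod>t\<le>n. u t (X (m + int t) \<omega>)) \<partial>P) = (\<integral>\<^sup>+y. forward u n y * w y \<partial>M)"
begin

text \<open>A function of the last variable is absorbed into \<open>u n\<close>; in
  \<open>law_future\<close> one of the first variable is absorbed into \<open>u 0\<close>.\<close>

lemma law_past:
  assumes [measurable]: "\<And>t. u t \<in> borel_measurable M" "\<phi> \<in> borel_measurable M"
  shows "(\<integral>\<^sup>+\<omega>. (\<Prod>t\<le>n. u t (X (m + int t) \<omega>)) * \<phi> (X (m + int n) \<omega>) \<partial>P)
    = (\<integral>\<^sup>+y. forward u n y * \<phi> y * w y \<partial>M)"
proof -
  define u' where "u' = u(n := (\<lambda>x. u n x * \<phi> x))"
  have [measurable]: "u' t \<in> borel_measurable M" for t by (simp add: u'_def)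
  have "(\<Prod>t\<le>n. u' t (X (m + int t) \<omega>)) = (\<Prod>t\<le>n. u t (X (m + int t) \<omega>)) * \<phi> (X (m + int n) \<omega>)" for \<omega>
  proof -
    have "{..n} = insert n {..<n}" by auto
    moreover have "(\<Prod>t<n. u' t (X (m + int t) \<omega>)) = (\<Prod>t<n. u t (X (m + int t) \<omega>))"
      by (intro prod.cong) (auto simp: u'_def)
    ultimately show ?thesis by (simp add: u'_def mult_ac)
  qed
  then have "(\<integral>\<^sup>+\<omega>. (\<Prod>t\<le>n. u t (X (m + int t) \<omega>)) * \<phi> (X (m + int n) \<omega>) \<partial>P)
      = (\<integral>\<^sup>+y. forward u' n y * w y \<partial>M)"
    using law[of u' m n] by simp
  also have "forward u' n = (\<lambda>y. forward u n y * \<phi> y)"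
  proof (cases n)
    case (Suc k)
    have "forward u' k = forward u k" by (rule forward_cong) (auto simp: u'_def Suc)
    then show ?thesis by (simp add: Suc) (simp add: u'_def Suc mult.assoc)
  qed (simp add: u'_def mult.assoc)
  finally show ?thesis .
qed

lemma law_future:
  assumes [measurable]: "\<And>t. u t \<in> borel_measurable M" "\<psi> \<in> borel_measurable M"
  shows "(\<integral>\<^sup>+\<omega>. (\<Prod>t\<le>n. u t (X (m + int t) \<omega>)) * \<psi> (X m \<omega>) \<partial>P)
    = (\<integral>\<^sup>+y. v y * \<psi> y * backward u n w y \<partial>M)"
proof -
  define u' where "u' = u(0 := (\<lambda>x. u 0 x * \<psi> x))"
  have [measurable]: "u' t \<in> borel_measurable M" for t by (simp add: u'_def)
  have "(\<Prod>t\<le>n. u' t (X (m + int t) \<omega>)) = (\<Prod>t\<le>n. u t (X (m + int t) \<omega>)) * \<psi> (X m \<omega>)" for \<omega>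
  proof -
    have "{..n} = insert 0 {0<..n}" by auto
    moreover have "(\<Prod>t\<in>{0<..n}. u' t (X (m + int t) \<omega>)) = (\<Prod>t\<in>{0<..n}. u t (X (m + int t) \<omega>))"
      by (intro prod.cong) (auto simp: u'_def)
    ultimately show ?thesis by (simp add: u'_def mult_ac)
  qed
  then have "(\<integral>\<^sup>+\<omega>. (\<Prod>t\<le>n. u t (X (m + int t) \<omega>)) * \<psi> (X m \<omega>) \<partial>P)
      = (\<integral>\<^sup>+y. v y * backward u' n w y \<partial>M)"
    using law[of u' m n] by (simp add: forward_eq_backward)
  also have "backward u' n w = (\<lambda>y. \<psi> y * backward u n w y)"
    by (cases n) (simp_all add: u'_def mult_ac)
  finally show ?thesis by (simp add: mult.assoc)
qed

lemma law_single:
  assumes [measurable]: "\<phi> \<in> borel_measurable M"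
  shows "(\<integral>\<^sup>+\<omega>. \<phi> (X t \<omega>) \<partial>P) = (\<integral>\<^sup>+y. v y * \<phi> y * w y \<partial>M)"
  using law_past[of "\<lambda>_ _. 1" \<phi> t 0] by simp

text \<open>Both sides reduce to the double integral of
  \<open>forward a k x * iter_kernel n x y * backward b j w y\<close>. On the left the kernel comes
  from the gap. On the right the past and an independent copy of the future contribute the weights
  \<open>w x\<close> and \<open>v y\<close>, which \<open>ratio_times\<close> merges with
  \<open>ratio\<close> into the kernel.\<close>

lemma factorization_windows:
  assumes [measurable]: "\<And>t. a t \<in> borel_measurable M" "\<And>t. b t \<in> borel_measurable M"
  shows "(\<integral>\<^sup>+\<omega>. (\<Prod>t\<le>k. a t (X (- int k + int t) \<omega>)) * (\<Prod>t\<le>j. b t (X (int n + 1 + int t) \<omega>)) \<partial>P)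
    = (\<integral>\<^sup>+\<omega>. \<integral>\<^sup>+\<omega>'. (\<Prod>t\<le>k. a t (X (- int k + int t) \<omega>)) *
        (\<Prod>t\<le>j. b t (X (int n + 1 + int t) \<omega>')) * ratio n (X 0 \<omega>) (X (int n + 1) \<omega>') \<partial>P \<partial>P)"
    (is "?L = ?R")
proof -
  \<comment> \<open>A single window from time -k to time n + 1 + j: index k is time 0, the next n
    indices form the gap, and index k + n + 1 is time n + 1.\<close>
  define u where "u t = (if t \<le> k then a t else if t \<le> k + n then (\<lambda>_. 1) else b (t - (k + n + 1)))" for t
  have [measurable]: "u t \<in> borel_measurable M" for t by (simp add: u_def)
  define \<beta> where "\<beta> = backward b j w"
  have [measurable]: "\<beta> \<in> borel_measurable M" unfolding \<beta>_def by measurable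
  have u_prod: "(\<Prod>t\<le>k + n + Suc j. u t (X (- int k + int t) \<omega>))
      = (\<Prod>t\<le>k. a t (X (- int k + int t) \<omega>)) * (\<Prod>t\<le>j. b t (X (int n + 1 + int t) \<omega>))" for \<omega>
  proof -
    let ?f = "\<lambda>t. u t (X (- int k + int t) \<omega>)"
    have sp: "{..k + n + Suc j} = {..k} \<union> ({k<..k + n} \<union> {k + n + 1..k + n + 1 + j})" by auto
    have "prod ?f {..k + n + Suc j} = prod ?f {..k} * (prod ?f {k<..k + n} * prod ?f {k + n + 1..k + n + 1 + j})"
      unfolding sp by (subst prod.union_disjoint, simp, simp, force, subst prod.union_disjoint) auto
    also have "prod ?f {..k} = (\<Prod>t\<le>k. a t (X (- int k + int t) \<omega>))"
      by (intro prod.cong) (auto simp: u_def)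
    also have "prod ?f {k<..k + n} = 1"
      by (intro prod.neutral) (auto simp: u_def)
    also have "prod ?f {k + n + 1..k + n + 1 + j} = (\<Prod>t\<le>j. b t (X (int n + 1 + int t) \<omega>))"
      by (rule prod.reindex_bij_witness[of _ "\<lambda>t. t + (k + n + 1)" "\<lambda>t. t - (k + n + 1)"])
        (auto simp: u_def algebra_simps)
    finally show ?thesis by simp
  qed
  have fwd: "forward u k = forward a k" by (rule forward_cong) (simp add: u_def)
  have bwd: "(\<lambda>t. u (k + n + Suc t)) = b" by (simp add: u_def fun_eq_iff)
  have "?L = (\<integral>\<^sup>+y. forward u (k + n + Suc j) y * w y \<partial>M)"
    unfolding u_prod[symmetric] by (rule law) simp
  also have "\<dots> = (\<integral>\<^sup>+y. push (forward u (k + n)) y * \<beta> y \<partial>M)"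
    by (subst forward_backward) (simp_all only: bwd \<beta>_def, measurable)
  also have "\<dots> = (\<integral>\<^sup>+y. (\<integral>\<^sup>+x. forward a k x * iter_kernel n x y \<partial>M) * \<beta> y \<partial>M)"
    by (intro nn_integral_cong, subst forward_gap) (auto simp: u_def fwd)
  also have "\<dots> = (\<integral>\<^sup>+y. \<integral>\<^sup>+x. forward a k x * iter_kernel n x y * \<beta> y \<partial>M \<partial>M)"
    by (intro nn_integral_cong) (simp add: nn_integral_multc)
  also have "\<dots> = (\<integral>\<^sup>+x. \<integral>\<^sup>+y. forward a k x * iter_kernel n x y * \<beta> y \<partial>M \<partial>M)"
    by (rule Tonelli) measurable
  finally have L: "?L = (\<integral>\<^sup>+x. \<integral>\<^sup>+y. forward a k x * iter_kernel n x y * \<beta> y \<partial>M \<partial>M)" .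
  \<comment> \<open>The expectation over the independent copy of the future while
    \<open>X 0 = x\<close> is held fixed.\<close>
  define \<phi> where "\<phi> x = (\<integral>\<^sup>+y. v y * ratio n x y * \<beta> y \<partial>M)" for x
  have [measurable]: "\<phi> \<in> borel_measurable M" unfolding \<phi>_def by measurable
  have "?R = (\<integral>\<^sup>+\<omega>. (\<Prod>t\<le>k. a t (X (- int k + int t) \<omega>)) * \<phi> (X (- int k + int k) \<omega>) \<partial>P)"
  proof (rule nn_integral_cong)
    fix \<omega> assume [measurable]: "\<omega> \<in> space P"
    then have [measurable]: "X 0 \<omega> \<in> space M" by (rule measurable_space[OF X_measurable])
    have "(\<integral>\<^sup>+\<omega>'. (\<Prod>t\<le>k. a t (X (- int k + int t) \<omega>)) *
        (\<Prod>t\<le>j. b t (X (int n + 1 + int t) \<omega>')) * ratio n (X 0 \<omega>) (X (int n + 1) \<omega>') \<partial>P)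
      = (\<Prod>t\<le>k. a t (X (- int k + int t) \<omega>)) *
        (\<integral>\<^sup>+\<omega>'. (\<Prod>t\<le>j. b t (X (int n + 1 + int t) \<omega>')) * ratio n (X 0 \<omega>) (X (int n + 1) \<omega>') \<partial>P)"
      by (subst nn_integral_cmult[symmetric]) (auto simp: mult.assoc)
    also have "(\<integral>\<^sup>+\<omega>'. (\<Prod>t\<le>j. b t (X (int n + 1 + int t) \<omega>')) * ratio n (X 0 \<omega>) (X (int n + 1) \<omega>') \<partial>P)
        = \<phi> (X 0 \<omega>)"
      unfolding \<phi>_def \<beta>_def by (rule law_future) measurable
    finally show "(\<integral>\<^sup>+\<omega>'. (\<Prod>t\<le>k. a t (X (- int k + int t) \<omega>)) *
        (\<Prod>t\<le>j. b t (X (int n + 1 + int t) \<omega>')) * ratio n (X 0 \<omega>) (X (int n + 1) \<omega>') \<partial>P)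
      = (\<Prod>t\<le>k. a t (X (- int k + int t) \<omega>)) * \<phi> (X (- int k + int k) \<omega>)" by simp
  qed
  also have "\<dots> = (\<integral>\<^sup>+x. forward a k x * \<phi> x * w x \<partial>M)"
    by (rule law_past) measurable
  also have "\<dots> = (\<integral>\<^sup>+x. \<integral>\<^sup>+y. forward a k x * iter_kernel n x y * \<beta> y \<partial>M \<partial>M)"
  proof (rule nn_integral_cong_AE)
    show "AE x in M. forward a k x * \<phi> x * w x = (\<integral>\<^sup>+y. forward a k x * iter_kernel n x y * \<beta> y \<partial>M)"
      using w_pos AE_space
    proof eventually_elim
      case (elim x)
      note [measurable] = elim(2)
      have "forward a k x * \<phi> x * w x = (\<integral>\<^sup>+y. forward a k x * (w x * v y * ratio n x y) * \<beta> y \<partial>M)"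
        unfolding \<phi>_def
        by (subst nn_integral_cmult[symmetric], simp, subst nn_integral_multc[symmetric]) (simp_all add: mult_ac)
      also have "\<dots> = (\<integral>\<^sup>+y. forward a k x * iter_kernel n x y * \<beta> y \<partial>M)"
        using v_pos by (intro nn_integral_cong_AE, eventually_elim) (simp add: ratio_times elim)
      finally show ?case .
    qed
  qed
  finally show ?thesis using L by simp
qed

end

text \<open>\<open>factorization_windows\<close> wants a factor at every time of a window without
  holes; times outside \<open>J\<close> receive \<open>space M\<close>.\<close>

lemma rectangle_indicator:
  assumes R: "R = {\<omega> \<in> space P. \<forall>t\<in>J. X t \<omega> \<in> a t}" and J: "J \<subseteq> {s..s + int k}"
    and X: "\<And>t. X t \<omega> \<in> space M" and \<omega>: "\<omega> \<in> space P"
  shows "(indicator R \<omega> :: ennreal)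
    = (\<Prod>t\<le>k. indicator (if s + int t \<in> J then a (s + int t) else space M) (X (s + int t) \<omega>))"
proof (cases "\<omega> \<in> R")
  case True
  then show ?thesis using X by (auto simp: R intro!: prod.neutral[symmetric])
next
  case False
  then obtain t where t: "t \<in> J" "X t \<omega> \<notin> a t" using \<omega> by (auto simp: R)
  define i where "i = nat (t - s)"
  have "t \<in> {s..s + int k}" using t(1) J by blast
  then have i: "t = s + int i" "i \<le> k" by (auto simp: i_def)
  have "(\<Prod>t\<le>k. indicator (if s + int t \<in> J then a (s + int t) else space M) (X (s + int t) \<omega>)) = (0::ennreal)"
    using t i by (intro prod_zero bexI[of _ i]) auto
  then show ?thesis using False by simp
qed

lemma finite_int_bounded:
  assumes "finite (J :: int set)"
  shows "\<exists>k::nat. \<forall>t\<in>J. \<bar>t\<bar> \<le> int k"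
proof -
  have "\<bar>t\<bar> \<le> int (\<Sum>t\<in>J. nat \<bar>t\<bar>)" if "t \<in> J" for t
    using member_le_sum[of t J "\<lambda>t. nat \<bar>t\<bar>"] assms that by (simp only: nat_le_iff)
  then show ?thesis by blast
qed

text \<open>The window is made to end exactly at time 0, where \<open>ratio\<close> is evaluated.
  Its counterpart for the future begins exactly at time n + 1.\<close>

lemma past_rectangle_indicator:
  assumes X: "\<And>t \<omega>. \<omega> \<in> space P \<Longrightarrow> X t \<omega> \<in> space M" and "R \<in> rectangles P M X {..0}"
  shows "\<exists>k a. (\<forall>t. a t \<in> sets M) \<and> (\<forall>\<omega>\<in>space P.
    indicator R \<omega> = (\<Prod>t\<le>k. indicator (a t) (X (- int k + int t) \<omega>) :: ennreal))"
proof -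
  obtain J a where R: "R = {\<omega> \<in> space P. \<forall>t\<in>J. X t \<omega> \<in> a t}" and J: "finite J" "J \<subseteq> {..0}"
    and a: "\<forall>t. a t \<in> sets M"
    using assms(2) unfolding rectangles_def by blast
  obtain k where k: "\<forall>t\<in>J. \<bar>t\<bar> \<le> int k" using finite_int_bounded[OF J(1)] by blast
  have J': "J \<subseteq> {- int k..- int k + int k}" using k J by fastforce
  let ?b = "\<lambda>t. if - int k + int t \<in> J then a (- int k + int t) else space M"
  show ?thesis
  proof (intro exI[of _ k] exI[of _ ?b] conjI allI ballI)
    show "?b t \<in> sets M" for t using a by simp
    show "indicator R \<omega> = (\<Prod>t\<le>k. indicator (?b t) (X (- int k + int t) \<omega>) :: ennreal)" if "\<omega> \<in> space P" for \<omega>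
      using X[OF that] that by (intro rectangle_indicator[OF R J'])
  qed
qed

lemma future_rectangle_indicator:
  assumes X: "\<And>t \<omega>. \<omega> \<in> space P \<Longrightarrow> X t \<omega> \<in> space M" and "R \<in> rectangles P M X {int n + 1..}"
  shows "\<exists>k a. (\<forall>t. a t \<in> sets M) \<and> (\<forall>\<omega>\<in>space P.
    indicator R \<omega> = (\<Prod>t\<le>k. indicator (a t) (X (int n + 1 + int t) \<omega>) :: ennreal))"
proof -
  obtain J a where R: "R = {\<omega> \<in> space P. \<forall>t\<in>J. X t \<omega> \<in> a t}" and J: "finite J" "J \<subseteq> {int n + 1..}"
    and a: "\<forall>t. a t \<in> sets M"
    using assms(2) unfolding rectangles_def by blast
  obtain k where k: "\<forall>t\<in>J. \<bar>t\<bar> \<le> int k" using finite_int_bounded[OF J(1)] by blast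
  have J': "J \<subseteq> {int n + 1..int n + 1 + int k}" using k J by fastforce
  let ?b = "\<lambda>t. if int n + 1 + int t \<in> J then a (int n + 1 + int t) else space M"
  show ?thesis
  proof (intro exI[of _ k] exI[of _ ?b] conjI allI ballI)
    show "?b t \<in> sets M" for t using a by simp
    show "indicator R \<omega> = (\<Prod>t\<le>k. indicator (?b t) (X (int n + 1 + int t) \<omega>) :: ennreal)" if "\<omega> \<in> space P" for \<omega>
      using X[OF that] that by (intro rectangle_indicator[OF R J'])
  qed
qed

lemma sum_indicator_disjoint_le_1:
  assumes "finite U" "disjoint U"
  shows "(\<Sum>A\<in>U. indicator A \<omega> :: ennreal) \<le> 1"
proof (cases "\<exists>A\<in>U. \<omega> \<in> A")
  case True
  then obtain A where A: "A \<in> U" "\<omega> \<in> A" by blast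
  have "(\<Sum>A\<in>U. indicator A \<omega> :: ennreal) = indicator A \<omega> + (\<Sum>B\<in>U - {A}. indicator B \<omega>)"
    using A assms(1) by (simp add: sum.remove)
  also have "(\<Sum>B\<in>U - {A}. indicator B \<omega> :: ennreal) = 0"
  proof (rule sum.neutral, rule ballI)
    fix B assume "B \<in> U - {A}"
    then have "B \<inter> A = {}" using A assms(2) by (auto simp: disjoint_def)
    then show "(indicator B \<omega> :: ennreal) = 0" using A(2) by (auto simp: indicator_def)
  qed
  finally show ?thesis using A by simp
next
  case False
  then have "(\<Sum>A\<in>U. indicator A \<omega> :: ennreal) = 0" by (intro sum.neutral) auto
  then show ?thesis by simp
qed

section \<open>Dependence between past and future\<close>

context kernel_process
begin

lemma X_space: "\<omega> \<in> space P \<Longrightarrow> X t \<omega> \<in> space M"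
  by (rule measurable_space[OF X_measurable])

lemma emeasure_inter_eq:
  assumes [measurable]: "A \<in> sets P" "B \<in> sets P"
  shows "emeasure P (A \<inter> B) = (\<integral>\<^sup>+\<omega>. indicator A \<omega> * indicator B \<omega> \<partial>P)"
  by (simp add: nn_integral_indicator[symmetric] indicator_inter_arith)

lemma factorization_rectangles:
  assumes A: "A \<in> rectangles P M X {..0}" and B: "B \<in> rectangles P M X {int n + 1..}"
  shows "emeasure P (A \<inter> B) = (\<integral>\<^sup>+\<omega>. \<integral>\<^sup>+\<omega>'. indicator A \<omega> * indicator B \<omega>' *
    ratio n (X 0 \<omega>) (X (int n + 1) \<omega>') \<partial>P \<partial>P)"
proof -
  have [measurable]: "A \<in> sets P" "B \<in> sets P"
    using A B rectangles_measurable[of X, OF X_measurable] by auto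
  obtain k a where [measurable]: "\<And>t. a t \<in> sets M"
    and a: "\<And>\<omega>. \<omega> \<in> space P \<Longrightarrow> indicator A \<omega> = (\<Prod>t\<le>k. indicator (a t) (X (- int k + int t) \<omega>) :: ennreal)"
    using past_rectangle_indicator[of P X M, OF X_space A] by blast
  obtain j b where [measurable]: "\<And>t. b t \<in> sets M"
    and b: "\<And>\<omega>. \<omega> \<in> space P \<Longrightarrow> indicator B \<omega> = (\<Prod>t\<le>j. indicator (b t) (X (int n + 1 + int t) \<omega>) :: ennreal)"
    using future_rectangle_indicator[of P X M, OF X_space B] by blast
  have "emeasure P (A \<inter> B) = (\<integral>\<^sup>+\<omega>. (\<Prod>t\<le>k. indicator (a t) (X (- int k + int t) \<omega>)) *
      (\<Prod>t\<le>j. indicator (b t) (X (int n + 1 + int t) \<omega>)) \<partial>P)"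
    unfolding emeasure_inter_eq[OF \<open>A \<in> sets P\<close> \<open>B \<in> sets P\<close>]
    by (intro nn_integral_cong) (simp only: a b)
  also have "\<dots> = (\<integral>\<^sup>+\<omega>. \<integral>\<^sup>+\<omega>'. (\<Prod>t\<le>k. indicator (a t) (X (- int k + int t) \<omega>)) *
      (\<Prod>t\<le>j. indicator (b t) (X (int n + 1 + int t) \<omega>')) * ratio n (X 0 \<omega>) (X (int n + 1) \<omega>') \<partial>P \<partial>P)"
    by (rule factorization_windows) measurable
  also have "\<dots> = (\<integral>\<^sup>+\<omega>. \<integral>\<^sup>+\<omega>'. indicator A \<omega> * indicator B \<omega>' *
      ratio n (X 0 \<omega>) (X (int n + 1) \<omega>') \<partial>P \<partial>P)"
    by (intro nn_integral_cong) (simp only: a b)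
  finally show ?thesis .
qed

text \<open>Both sides are measures in \<open>A\<close> and in \<open>B\<close> separately, so the
  identity for rectangles extends one argument at a time: first \<open>A\<close> against a
  rectangle, then \<open>B\<close> against a general \<open>A\<close>.\<close>

lemma factorization:
  assumes A: "A \<in> sigma_generated P M X {..0}" and B: "B \<in> sigma_generated P M X {int n + 1..}"
  shows "emeasure P (A \<inter> B) = (\<integral>\<^sup>+\<omega>. \<integral>\<^sup>+\<omega>'. indicator A \<omega> * indicator B \<omega>' *
    ratio n (X 0 \<omega>) (X (int n + 1) \<omega>') \<partial>P \<partial>P)"
proof -
  let ?k = "\<lambda>\<omega> \<omega>'. ratio n (X 0 \<omega>) (X (int n + 1) \<omega>')"
  note stable = Int_stable_rectangles[of P X M, OF X_space]
  have rect_sets: "rectangles P M X I \<subseteq> sets P" for I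
    using rectangles_measurable[of X, OF X_measurable] by blast
  have [measurable]: "A \<in> sets P" "B \<in> sets P"
    using A B sigma_generated_measurable[of X, OF X_measurable] by auto
  have dens: "emeasure (density P (indicator B)) A = emeasure P (A \<inter> B)"
    if "A \<in> sets P" "B \<in> sets P" for A B
    using that by (simp add: emeasure_density emeasure_inter_eq mult.commute)
  have past: "emeasure P (A' \<inter> B') = (\<integral>\<^sup>+\<omega>. \<integral>\<^sup>+\<omega>'. indicator A' \<omega> * indicator B' \<omega>' * ?k \<omega> \<omega>' \<partial>P \<partial>P)"
    if A': "A' \<in> sigma_sets (space P) (rectangles P M X {..0})" and B': "B' \<in> rectangles P M X {int n + 1..}" for A' B'
  proof -
    have [measurable]: "B' \<in> sets P" using B' rect_sets by auto
    define \<Psi> where "\<Psi> \<omega> = (\<integral>\<^sup>+\<omega>'. indicator B' \<omega>' * ?k \<omega> \<omega>' \<partial>P)" for \<omega>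
    have [measurable]: "\<Psi> \<in> borel_measurable P" unfolding \<Psi>_def by measurable
    have \<Psi>: "emeasure (density P \<Psi>) A = (\<integral>\<^sup>+\<omega>. \<integral>\<^sup>+\<omega>'. indicator A \<omega> * indicator B' \<omega>' * ?k \<omega> \<omega>' \<partial>P \<partial>P)"
      if [measurable]: "A \<in> sets P" for A
    proof -
      have "emeasure (density P \<Psi>) A = (\<integral>\<^sup>+\<omega>. \<Psi> \<omega> * indicator A \<omega> \<partial>P)"
        by (simp add: emeasure_density)
      also have "\<dots> = (\<integral>\<^sup>+\<omega>. \<integral>\<^sup>+\<omega>'. indicator A \<omega> * indicator B' \<omega>' * ?k \<omega> \<omega>' \<partial>P \<partial>P)"
        unfolding \<Psi>_def by (intro nn_integral_cong) (auto simp: indicator_def)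
      finally show ?thesis .
    qed
    have "emeasure (density P (indicator B')) A' = emeasure (density P \<Psi>) A'"
    proof (rule emeasure_eq_on_sigma_sets[OF stable rectangles_subset_Pow space_in_rectangles _ _ _ _ _ A'])
      fix A assume A: "A \<in> rectangles P M X {..0}"
      then have [measurable]: "A \<in> sets P" using rect_sets by auto
      show "emeasure (density P (indicator B')) A = emeasure (density P \<Psi>) A"
        by (simp only: \<Psi>[OF \<open>A \<in> sets P\<close>] dens[OF \<open>A \<in> sets P\<close> \<open>B' \<in> sets P\<close>] factorization_rectangles[OF A B'])
    next
      have "emeasure (density P (indicator B')) (space P) = emeasure P (space P \<inter> B')"
        by (rule dens) auto
      also have "\<dots> < top" by (simp add: P.emeasure_eq_measure)
      finally show "emeasure (density P (indicator B')) (space P) < top" .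
    qed (use rect_sets in auto)
    moreover have "A' \<in> sets P"
      using A' sigma_generated_measurable[of X, OF X_measurable] by (auto simp: sigma_generated_eq_rectangles)
    ultimately show ?thesis using \<Psi>[of A'] dens[of A' B'] by simp
  qed
  \<comment> \<open>For the second extension the order of integration is reversed, so that the
    right-hand side becomes a measure in \<open>B\<close> with a density in \<omega>'.\<close>
  define \<Phi> where "\<Phi> \<omega>' = (\<integral>\<^sup>+\<omega>. indicator A \<omega> * ?k \<omega> \<omega>' \<partial>P)" for \<omega>'
  have [measurable]: "\<Phi> \<in> borel_measurable P" unfolding \<Phi>_def by measurable
  have \<Phi>: "emeasure (density P \<Phi>) B = (\<integral>\<^sup>+\<omega>. \<integral>\<^sup>+\<omega>'. indicator A \<omega> * indicator B \<omega>' * ?k \<omega> \<omega>' \<partial>P \<partial>P)"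
    if [measurable]: "B \<in> sets P" for B
  proof -
    have "emeasure (density P \<Phi>) B = (\<integral>\<^sup>+\<omega>'. \<Phi> \<omega>' * indicator B \<omega>' \<partial>P)"
      by (simp add: emeasure_density)
    also have "\<dots> = (\<integral>\<^sup>+\<omega>'. \<integral>\<^sup>+\<omega>. indicator A \<omega> * indicator B \<omega>' * ?k \<omega> \<omega>' \<partial>P \<partial>P)"
      unfolding \<Phi>_def by (intro nn_integral_cong) (auto simp: indicator_def)
    also have "\<dots> = (\<integral>\<^sup>+\<omega>. \<integral>\<^sup>+\<omega>'. indicator A \<omega> * indicator B \<omega>' * ?k \<omega> \<omega>' \<partial>P \<partial>P)"
      by (rule pair_sigma_finite.Fubini') (unfold_locales, measurable)
    finally show ?thesis .
  qed
  have "emeasure (density P (indicator A)) B = emeasure (density P \<Phi>) B"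
  proof (rule emeasure_eq_on_sigma_sets[OF stable rectangles_subset_Pow space_in_rectangles _ _ _ _ _
        B[unfolded sigma_generated_eq_rectangles]])
    fix B assume B: "B \<in> rectangles P M X {int n + 1..}"
    then have [measurable]: "B \<in> sets P" using rect_sets by auto
    show "emeasure (density P (indicator A)) B = emeasure (density P \<Phi>) B"
      using past[OF A[unfolded sigma_generated_eq_rectangles] B]
      by (simp only: \<Phi>[OF \<open>B \<in> sets P\<close>] dens[OF \<open>B \<in> sets P\<close> \<open>A \<in> sets P\<close>] Int_commute)
  next
    have "emeasure (density P (indicator A)) (space P) = emeasure P (space P \<inter> A)"
      by (rule dens) auto
    also have "\<dots> < top" by (simp add: P.emeasure_eq_measure)
    finally show "emeasure (density P (indicator A)) (space P) < top" .
  qed (use rect_sets in auto)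
  then show ?thesis using \<Phi>[of B] dens[of B A] by (simp add: Int_commute)
qed

text \<open>\<open>X 0\<close> and \<open>X (n + 1)\<close> each have density v * w. The weights
  \<open>v x\<close> and \<open>w y\<close> stay outside, while \<open>w x * v y\<close> moves into
  the distance and turns \<open>ratio\<close> into \<open>iter_kernel\<close> and 1 into
  \<open>w x * v y\<close>.\<close>

lemma integral_absdiff_ratio:
  "(\<integral>\<^sup>+\<omega>. \<integral>\<^sup>+\<omega>'. absdiff (ratio n (X 0 \<omega>) (X (int n + 1) \<omega>')) 1 \<partial>P \<partial>P)
    = (\<integral>\<^sup>+x. \<integral>\<^sup>+y. v x * absdiff (iter_kernel n x y) (w x * v y) * w y \<partial>M \<partial>M)"
proof -
  have "(\<integral>\<^sup>+\<omega>. \<integral>\<^sup>+\<omega>'. absdiff (ratio n (X 0 \<omega>) (X (int n + 1) \<omega>')) 1 \<partial>P \<partial>P)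
      = (\<integral>\<^sup>+\<omega>. (\<integral>\<^sup>+y. v y * absdiff (ratio n (X 0 \<omega>) y) 1 * w y \<partial>M) \<partial>P)"
  proof (rule nn_integral_cong)
    fix \<omega> assume "\<omega> \<in> space P"
    then have [measurable]: "X 0 \<omega> \<in> space M" by (rule X_space)
    show "(\<integral>\<^sup>+\<omega>'. absdiff (ratio n (X 0 \<omega>) (X (int n + 1) \<omega>')) 1 \<partial>P)
        = (\<integral>\<^sup>+y. v y * absdiff (ratio n (X 0 \<omega>) y) 1 * w y \<partial>M)"
      by (rule law_single[where \<phi>="\<lambda>y. absdiff (ratio n (X 0 \<omega>) y) 1"]) measurable
  qed
  also have "\<dots> = (\<integral>\<^sup>+x. v x * (\<integral>\<^sup>+y. v y * absdiff (ratio n x y) 1 * w y \<partial>M) * w x \<partial>M)"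
    by (rule law_single) measurable
  also have "\<dots> = (\<integral>\<^sup>+x. \<integral>\<^sup>+y. v x * absdiff (iter_kernel n x y) (w x * v y) * w y \<partial>M \<partial>M)"
  proof (rule nn_integral_cong_AE)
    show "AE x in M. v x * (\<integral>\<^sup>+y. v y * absdiff (ratio n x y) 1 * w y \<partial>M) * w x
        = (\<integral>\<^sup>+y. v x * absdiff (iter_kernel n x y) (w x * v y) * w y \<partial>M)"
      using w_pos AE_space
    proof eventually_elim
      case (elim x)
      note [measurable] = elim(2)
      have "v x * (\<integral>\<^sup>+y. v y * absdiff (ratio n x y) 1 * w y \<partial>M) * w x
          = (\<integral>\<^sup>+y. v x * (w x * v y * absdiff (ratio n x y) 1) * w y \<partial>M)"
        by (subst nn_integral_cmult[symmetric], measurable, subst nn_integral_multc[symmetric], measurable)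
          (simp only: mult_ac)
      also have "\<dots> = (\<integral>\<^sup>+y. v x * absdiff (iter_kernel n x y) (w x * v y) * w y \<partial>M)"
      proof (rule nn_integral_cong_AE)
        show "AE y in M. v x * (w x * v y * absdiff (ratio n x y) 1) * w y
            = v x * absdiff (iter_kernel n x y) (w x * v y) * w y"
          using v_pos
        proof eventually_elim
          case (elim y)
          have "w x * v y < top" using elim \<open>0 < w x \<and> w x < top\<close> by (simp add: ennreal_mult_less_top)
          then show ?case
            using elim \<open>0 < w x \<and> w x < top\<close> by (simp add: absdiff_mult_left ratio_times)
        qed
      qed
      finally show ?case .
    qed
  qed
  finally show ?thesis .
qed

text \<open>Each term is at most the integral of |ratio - 1| over A \<times> B against the product
  law, and by disjointness these rectangles add up to at most the whole space. With disjoint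
  families in place of partitions a single pair of events is covered too, which the proof of
  ergodicity uses.\<close>

lemma dependence_bound:
  assumes c: "0 \<le> c"
    and bound: "(\<integral>\<^sup>+x. \<integral>\<^sup>+y. v x * absdiff (iter_kernel n x y) (w x * v y) * w y \<partial>M \<partial>M) \<le> ennreal c"
    and U: "finite U" "disjoint U" "U \<subseteq> sigma_generated P M X {..0}"
    and V: "finite V" "disjoint V" "V \<subseteq> sigma_generated P M X {int n + 1..}"
  shows "(\<Sum>A\<in>U. \<Sum>B\<in>V. \<bar>measure P (A \<inter> B) - measure P A * measure P B\<bar>) \<le> c"
proof -
  let ?k = "\<lambda>\<omega> \<omega>'. ratio n (X 0 \<omega>) (X (int n + 1) \<omega>')"
  define d where "d \<omega> \<omega>' = absdiff (?k \<omega> \<omega>') 1" for \<omega> \<omega>'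
  have d_le: "(\<integral>\<^sup>+\<omega>. \<integral>\<^sup>+\<omega>'. d \<omega> \<omega>' \<partial>P \<partial>P) \<le> ennreal c"
    using bound unfolding d_def integral_absdiff_ratio .
  have [measurable]: "case_prod d \<in> borel_measurable (P \<Otimes>\<^sub>M P)"
    unfolding d_def by measurable
  have Us[measurable]: "A \<in> sets P" if "A \<in> U" for A
    using that U(3) sigma_generated_measurable[of X, OF X_measurable] by blast
  have Vs[measurable]: "B \<in> sets P" if "B \<in> V" for B
    using that V(3) sigma_generated_measurable[of X, OF X_measurable] by blast
  define D where "D A B = (\<integral>\<^sup>+\<omega>. \<integral>\<^sup>+\<omega>'. indicator A \<omega> * indicator B \<omega>' * d \<omega> \<omega>' \<partial>P \<partial>P)" for A B
  have pair: "ennreal \<bar>measure P (A \<inter> B) - measure P A * measure P B\<bar> \<le> D A B"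
    if A: "A \<in> U" and B: "B \<in> V" for A B
  proof -
    note [measurable] = Us[OF A] Vs[OF B]
    have joint: "emeasure P (A \<inter> B) = (\<integral>\<^sup>+\<omega>. \<integral>\<^sup>+\<omega>'. indicator A \<omega> * indicator B \<omega>' * ?k \<omega> \<omega>' \<partial>P \<partial>P)"
      using A B U(3) V(3) by (intro factorization) auto
    have prod: "emeasure P A * emeasure P B = (\<integral>\<^sup>+\<omega>. \<integral>\<^sup>+\<omega>'. indicator A \<omega> * indicator B \<omega>' \<partial>P \<partial>P)"
      by (simp add: nn_integral_cmult nn_integral_multc)
    \<comment> \<open>Applied twice, with \<open>ratio\<close> and 1 in either role, since the two
      probabilities cannot be subtracted in \<open>ennreal\<close>.\<close>
    have split: "(\<integral>\<^sup>+\<omega>. \<integral>\<^sup>+\<omega>'. indicator A \<omega> * indicator B \<omega>' * f \<omega> \<omega>' \<partial>P \<partial>P)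
        \<le> (\<integral>\<^sup>+\<omega>. \<integral>\<^sup>+\<omega>'. indicator A \<omega> * indicator B \<omega>' * g \<omega> \<omega>' \<partial>P \<partial>P) + D A B"
      if fg: "\<And>\<omega> \<omega>'. f \<omega> \<omega>' \<le> g \<omega> \<omega>' + d \<omega> \<omega>'" and [measurable]: "case_prod g \<in> borel_measurable (P \<Otimes>\<^sub>M P)" for f g
    proof -
      have "(\<integral>\<^sup>+\<omega>. \<integral>\<^sup>+\<omega>'. indicator A \<omega> * indicator B \<omega>' * f \<omega> \<omega>' \<partial>P \<partial>P)
          \<le> (\<integral>\<^sup>+\<omega>. \<integral>\<^sup>+\<omega>'. indicator A \<omega> * indicator B \<omega>' * g \<omega> \<omega>' + indicator A \<omega> * indicator B \<omega>' * d \<omega> \<omega>' \<partial>P \<partial>P)"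
        unfolding distrib_left[symmetric] using fg by (intro nn_integral_mono mult_left_mono) auto
      also have "\<dots> = (\<integral>\<^sup>+\<omega>. (\<integral>\<^sup>+\<omega>'. indicator A \<omega> * indicator B \<omega>' * g \<omega> \<omega>' \<partial>P) +
          (\<integral>\<^sup>+\<omega>'. indicator A \<omega> * indicator B \<omega>' * d \<omega> \<omega>' \<partial>P) \<partial>P)"
        by (intro nn_integral_cong nn_integral_add) measurable
      also have "\<dots> = (\<integral>\<^sup>+\<omega>. \<integral>\<^sup>+\<omega>'. indicator A \<omega> * indicator B \<omega>' * g \<omega> \<omega>' \<partial>P \<partial>P) + D A B"
        unfolding D_def by (rule nn_integral_add) measurable
      finally show ?thesis .
    qed
    have "emeasure P (A \<inter> B) \<le> emeasure P A * emeasure P B + D A B"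
      using split[of ?k "\<lambda>_ _. 1"] le_add_absdiff(1)[of _ 1] unfolding joint prod d_def by simp
    moreover have "emeasure P A * emeasure P B \<le> emeasure P (A \<inter> B) + D A B"
      using split[of "\<lambda>_ _. 1" ?k] le_add_absdiff(2)[of 1] unfolding joint prod d_def by simp
    ultimately show ?thesis
    proof (cases "D A B")
      case (real e)
      assume "emeasure P (A \<inter> B) \<le> emeasure P A * emeasure P B + D A B"
        "emeasure P A * emeasure P B \<le> emeasure P (A \<inter> B) + D A B"
      then show ?thesis
        using real by (simp add: P.emeasure_eq_measure ennreal_mult[symmetric] ennreal_plus[symmetric] abs_le_iff
          del: ennreal_plus)
    qed simp
  qed
  have "ennreal (\<Sum>A\<in>U. \<Sum>B\<in>V. \<bar>measure P (A \<inter> B) - measure P A * measure P B\<bar>)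
      = (\<Sum>A\<in>U. \<Sum>B\<in>V. ennreal \<bar>measure P (A \<inter> B) - measure P A * measure P B\<bar>)"
    by (simp add: sum_ennreal sum_nonneg)
  also have "\<dots> \<le> (\<Sum>A\<in>U. \<Sum>B\<in>V. D A B)"
    by (intro sum_mono pair)
  also have "\<dots> = (\<integral>\<^sup>+\<omega>. \<integral>\<^sup>+\<omega>'. (\<Sum>A\<in>U. indicator A \<omega>) * (\<Sum>B\<in>V. indicator B \<omega>') * d \<omega> \<omega>' \<partial>P \<partial>P)"
  proof -
    have m1: "(\<lambda>\<omega>. \<integral>\<^sup>+\<omega>'. indicator A \<omega> * indicator B \<omega>' * d \<omega> \<omega>' \<partial>P) \<in> borel_measurable P"
      if A: "A \<in> U" and B: "B \<in> V" for A B
    proof -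
      note [measurable] = Us[OF A] Vs[OF B]
      show ?thesis by measurable
    qed
    have m2: "(\<lambda>\<omega>'. indicator A \<omega> * indicator B \<omega>' * d \<omega> \<omega>') \<in> borel_measurable P"
      if A: "A \<in> U" and B: "B \<in> V" and \<omega>: "\<omega> \<in> space P" for A B \<omega>
    proof -
      note [measurable] = Us[OF A] Vs[OF B] \<omega>
      show ?thesis by measurable
    qed
    have "(\<Sum>A\<in>U. \<Sum>B\<in>V. D A B)
        = (\<integral>\<^sup>+\<omega>. (\<Sum>A\<in>U. \<Sum>B\<in>V. \<integral>\<^sup>+\<omega>'. indicator A \<omega> * indicator B \<omega>' * d \<omega> \<omega>' \<partial>P) \<partial>P)"
      unfolding D_def by (simp add: nn_integral_sum m1)
    also have "\<dots> = (\<integral>\<^sup>+\<omega>. \<integral>\<^sup>+\<omega>'. (\<Sum>A\<in>U. \<Sum>B\<in>V. indicator A \<omega> * indicator B \<omega>' * d \<omega> \<omega>') \<partial>P \<partial>P)"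
      by (intro nn_integral_cong) (simp add: nn_integral_sum m2)
    moreover have "(\<Sum>A\<in>U. \<Sum>B\<in>V. indicator A \<omega> * indicator B \<omega>' * d \<omega> \<omega>')
        = (\<Sum>A\<in>U. indicator A \<omega>) * (\<Sum>B\<in>V. indicator B \<omega>') * d \<omega> \<omega>'" for \<omega> \<omega>'
      unfolding sum_product by (simp only: sum_distrib_right)
    ultimately show ?thesis by simp
  qed
  also have "\<dots> \<le> (\<integral>\<^sup>+\<omega>. \<integral>\<^sup>+\<omega>'. 1 * 1 * d \<omega> \<omega>' \<partial>P \<partial>P)"
    using U V by (intro nn_integral_mono mult_mono sum_indicator_disjoint_le_1) auto
  also have "\<dots> \<le> ennreal c" using d_le by simp
  finally show ?thesis using c by simp
qed

end

section \<open>Mixing and ergodicity\<close>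

text \<open>Events shifted far into the future become independent of the past. An invariant event
  does not feel the shift, so it is independent of every cylinder moved into the past, by
  stationarity of every cylinder, and finally of itself: its probability is its own square.\<close>

lemma strong_mixing_imp_ergodic:
  assumes "prob_space P" and stat: "strictly_stationary P M X"
    and mix: "\<And>n A B. A \<in> sigma_generated P M X {..0} \<Longrightarrow> B \<in> sigma_generated P M X {int n + 1..} \<Longrightarrow>
      \<bar>measure P (A \<inter> B) - measure P A * measure P B\<bar> \<le> a n"
    and a: "a \<longlonglongrightarrow> 0"
  shows "ergodic_process P M X"
proof -
  interpret prob_space P by fact
  have X[measurable]: "X t \<in> P \<rightarrow>\<^sub>M M" for t using stat by (simp add: strictly_stationary_def)
  define S where "S = (\<Pi>\<^sub>M t\<in>(UNIV::int set). M)"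
  define Y where "Y k \<omega> = (\<lambda>t. X (t + k) \<omega>)" for k \<omega>
  have Y[measurable]: "Y k \<in> P \<rightarrow>\<^sub>M S" for k
    unfolding Y_def S_def
    by (rule measurable_PiM_single') (auto intro: measurable_space[OF X])
  define pm where "pm B = measure P {\<omega> \<in> space P. Y 0 \<omega> \<in> B}" for B
  have pm: "measure P {\<omega> \<in> space P. Y k \<omega> \<in> B} = pm B" if [measurable]: "B \<in> sets S" for k B
  proof -
    have "distr P S (Y k) = distr P S (Y 0)"
      using stat unfolding strictly_stationary_def Y_def S_def by simp
    then have "measure (distr P S (Y k)) B = measure (distr P S (Y 0)) B" by simp
    then show ?thesis
      by (simp add: measure_distr pm_def vimage_def Int_def conj_commute)
  qed
  let ?cyl = "prod_algebra (UNIV::int set) (\<lambda>_. M)"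
  have S_sets: "sets S = sigma_sets (space S) ?cyl"
    unfolding S_def by (simp add: sets_PiM space_PiM)
  have cyl_sets: "?cyl \<subseteq> sets S" unfolding S_sets by (auto intro: sigma_sets.Basic)
  have cyl_Pow: "?cyl \<subseteq> Pow (space S)" unfolding S_def space_PiM by (rule prod_algebra_sets_into_space)
  \<comment> \<open>A cylinder restricts finitely many times, all in [-l, l]; the shift by k moves
    them into [k - l, k + l]. One l serves every k.\<close>
  have cyl_bounded: "\<exists>l::nat. \<forall>k I. {- int l + k..int l + k} \<subseteq> I \<longrightarrow>
      {\<omega> \<in> space P. Y k \<omega> \<in> C} \<in> sigma_generated P M X I" if cyl: "C \<in> ?cyl" for C
  proof -
    obtain J E where C: "C = prod_emb UNIV (\<lambda>_. M) J (\<Pi>\<^sub>E j\<in>J. E j)"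
      and J: "finite J" and E: "\<And>j. j \<in> J \<Longrightarrow> E j \<in> sets M"
      using cyl by (auto simp: prod_algebra_def)
    obtain l :: nat where l: "\<And>t. t \<in> J \<Longrightarrow> \<bar>t\<bar> \<le> int l"
      using finite_int_bounded[OF J] by blast
    have "{\<omega> \<in> space P. Y k \<omega> \<in> C} \<in> sigma_generated P M X I"
      if I: "{- int l + k..int l + k} \<subseteq> I" for k I
    proof -
      define E' where "E' t = (if t - k \<in> J then E (t - k) else space M)" for t
      have "Y k \<omega> \<in> C \<longleftrightarrow> (\<forall>t\<in>(\<lambda>t. t + k) ` J. X t \<omega> \<in> E' t)" if "\<omega> \<in> space P" for \<omega>
        using measurable_space[OF X that] unfolding C E'_def Y_def prod_emb_iff
        by (auto simp: PiE_iff extensional_def)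
      then have "{\<omega> \<in> space P. Y k \<omega> \<in> C} = {\<omega> \<in> space P. \<forall>t\<in>(\<lambda>t. t + k) ` J. X t \<omega> \<in> E' t}"
        by blast
      moreover have "(\<lambda>t. t + k) ` J \<subseteq> I"
      proof (rule subset_trans[OF _ I], rule image_subsetI)
        fix t assume "t \<in> J"
        from l[OF this] show "t + k \<in> {- int l + k..int l + k}" by auto
      qed
      ultimately have "{\<omega> \<in> space P. Y k \<omega> \<in> C} \<in> rectangles P M X I"
        unfolding rectangles_def using J E
        by (intro CollectI exI[of _ "(\<lambda>t. t + k) ` J"] exI[of _ E']) (auto simp: E'_def)
      then show ?thesis
        unfolding sigma_generated_eq_rectangles by (rule sigma_sets.Basic)
    qed
    then show ?thesis by blast
  qed
  \<comment> \<open>The rate applies to cylinders, which a shift can place in the future. A general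
    event depends on all times, and only the limit survives the extension to it.\<close>
  have lim: "(\<lambda>j::nat. measure P (R \<inter> {\<omega> \<in> space P. Y (int j) \<omega> \<in> B})) \<longlonglongrightarrow> measure P R * pm B"
    if R: "R \<in> sigma_generated P M X {..0}" and B: "B \<in> sets S" for R B
  proof -
    have [measurable]: "R \<in> sets P" by (rule sigma_generated_measurable[of X, OF X R])
    have "B \<in> sigma_sets (space S) ?cyl" using B by (simp add: S_sets)
    with Int_stable_prod_algebra cyl_Pow show ?thesis
    proof (induction rule: sigma_sets_induct_disjoint)
      case (basic B)
      then have [measurable]: "B \<in> sets S" using cyl_sets by auto
      obtain l :: nat where l: "\<And>k I. {- int l + k..int l + k} \<subseteq> I \<Longrightarrow>
          {\<omega> \<in> space P. Y k \<omega> \<in> B} \<in> sigma_generated P M X I"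
        using cyl_bounded[OF basic] by blast
      \<comment> \<open>After the shift by n + l + 1 the earliest possible time of the cylinder is n
        + 1, where the future begins.\<close>
      have le: "\<bar>measure P (R \<inter> {\<omega> \<in> space P. Y (int (n + (l + 1))) \<omega> \<in> B}) - measure P R * pm B\<bar> \<le> a n" for n
      proof -
        have "{\<omega> \<in> space P. Y (int (n + (l + 1))) \<omega> \<in> B} \<in> sigma_generated P M X {int n + 1..}"
          by (rule l) auto
        from mix[OF R this] show ?thesis by (simp only: pm[OF \<open>B \<in> sets S\<close>])
      qed
      show ?case
      proof (rule LIMSEQ_offset[where k="l + 1"], rule LIM_zero_cancel, rule Lim_null_comparison[OF _ a])
        show "\<forall>\<^sub>F n in sequentially. norm (measure P (R \<inter> {\<omega> \<in> space P. Y (int (n + (l + 1))) \<omega> \<in> B}) -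
            measure P R * pm B) \<le> a n"
          using le by (simp only: real_norm_def eventually_True)
      qed
    next
      case empty
      then show ?case by (simp add: pm_def)
    next
      case (compl B)
      then have [measurable]: "B \<in> sets S" by (simp add: S_sets)
      have eq: "measure P (R \<inter> {\<omega> \<in> space P. Y k \<omega> \<in> space S - B})
          = measure P R - measure P (R \<inter> {\<omega> \<in> space P. Y k \<omega> \<in> B})"
        if [measurable]: "R \<in> sets P" for R k
      proof -
        have "R \<inter> {\<omega> \<in> space P. Y k \<omega> \<in> space S - B} = R - (R \<inter> {\<omega> \<in> space P. Y k \<omega> \<in> B})"
          using measurable_space[OF Y] sets.sets_into_space[OF that] by auto
        then show ?thesis by (simp add: finite_measure_Diff)
      qed
      have "pm (space S - B) = 1 - pm B"
        using eq[of "space P" 0] by (simp add: pm_def prob_space Int_def)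
      then have "measure P R * pm (space S - B) = measure P R - measure P R * pm B"
        by (simp only: right_diff_distrib mult_1_right)
      then show ?case
        unfolding eq[OF \<open>R \<in> sets P\<close>] using compl(2) by (auto intro: tendsto_diff)
    next
      case (union B)
      have Bs[measurable]: "B i \<in> sets S" for i using union(2) S_sets by auto
      have sums: "(\<lambda>i. measure P (R \<inter> {\<omega> \<in> space P. Y k \<omega> \<in> B i})) sums
          measure P (R \<inter> {\<omega> \<in> space P. Y k \<omega> \<in> (\<Union>i. B i)})" if [measurable]: "R \<in> sets P" for R k
      proof -
        have "(\<lambda>i. measure P (R \<inter> {\<omega> \<in> space P. Y k \<omega> \<in> B i})) sums
            measure P (\<Union>i. R \<inter> {\<omega> \<in> space P. Y k \<omega> \<in> B i})"
          using union(1) by (intro finite_measure_UNION) (auto simp: disjoint_family_on_def)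
        moreover have "(\<Union>i. R \<inter> {\<omega> \<in> space P. Y k \<omega> \<in> B i}) = R \<inter> {\<omega> \<in> space P. Y k \<omega> \<in> (\<Union>i. B i)}" by auto
        ultimately show ?thesis by simp
      qed
      have pm_sums: "(\<lambda>i. pm (B i)) sums pm (\<Union>i. B i)"
        using sums[of "space P" 0] by (simp add: pm_def Int_def)
      \<comment> \<open>Limit and series are exchanged by dominated convergence; by stationarity
        \<open>pm (B i)\<close> is a bound for every j.\<close>
      have "(\<lambda>j::nat. \<Sum>i. measure P (R \<inter> {\<omega> \<in> space P. Y (int j) \<omega> \<in> B i})) \<longlonglongrightarrow> (\<Sum>i. measure P R * pm (B i))"
      proof (rule tannerys_theorem[where M="\<lambda>i. pm (B i)", THEN conjunct2, THEN conjunct2])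
        show "summable (\<lambda>i. pm (B i))" using pm_sums by (rule sums_summable)
        have "measure P (R \<inter> {\<omega> \<in> space P. Y (int j) \<omega> \<in> B i}) \<le> pm (B i)" for i j
          unfolding pm[OF Bs, of "int j", symmetric] by (intro finite_measure_mono) auto
        then show "\<forall>\<^sub>F (i, j) in sequentially \<times>\<^sub>F sequentially.
            norm (measure P (R \<inter> {\<omega> \<in> space P. Y (int j) \<omega> \<in> B i})) \<le> pm (B i)"
          by (intro always_eventually) auto
      qed (use union(3) in auto)
      moreover have "(\<Sum>i. measure P R * pm (B i)) = measure P R * pm (\<Union>i. B i)"
        using pm_sums by (simp add: suminf_mult sums_iff)
      moreover have "(\<Sum>i. measure P (R \<inter> {\<omega> \<in> space P. Y (int j) \<omega> \<in> B i}))
          = measure P (R \<inter> {\<omega> \<in> space P. Y (int j) \<omega> \<in> (\<Union>i. B i)})" for j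
        using sums[of R "int j"] by (simp add: sums_iff)
      ultimately show ?case by simp
    qed
  qed
  have "pm E \<in> {0, 1}" if E: "E \<in> sets S" and inv: "{\<xi> \<in> space S. (\<lambda>t. \<xi> (t + 1)) \<in> E} = E" for E
  proof -
    note [measurable] = E
    have step: "Y (k + 1) \<omega> \<in> E \<longleftrightarrow> Y k \<omega> \<in> E" if "\<omega> \<in> space P" for k \<omega>
    proof -
      have "Y k \<omega> \<in> space S" using that by (rule measurable_space[OF Y])
      moreover have "(\<lambda>t. Y k \<omega> (t + 1)) = Y (k + 1) \<omega>" by (simp add: Y_def add_ac)
      moreover have "Y k \<omega> \<in> E \<longleftrightarrow> Y k \<omega> \<in> {\<xi> \<in> space S. (\<lambda>t. \<xi> (t + 1)) \<in> E}"
        by (simp only: inv)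
      ultimately show ?thesis by simp
    qed
    have inv_Y: "{\<omega> \<in> space P. Y k \<omega> \<in> E} = {\<omega> \<in> space P. Y 0 \<omega> \<in> E}" for k
    proof (induction k rule: int_induct[where k=0])
      case (step1 i)
      then show ?case using step by blast
    next
      case (step2 i)
      then show ?case using step[of _ "i - 1"] by auto
    qed simp
    have cyl_indep: "pm (C \<inter> E) = pm C * pm E" if C: "C \<in> ?cyl" for C
    proof -
      have [measurable]: "C \<in> sets S" using C cyl_sets by auto
      obtain l :: nat where l: "\<And>k I. {- int l + k..int l + k} \<subseteq> I \<Longrightarrow>
          {\<omega> \<in> space P. Y k \<omega> \<in> C} \<in> sigma_generated P M X I"
        using cyl_bounded[OF C] by blast
      \<comment> \<open>The shift by -l puts the cylinder into the past. By invariance the sequence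
        in \<open>lim\<close> is then constant, so its value equals its limit.\<close>
      let ?R = "{\<omega> \<in> space P. Y (- int l) \<omega> \<in> C}"
      have R: "?R \<in> sigma_generated P M X {..0}" by (rule l) auto
      have "?R \<inter> {\<omega> \<in> space P. Y k \<omega> \<in> E} = {\<omega> \<in> space P. Y (- int l) \<omega> \<in> C \<inter> E}" for k
        unfolding inv_Y[of k] inv_Y[of "- int l", symmetric] by auto
      then have "(\<lambda>j::nat. pm (C \<inter> E)) \<longlonglongrightarrow> measure P ?R * pm E"
        using lim[OF R E] by (simp only: pm[OF sets.Int[OF \<open>C \<in> sets S\<close> E]])
      then show ?thesis by (simp add: LIMSEQ_const_iff pm)
    qed
    define \<nu> where "\<nu> = distr P S (Y 0)"
    have \<nu>: "emeasure \<nu> C = ennreal (pm C)" if "C \<in> sets S" for C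
      using that by (simp add: \<nu>_def emeasure_distr emeasure_eq_measure pm_def vimage_def Int_def conj_commute)
    have sets_\<nu>[measurable_cong]: "sets \<nu> = sets S" by (simp add: \<nu>_def)
    have pm_nonneg: "0 \<le> pm C" for C by (simp add: pm_def)
    have N1: "emeasure (density \<nu> (indicator E)) C = ennreal (pm (C \<inter> E))" if [measurable]: "C \<in> sets S" for C
    proof -
      have "emeasure (density \<nu> (indicator E)) C = emeasure \<nu> (C \<inter> E)"
      proof -
        have "emeasure (density \<nu> (indicator E)) C = (\<integral>\<^sup>+x. indicator E x * indicator C x \<partial>\<nu>)"
          by (rule emeasure_density) measurable
        also have "\<dots> = (\<integral>\<^sup>+x. indicator (C \<inter> E) x \<partial>\<nu>)"
          by (intro nn_integral_cong) (auto simp: indicator_def)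
        also have "\<dots> = emeasure \<nu> (C \<inter> E)" by (rule nn_integral_indicator) measurable
        finally show ?thesis .
      qed
      then show ?thesis by (simp add: \<nu>)
    qed
    have N2: "emeasure (density \<nu> (\<lambda>_. ennreal (pm E))) C = ennreal (pm C * pm E)" if [measurable]: "C \<in> sets S" for C
    proof -
      have "emeasure (density \<nu> (\<lambda>_. ennreal (pm E))) C = ennreal (pm E) * emeasure \<nu> C"
        by (subst emeasure_density) (auto simp: nn_integral_cmult_indicator)
      then show ?thesis by (simp add: \<nu> ennreal_mult pm_nonneg mult.commute)
    qed
    \<comment> \<open>Independence from cylinders is the equality of two finite measures on a
      generating pi-system, which is then evaluated at \<open>E\<close> itself.\<close>
    have "emeasure (density \<nu> (indicator E)) E = emeasure (density \<nu> (\<lambda>_. ennreal (pm E))) E"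
    proof (rule emeasure_eq_on_sigma_sets[OF Int_stable_prod_algebra cyl_Pow])
      show "space S \<in> ?cyl" unfolding S_def space_PiM by (rule space_in_prod_algebra)
      show "emeasure (density \<nu> (indicator E)) C = emeasure (density \<nu> (\<lambda>_. ennreal (pm E))) C" if "C \<in> ?cyl" for C
        using that cyl_sets by (subst N1, blast, subst N2, blast) (simp add: cyl_indep)
      show "emeasure (density \<nu> (indicator E)) (space S) < top" by (subst N1) auto
      show "E \<in> sigma_sets (space S) ?cyl" using E by (simp add: S_sets)
    qed (use cyl_sets sets_\<nu> in \<open>auto simp: \<nu>_def\<close>)
    then have "pm E = pm E * pm E" using E by (simp add: N1 N2 pm_nonneg)
    then show ?thesis by auto
  qed
  then show ?thesis
    using stat unfolding ergodic_process_def pm_def Y_def S_def by auto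
qed

section \<open>From finite-dimensional densities to the Markov property\<close>

text \<open>A Bochner integral that vanishes for lack of integrability is excluded by \<open>c \<noteq> 0\<close>.\<close>

lemma nn_integral_eq_of_integral_eq:
  fixes f :: "'x \<Rightarrow> real"
  assumes "(\<integral>x. f x \<partial>M) = c" "c \<noteq> 0" "AE x in M. 0 \<le> f x"
  shows "(\<integral>\<^sup>+x. ennreal (f x) \<partial>M) = ennreal c"
proof -
  have "integrable M f" using assms(1,2) not_integrable_integral_eq by blast
  then show ?thesis using assms by (simp add: nn_integral_eq_integral)
qed

context positive_kernel
begin

text \<open>Induction from the end of the path, for all \<open>g\<close>: integrating out the last
  coordinate replaces \<open>g\<close> by a \<open>pull\<close>, and \<open>push_pull\<close>
  converts this into one more step of \<open>forward\<close>.\<close>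

lemma nn_integral_path_density:
  assumes [measurable]: "\<And>t. u t \<in> borel_measurable M" "g \<in> borel_measurable M"
  shows "(\<integral>\<^sup>+x. v (x 0) * u 0 (x 0) * (\<Prod>t\<in>{1..n}. K (x (t - 1)) (x t) * u t (x t)) * g (x n) \<partial>(\<Pi>\<^sub>M t\<in>{..n}. M))
    = (\<integral>\<^sup>+y. forward u n y * g y \<partial>M)"
  using assms(2)
proof (induction n arbitrary: g)
  case 0
  note [measurable] = 0
  interpret product_sigma_finite "\<lambda>_. M" by (unfold_locales)
  have "(\<integral>\<^sup>+x. v (x 0) * u 0 (x 0) * g (x 0) \<partial>(\<Pi>\<^sub>M t\<in>{0::nat}. M)) = (\<integral>\<^sup>+y. v y * u 0 y * g y \<partial>M)"
    by (rule product_nn_integral_singleton[where f="\<lambda>y. v y * u 0 y * g y"]) measurable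
  then show ?case by (simp add: atMost_0)
next
  case (Suc n)
  note [measurable] = Suc.prems
  interpret product_sigma_finite "\<lambda>_. M" by (unfold_locales)
  \<comment> \<open>The part of the density without the new coordinate; it is constant in the inner
    integral.\<close>
  define F where "F x = v (x 0) * u 0 (x 0) * (\<Prod>t\<in>{1..n}. K (x (t - 1)) (x t) * u t (x t))" for x :: "nat \<Rightarrow> 'x"
  define g' where "g' x = pull (\<lambda>y. u (Suc n) y * g y) x" for x
  have [measurable]: "g' \<in> borel_measurable M" unfolding g'_def by measurable
  have F_upd: "F (x(Suc n := y)) = F x" for x y
    unfolding F_def by (auto intro!: arg_cong2[where f="(*)"] prod.cong)
  have ins: "{..Suc n} = insert (Suc n) {..n}" by auto
  have comp[measurable]: "(\<lambda>x. x t) \<in> (\<Pi>\<^sub>M t\<in>{..m}. M) \<rightarrow>\<^sub>M M" if "t \<le> m" for t m :: nat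
    using that by (intro measurable_component_singleton) simp
  have F_meas[measurable]: "F \<in> borel_measurable (\<Pi>\<^sub>M t\<in>{..m}. M)" if "n \<le> m" for m
    unfolding F_def using that by (intro borel_measurable_times_ennreal borel_measurable_prod_ennreal
      measurable_compose[OF comp] K_measurable assms v_measurable comp) auto
  have "(\<integral>\<^sup>+x. v (x 0) * u 0 (x 0) * (\<Prod>t\<in>{1..Suc n}. K (x (t - 1)) (x t) * u t (x t)) * g (x (Suc n))
      \<partial>(\<Pi>\<^sub>M t\<in>{..Suc n}. M))
    = (\<integral>\<^sup>+x. F x * (K (x n) (x (Suc n)) * (u (Suc n) (x (Suc n)) * g (x (Suc n)))) \<partial>(\<Pi>\<^sub>M t\<in>insert (Suc n) {..n}. M))"
    unfolding ins F_def by (simp add: mult_ac)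
  also have "\<dots> = (\<integral>\<^sup>+x. \<integral>\<^sup>+y. F x * (K (x n) y * (u (Suc n) y * g y)) \<partial>M \<partial>(\<Pi>\<^sub>M t\<in>{..n}. M))"
  proof (subst product_nn_integral_insert)
    have 1: "F \<in> borel_measurable (\<Pi>\<^sub>M t\<in>{..Suc n}. M)" by (rule F_meas) simp
    have 2: "(\<lambda>x. x n) \<in> (\<Pi>\<^sub>M t\<in>{..Suc n}. M) \<rightarrow>\<^sub>M M" "(\<lambda>x. x (Suc n)) \<in> (\<Pi>\<^sub>M t\<in>{..Suc n}. M) \<rightarrow>\<^sub>M M"
      by (rule comp, simp)+
    note [measurable] = 1 2
    show "(\<lambda>x. F x * (K (x n) (x (Suc n)) * (u (Suc n) (x (Suc n)) * g (x (Suc n)))))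
        \<in> borel_measurable (\<Pi>\<^sub>M t\<in>insert (Suc n) {..n}. M)"
      unfolding ins[symmetric] by measurable
  qed (simp_all add: F_upd)
  also have "\<dots> = (\<integral>\<^sup>+x. F x * g' (x n) \<partial>(\<Pi>\<^sub>M t\<in>{..n}. M))"
  proof (rule nn_integral_cong)
    fix x assume "x \<in> space (\<Pi>\<^sub>M t\<in>{..n}. M)"
    then have [measurable]: "x n \<in> space M" by (auto simp: space_PiM PiE_iff)
    show "(\<integral>\<^sup>+y. F x * (K (x n) y * (u (Suc n) y * g y)) \<partial>M) = F x * g' (x n)"
      unfolding g'_def pull_def by (rule nn_integral_cmult) measurable
  qed
  also have "\<dots> = (\<integral>\<^sup>+y. forward u n y * g' y \<partial>M)"
    unfolding F_def by (rule Suc.IH) measurable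
  also have "\<dots> = (\<integral>\<^sup>+y. push (forward u n) y * (u (Suc n) y * g y) \<partial>M)"
    unfolding g'_def by (rule push_pull[symmetric]) measurable
  finally show ?case by (simp add: mult.assoc)
qed

end

text \<open>The exceptional set lies in a product with one null factor. Its measure is 0 even if
  other factors have infinite measure, as 0 * top = 0.\<close>

lemma AE_PiM_finite_component:
  assumes M: "sigma_finite_measure M" and "finite I" "i \<in> I" and "AE x in M. Q x"
  shows "AE x in (\<Pi>\<^sub>M t\<in>I. M). Q (x i)"
proof -
  interpret sigma_finite_measure M by fact
  interpret product_sigma_finite "\<lambda>_. M" by (unfold_locales)
  obtain N where N: "{x \<in> space M. \<not> Q x} \<subseteq> N" "N \<in> null_sets M"
    using assms(4) by (auto elim!: AE_E simp: null_sets_def)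
  let ?N = "\<Pi>\<^sub>E t\<in>I. if t = i then N else space M"
  have "emeasure (\<Pi>\<^sub>M t\<in>I. M) ?N = (\<Prod>t\<in>I. emeasure M (if t = i then N else space M))"
    using N(2) \<open>finite I\<close> by (intro emeasure_PiM) auto
  also have "\<dots> = 0"
    using N(2) assms(2,3) by (intro prod_zero bexI[of _ i]) auto
  finally have "?N \<in> null_sets (\<Pi>\<^sub>M t\<in>I. M)"
    using N(2) \<open>finite I\<close> by (intro null_setsI sets_PiM_I_finite) auto
  moreover have "{x \<in> space (\<Pi>\<^sub>M t\<in>I. M). \<not> Q (x i)} \<subseteq> ?N"
  proof (rule subsetI)
    fix x assume "x \<in> {x \<in> space (\<Pi>\<^sub>M t\<in>I. M). \<not> Q (x i)}"
    then have x: "x \<in> (\<Pi>\<^sub>E t\<in>I. space M)" "\<not> Q (x i)" by (auto simp: space_PiM)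
    then have "x i \<in> N" using N(1) \<open>i \<in> I\<close> by blast
    with x(1) show "x \<in> ?N" by (auto simp: PiE_iff)
  qed
  ultimately show ?thesis by (rule AE_I')
qed

text \<open>Passage from Bochner integrals to \<open>nn_integral\<close>. Dividing \<open>R\<close>
  by r makes the eigenvalue 1 and uses up the factor r^(-n) of the path density, one r for each of
  the n transitions.\<close>

lemma CEStGM_process_kernel_process:
  assumes M: "sigma_finite_measure M"
    and R_meas: "case_prod R \<in> borel_measurable (M \<Otimes>\<^sub>M M)" and R_nonneg: "\<And>x y. 0 \<le> R x y"
    and proc: "CEStGM_process M R P X"
  obtains r v w where "0 < r" "v \<in> L2 M" "w \<in> L2 M"
    "kernel_process M (\<lambda>x y. ennreal (R x y / r)) (\<lambda>x. ennreal (v x)) (\<lambda>x. ennreal (w x)) P X"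
proof -
  interpret sigma_finite_measure M by fact
  from proc obtain r v w where "prob_space P" and stat: "strictly_stationary P M X" and r: "0 < r"
    and v: "v \<in> L2 M" and w: "w \<in> L2 M"
    and v_pos: "AE x in M. 0 < v x" and w_pos: "AE x in M. 0 < w x"
    and Tv: "AE x in M. integral_operator M R v x = r * v x"
    and Tw: "AE x in M. adjoint_integral_operator M R w x = r * w x"
    and vw: "(\<integral>x. v x * w x \<partial>M) = 1"
    and dist: "\<And>m n. 1 \<le> n \<Longrightarrow>
       distributed P (\<Pi>\<^sub>M t\<in>{..<n}. M) (\<lambda>\<omega>. \<lambda>t\<in>{..<n}. X (m + int t) \<omega>)
         (\<lambda>x. ennreal (inverse (r ^ (n - 1)) * v (x 0) * (\<Prod>t\<in>{1..<n}. R (x (t - 1)) (x t)) * w (x (n - 1))))"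
    unfolding CEStGM_process_def by blast
  interpret P: prob_space P by fact
  have [measurable]: "v \<in> borel_measurable M" "w \<in> borel_measurable M" using v w by (auto simp: L2_def)
  note [measurable] = R_meas
  have X[measurable]: "X t \<in> P \<rightarrow>\<^sub>M M" for t using stat by (simp add: strictly_stationary_def)
  let ?K = "\<lambda>x y. ennreal (R x y / r)" and ?v = "\<lambda>x. ennreal (v x)" and ?w = "\<lambda>x. ennreal (w x)"
  have pk: "positive_kernel M ?K ?v ?w"
  proof (unfold_locales)
    show "case_prod ?K \<in> borel_measurable (M \<Otimes>\<^sub>M M)" by measurable
    show "AE x in M. 0 < ?v x \<and> ?v x < top" "AE x in M. 0 < ?w x \<and> ?w x < top"
      using v_pos w_pos by auto
    show "AE y in M. (\<integral>\<^sup>+x. ?v x * ?K x y \<partial>M) = ?v y"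
      using Tv v_pos
    proof eventually_elim
      case (elim y)
      have "(\<integral>x. v x * (R x y / r) \<partial>M) = (\<integral>x. R x y *\<^sub>R v x \<partial>M) / r"
        by (simp add: mult.commute)
      also have "\<dots> = v y" using elim r by (simp add: integral_operator_def)
      finally have "(\<integral>\<^sup>+x. ennreal (v x * (R x y / r)) \<partial>M) = ennreal (v y)"
        using elim v_pos R_nonneg r by (intro nn_integral_eq_of_integral_eq) auto
      moreover have "(\<integral>\<^sup>+x. ennreal (v x * (R x y / r)) \<partial>M) = (\<integral>\<^sup>+x. ?v x * ?K x y \<partial>M)"
        by (rule nn_integral_cong_AE, use v_pos in eventually_elim, rule ennreal_mult) (use R_nonneg r in auto)
      ultimately show ?case by simp
    qed
    show "AE x in M. (\<integral>\<^sup>+y. ?K x y * ?w y \<partial>M) = ?w x"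
      using Tw w_pos
    proof eventually_elim
      case (elim x)
      have "(\<integral>y. (R x y / r) * w y \<partial>M) = (\<integral>y. R x y *\<^sub>R w y \<partial>M) / r"
        by (simp add: mult.commute)
      also have "\<dots> = w x" using elim r by (simp add: adjoint_integral_operator_def integral_operator_def)
      finally have "(\<integral>\<^sup>+y. ennreal ((R x y / r) * w y) \<partial>M) = ennreal (w x)"
        using elim w_pos R_nonneg r by (intro nn_integral_eq_of_integral_eq) auto
      moreover have "(\<integral>\<^sup>+y. ennreal ((R x y / r) * w y) \<partial>M) = (\<integral>\<^sup>+y. ?K x y * ?w y \<partial>M)"
        by (rule nn_integral_cong_AE, use w_pos in eventually_elim, rule ennreal_mult) (use R_nonneg r in auto)
      ultimately show ?case by simp
    qed
    have "(\<integral>\<^sup>+x. ennreal (v x * w x) \<partial>M) = ennreal 1"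
      using v_pos w_pos vw by (intro nn_integral_eq_of_integral_eq) auto
    moreover have "(\<integral>\<^sup>+x. ennreal (v x * w x) \<partial>M) = (\<integral>\<^sup>+x. ?v x * ?w x \<partial>M)"
      using v_pos w_pos by (intro nn_integral_cong_AE) (auto simp: ennreal_mult)
    ultimately show "(\<integral>\<^sup>+x. ?v x * ?w x \<partial>M) = 1" by simp
  qed measurable
  interpret positive_kernel M ?K ?v ?w by fact
  have law: "(\<integral>\<^sup>+\<omega>. (\<Prod>t\<le>n. u t (X (m + int t) \<omega>)) \<partial>P) = (\<integral>\<^sup>+y. forward u n y * ?w y \<partial>M)"
    if [measurable]: "\<And>t. u t \<in> borel_measurable M" for u n m
  proof -
    let ?N = "\<Pi>\<^sub>M t\<in>{..n}. M"
    let ?d = "\<lambda>x. ennreal (inverse (r ^ n) * v (x 0) * (\<Prod>t\<in>{1..n}. R (x (t - 1)) (x t)) * w (x n))"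
    \<comment> \<open>Here n counts transitions and not positions, so the density of a block of
      length \<open>Suc n\<close> is taken.\<close>
    have d: "distributed P ?N (\<lambda>\<omega>. \<lambda>t\<in>{..n}. X (m + int t) \<omega>) ?d"
    proof -
      have "{..<Suc n} = {..n}" "{1..<Suc n} = {1..n}" by auto
      then show ?thesis using dist[of "Suc n" m] by simp
    qed
    have [measurable]: "(\<lambda>x. \<Prod>t\<le>n. u t (x t)) \<in> borel_measurable ?N"
      by (intro borel_measurable_prod_ennreal measurable_compose[OF measurable_component_singleton]) auto
    have "(\<integral>\<^sup>+\<omega>. (\<Prod>t\<le>n. u t (X (m + int t) \<omega>)) \<partial>P)
        = (\<integral>\<^sup>+\<omega>. (\<lambda>x. \<Prod>t\<le>n. u t (x t)) (\<lambda>t\<in>{..n}. X (m + int t) \<omega>) \<partial>P)"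
      by (intro nn_integral_cong prod.cong) auto
    also have "\<dots> = (\<integral>\<^sup>+x. ?d x * (\<Prod>t\<le>n. u t (x t)) \<partial>?N)"
      by (rule distributed_nn_integral[OF d, symmetric]) measurable
    also have "\<dots> = (\<integral>\<^sup>+x. ?v (x 0) * u 0 (x 0) * (\<Prod>t\<in>{1..n}. ?K (x (t - 1)) (x t) * u t (x t)) * ?w (x n) \<partial>?N)"
    proof (rule nn_integral_cong_AE)
      \<comment> \<open>\<open>ennreal\<close> is multiplicative on nonnegative factors.
        \<open>R\<close> is nonnegative everywhere, whereas \<open>v\<close> and \<open>w\<close>,
        which occur at the two endpoints, are positive almost everywhere only.\<close>
      have "AE x in ?N. 0 < v (x 0)" "AE x in ?N. 0 < w (x n)"
        by (rule AE_PiM_finite_component[OF M, where Q="\<lambda>y. 0 < v y"], use v_pos in auto)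
          (rule AE_PiM_finite_component[OF M, where Q="\<lambda>y. 0 < w y"], use w_pos in auto)
      then show "AE x in ?N. ?d x * (\<Prod>t\<le>n. u t (x t))
          = ?v (x 0) * u 0 (x 0) * (\<Prod>t\<in>{1..n}. ?K (x (t - 1)) (x t) * u t (x t)) * ?w (x n)"
      proof eventually_elim
        case (elim x)
        have scale: "inverse (r ^ n) * (\<Prod>t\<in>{1..n}. R (x (t - 1)) (x t)) = (\<Prod>t\<in>{1..n}. R (x (t - 1)) (x t) / r)"
          by (simp add: prod_dividef inverse_eq_divide)
        have "a * b * c * d = b * (a * c) * d" for a b c d :: real by (simp only: mult_ac)
        then have d_eq: "inverse (r ^ n) * v (x 0) * (\<Prod>t\<in>{1..n}. R (x (t - 1)) (x t)) * w (x n)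
            = v (x 0) * (\<Prod>t\<in>{1..n}. R (x (t - 1)) (x t) / r) * w (x n)"
          unfolding scale[symmetric] by this
        have "?d x = ?v (x 0) * (\<Prod>t\<in>{1..n}. ?K (x (t - 1)) (x t)) * ?w (x n)"
          unfolding d_eq using elim r R_nonneg by (simp add: ennreal_mult prod_ennreal prod_nonneg)
        moreover have "(\<Prod>t\<le>n. u t (x t)) = u 0 (x 0) * (\<Prod>t\<in>{1..n}. u t (x t))"
          by (simp add: prod.atLeast1_atMost_eq prod.atMost_shift)
        ultimately show ?case by (simp add: prod.distrib mult_ac)
      qed
    qed
    also have "\<dots> = (\<integral>\<^sup>+y. forward u n y * ?w y \<partial>M)"
      by (rule nn_integral_path_density) measurable
    finally show ?thesis .
  qed
  have "kernel_process M ?K ?v ?w P X"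
    by unfold_locales (use law in auto)
  then show ?thesis using that r v w by blast
qed

section \<open>Mixing of the process\<close>

lemma (in kernel_process) geometrically_beta_mixing_ergodic:
  assumes stat: "strictly_stationary P M X"
    and \<rho>: "0 < \<rho>" "\<rho> < 1" "0 < C"
    and conv: "\<And>n. (\<integral>\<^sup>+x. \<integral>\<^sup>+y. v x * absdiff (iter_kernel n x y) (w x * v y) * w y \<partial>M \<partial>M) \<le> ennreal (C * \<rho> ^ n)"
  shows "geometrically_beta_mixing P M X \<and> ergodic_process P M X"
proof
  have nonneg: "0 \<le> C * \<rho> ^ n" for n using \<rho> by simp
  let ?past = "sigma_generated P M X {..0}" and ?future = "\<lambda>n. sigma_generated P M X {int n + 1..}"
  have space: "space P \<in> sigma_generated P M X I" for I
    unfolding sigma_generated_def by (rule sigma_sets_top)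
  \<comment> \<open>The bound on the supremum requires one admissible pair of partitions. The
    trivial partition is one, its block being nonempty because P is a probability space.\<close>
  have part: "partition_on (space P) {space P}"
    using P.not_empty by (auto simp: partition_on_def disjoint_def)
  have "beta_coeff P ?past (?future n) \<le> C * \<rho> ^ n" for n
    unfolding beta_coeff_def
  proof (rule cSup_least)
    show "{1 / 2 * (\<Sum>A\<in>U. \<Sum>B\<in>V. \<bar>measure P (A \<inter> B) - measure P A * measure P B\<bar>) | U V.
        finite U \<and> U \<subseteq> ?past \<and> partition_on (space P) U \<and>
        finite V \<and> V \<subseteq> ?future n \<and> partition_on (space P) V} \<noteq> {}"
      using space part by blast
  next
    fix s assume "s \<in> {1 / 2 * (\<Sum>A\<in>U. \<Sum>B\<in>V. \<bar>measure P (A \<inter> B) - measure P A * measure P B\<bar>) | U V.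
        finite U \<and> U \<subseteq> ?past \<and> partition_on (space P) U \<and>
        finite V \<and> V \<subseteq> ?future n \<and> partition_on (space P) V}"
    then obtain U V where s: "s = 1 / 2 * (\<Sum>A\<in>U. \<Sum>B\<in>V. \<bar>measure P (A \<inter> B) - measure P A * measure P B\<bar>)"
      and U: "finite U" "partition_on (space P) U" "U \<subseteq> ?past"
      and V: "finite V" "partition_on (space P) V" "V \<subseteq> ?future n" by blast
    have "(\<Sum>A\<in>U. \<Sum>B\<in>V. \<bar>measure P (A \<inter> B) - measure P A * measure P B\<bar>) \<le> C * \<rho> ^ n"
      using U V by (intro dependence_bound[OF nonneg conv]) (auto dest: partition_onD2)
    then show "s \<le> C * \<rho> ^ n" unfolding s using nonneg[of n] by simp
  qed
  then show "geometrically_beta_mixing P M X"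
    unfolding geometrically_beta_mixing_def using stat \<rho> by blast
  show "ergodic_process P M X"
  proof (rule strong_mixing_imp_ergodic[OF P.prob_space_axioms stat])
    show "(\<lambda>n. C * \<rho> ^ n) \<longlonglongrightarrow> 0"
      using \<rho> tendsto_mult_right_zero LIMSEQ_power_zero[of \<rho>] by auto
    show "\<bar>measure P (A \<inter> B) - measure P A * measure P B\<bar> \<le> C * \<rho> ^ n"
      if "A \<in> ?past" "B \<in> ?future n" for n A B
      using dependence_bound[OF nonneg conv, of "{A}" "{B}" n] that by simp
  qed
qed

lemma L2_nn_integral_power2:
  fixes f :: "'x \<Rightarrow> real"
  assumes "f \<in> L2 M"
  shows "(\<integral>\<^sup>+x. (ennreal (f x))\<^sup>2 \<partial>M) < top"
proof -
  have "(\<integral>\<^sup>+x. (ennreal (f x))\<^sup>2 \<partial>M) \<le> (\<integral>\<^sup>+x. ennreal ((norm (f x))\<^sup>2) \<partial>M)"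
  proof (rule nn_integral_mono)
    show "(ennreal (f x))\<^sup>2 \<le> ennreal ((norm (f x))\<^sup>2)" for x
      by (cases "0 \<le> f x") (simp_all add: ennreal_power ennreal_neg)
  qed
  also have "\<dots> < top"
    using assms by (auto simp: L2_def integrable_iff_bounded)
  finally show ?thesis .
qed

text \<open>
  On \<open>\<bar>x a\<bar> \<le> k\<close> the coupling \<open>H\<close> is bounded below by a function of \<open>y\<close> alone; these boxes are
  the small sets of the minorization.
\<close>

lemma H_fun_lower_bound:
  fixes \<Phi>1 :: "real ^ 'p ^ 'p"
  assumes x: "\<And>a. \<bar>x a\<bar> \<le> k"
  shows "exp (- (k * (\<Sum>a\<in>UNIV. \<Sum>b\<in>UNIV. \<bar>\<Phi>1 $ a $ b\<bar> * \<bar>y b\<bar>))) \<le> H_fun \<Phi>1 x y"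
proof -
  have "\<bar>vec_lambda x \<bullet> (\<Phi>1 *v vec_lambda y)\<bar> = \<bar>\<Sum>a\<in>UNIV. x a * (\<Sum>b\<in>UNIV. \<Phi>1 $ a $ b * y b)\<bar>"
    by (simp add: inner_vec_def matrix_vector_mult_def)
  also have "\<dots> \<le> (\<Sum>a\<in>UNIV. \<bar>x a * (\<Sum>b\<in>UNIV. \<Phi>1 $ a $ b * y b)\<bar>)" by (rule sum_abs)
  also have "\<dots> \<le> (\<Sum>a\<in>UNIV. k * (\<Sum>b\<in>UNIV. \<bar>\<Phi>1 $ a $ b\<bar> * \<bar>y b\<bar>))"
  proof (rule sum_mono)
    fix a
    have "\<bar>\<Sum>b\<in>UNIV. \<Phi>1 $ a $ b * y b\<bar> \<le> (\<Sum>b\<in>UNIV. \<bar>\<Phi>1 $ a $ b\<bar> * \<bar>y b\<bar>)"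
      unfolding abs_mult[symmetric] by (rule sum_abs)
    then show "\<bar>x a * (\<Sum>b\<in>UNIV. \<Phi>1 $ a $ b * y b)\<bar> \<le> k * (\<Sum>b\<in>UNIV. \<bar>\<Phi>1 $ a $ b\<bar> * \<bar>y b\<bar>)"
      unfolding abs_mult using x[of a] abs_ge_zero[of "x a"] by (intro mult_mono) linarith+
  qed
  also have "\<dots> = k * (\<Sum>a\<in>UNIV. \<Sum>b\<in>UNIV. \<bar>\<Phi>1 $ a $ b\<bar> * \<bar>y b\<bar>)" by (simp add: sum_distrib_left)
  finally show ?thesis unfolding H_fun_def by simp
qed

theorem theorem3p1:
  fixes \<X> :: "'p::finite \<Rightarrow> real set"
    and \<mu>a :: "'p \<Rightarrow> real measure"
    and s c :: "'p \<Rightarrow> real \<Rightarrow> real"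
    and \<theta> :: "real ^ 'p"
    and \<Phi>0 \<Phi>1 :: "real ^ 'p ^ 'p"
    and \<mu> :: "('p \<Rightarrow> real) measure"
    and R :: "('p \<Rightarrow> real) \<Rightarrow> ('p \<Rightarrow> real) \<Rightarrow> real"
    and P :: "'w measure"
    and X :: "int \<Rightarrow> 'w \<Rightarrow> 'p \<Rightarrow> real"
  assumes "\<And>a. \<X> a \<in> sets borel"
    and "\<And>a. space (\<mu>a a) = \<X> a"
    and "\<And>a. sets (\<mu>a a) = sets (restrict_space borel (\<X> a))"
    and "\<And>a. sigma_finite_measure (\<mu>a a)"
    and "\<And>a. s a \<in> borel_measurable (\<mu>a a)"
    and "\<And>a. c a \<in> borel_measurable (\<mu>a a)"
    and "transpose \<Phi>0 = \<Phi>0"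
    and "\<And>a. \<Phi>0 $ a $ a = 0"
    and "\<mu> = (\<Pi>\<^sub>M a\<in>UNIV. \<mu>a a)"
    and "R = interaction_kernel s c \<theta> \<Phi>0 \<Phi>1"
    and "(\<integral>\<^sup>+ (x, y). ennreal ((R x y)\<^sup>2) \<partial>(\<mu> \<Otimes>\<^sub>M \<mu>)) < \<infinity>"
    and "CEStGM_process \<mu> R P X"
  shows "geometrically_beta_mixing P \<mu> X \<and> ergodic_process P \<mu> X"
proof -
  interpret product_sigma_finite \<mu>a using assms(4) by (simp add: product_sigma_finite_def)
  have sf: "sigma_finite_measure \<mu>" unfolding assms(9) by (rule sigma_finite) simp
  interpret sigma_finite_measure \<mu> by fact
  have comp: "(\<lambda>x. x a) \<in> \<mu> \<rightarrow>\<^sub>M \<mu>a a" for a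
    unfolding assms(9) by (rule measurable_component_singleton) simp
  \<comment> \<open>Each \<open>\<mu>a a\<close> carries the Borel sets of a subset of the reals, so
    the coordinates are measurable real functions on \<mu>.\<close>
  have "(\<lambda>z. z) \<in> borel_measurable (\<mu>a a)" for a
    unfolding measurable_cong_sets[OF assms(3)[of a] refl] by (rule measurable_restrict_space1) simp
  then have coord[measurable (raw)]: "(\<lambda>x. f x a) \<in> borel_measurable N" if "f \<in> N \<rightarrow>\<^sub>M \<mu>" for f a and N :: "'z measure"
    using measurable_compose[OF measurable_compose[OF that comp]] by blast
  have [measurable]: "(\<lambda>x. s a (x a)) \<in> borel_measurable \<mu>" "(\<lambda>x. c a (x a)) \<in> borel_measurable \<mu>" for a
    using measurable_compose[OF comp assms(5)] measurable_compose[OF comp assms(6)] by auto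
  let ?G = "G_fun s c \<theta> \<Phi>0" and ?H = "H_fun \<Phi>1"
  have co: "(\<lambda>x. x a) \<in> borel_measurable \<mu>" for a using coord[of "\<lambda>x. x" \<mu>] by simp
  note [measurable] = co
  have co1: "(\<lambda>p. fst p a) \<in> borel_measurable (\<mu> \<Otimes>\<^sub>M \<mu>)" and co2: "(\<lambda>p. snd p a) \<in> borel_measurable (\<mu> \<Otimes>\<^sub>M \<mu>)" for a
    using measurable_compose[OF measurable_fst co[of a], of \<mu>] measurable_compose[OF measurable_snd co[of a], of \<mu>] by auto
  note [measurable] = co1 co2
  have G_meas[measurable]: "?G \<in> borel_measurable \<mu>"
    unfolding G_fun_def[abs_def] suff_stat_def inner_vec_def matrix_vector_mult_def by simp
  have H_meas[measurable]: "case_prod ?H \<in> borel_measurable (\<mu> \<Otimes>\<^sub>M \<mu>)"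
    unfolding H_fun_def inner_vec_def matrix_vector_mult_def case_prod_beta' by simp
  have R: "R x y = sqrt (?G x) * ?H x y * sqrt (?G y)" for x y
    by (simp add: assms(10) interaction_kernel_def)
  have G_pos: "0 < ?G x" and H_pos: "0 < ?H x y" for x y by (simp_all add: G_fun_def H_fun_def)
  have R_meas: "case_prod R \<in> borel_measurable (\<mu> \<Otimes>\<^sub>M \<mu>)"
    unfolding R[abs_def] using H_meas by (simp add: case_prod_beta')
  have R_nonneg: "0 \<le> R x y" for x y
    unfolding R using G_pos[of x] G_pos[of y] H_pos[of x y] by simp
  obtain r v w where r: "0 < r" and v: "v \<in> L2 \<mu>" and w: "w \<in> L2 \<mu>"
    and kp: "kernel_process \<mu> (\<lambda>x y. ennreal (R x y / r)) (\<lambda>x. ennreal (v x)) (\<lambda>x. ennreal (w x)) P X"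
    using CEStGM_process_kernel_process[OF sf R_meas R_nonneg assms(12)] by blast
  interpret kernel_process \<mu> "\<lambda>x y. ennreal (R x y / r)" "\<lambda>x. ennreal (v x)" "\<lambda>x. ennreal (w x)" P X
    by fact
  \<comment> \<open>\<open>R x y / r\<close> is the product of \<open>sqrt (?G x) / r\<close>,
    \<open>?H x y\<close> and \<open>sqrt (?G y)\<close>. The first factor is \<open>q\<close>;
    \<open>g k\<close> is the last one times the lower bound of \<open>?H\<close> on the box
    \<open>D k\<close>, in which x no longer occurs.\<close>
  define D where "D k = {x \<in> space \<mu>. \<forall>a. \<bar>x a\<bar> \<le> real k}" for k
  define q where "q x = ennreal (sqrt (?G x) / r)" for x
  define g where "g k y = ennreal (exp (- (real k * (\<Sum>a\<in>UNIV. \<Sum>b\<in>UNIV. \<bar>\<Phi>1 $ a $ b\<bar> * \<bar>y b\<bar>))) * sqrt (?G y))" for k y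
  have "\<exists>\<rho> C. 0 < \<rho> \<and> \<rho> < 1 \<and> 0 < C \<and> (\<forall>n. (\<integral>\<^sup>+x. \<integral>\<^sup>+y. ennreal (v x) *
      absdiff (iter_kernel n x y) (ennreal (w x) * ennreal (v y)) * ennreal (w y) \<partial>\<mu> \<partial>\<mu>) \<le> ennreal (C * \<rho> ^ n))"
  proof (rule geometric_convergence_Hilbert_Schmidt[where D=D and q=q and g=g])
    have "(\<integral>\<^sup>+x. \<integral>\<^sup>+y. (ennreal (R x y / r))\<^sup>2 \<partial>\<mu> \<partial>\<mu>)
        = (\<integral>\<^sup>+p. ennreal ((inverse r)\<^sup>2) * ennreal ((R (fst p) (snd p))\<^sup>2) \<partial>(\<mu> \<Otimes>\<^sub>M \<mu>))"
      using R_nonneg r R_meas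
      by (subst nn_integral_fst[symmetric])
        (auto simp: ennreal_power ennreal_mult[symmetric] power_mult_distrib divide_inverse mult.commute case_prod_beta')
    also have "\<dots> = ennreal ((inverse r)\<^sup>2) * (\<integral>\<^sup>+p. ennreal ((R (fst p) (snd p))\<^sup>2) \<partial>(\<mu> \<Otimes>\<^sub>M \<mu>))"
      using R_meas by (intro nn_integral_cmult) (simp add: case_prod_beta')
    also have "\<dots> < top"
      using assms(11) by (simp add: case_prod_beta' ennreal_mult_less_top)
    finally show "(\<integral>\<^sup>+x. \<integral>\<^sup>+y. (ennreal (R x y / r))\<^sup>2 \<partial>\<mu> \<partial>\<mu>) < top" .
    show "(\<integral>\<^sup>+x. (ennreal (v x))\<^sup>2 \<partial>\<mu>) < top" "(\<integral>\<^sup>+x. (ennreal (w x))\<^sup>2 \<partial>\<mu>) < top"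
      using v w by (simp_all add: L2_nn_integral_power2)
    show "D k \<in> sets \<mu>" for k unfolding D_def by measurable
    show "incseq D"
      by (rule incseq_SucI) (auto simp: D_def intro: order_trans)
    show "(\<Union>k. D k) = space \<mu>"
    proof (rule set_eqI)
      fix x :: "'p \<Rightarrow> real"
      have "\<exists>k. \<forall>a. \<bar>x a\<bar> \<le> real k"
      proof -
        obtain k where k: "(\<Sum>a\<in>UNIV. \<bar>x a\<bar>) \<le> real k" using real_arch_simple by blast
        have "\<bar>x a\<bar> \<le> real k" for a
          using member_le_sum[of a UNIV "\<lambda>a. \<bar>x a\<bar>"] k by simp
        then show ?thesis by blast
      qed
      then show "x \<in> (\<Union>k. D k) \<longleftrightarrow> x \<in> space \<mu>" by (auto simp: D_def)
    qed
    show "q \<in> borel_measurable \<mu>" unfolding q_def[abs_def] by measurable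
    show "0 < q x" "q x < top" for x using G_pos[of x] r by (simp_all add: q_def)
    show "g k \<in> borel_measurable \<mu>" for k unfolding g_def[abs_def] by measurable
    show "0 < g k y" for k y using G_pos[of y] by (simp add: g_def)
    show "q x * g k y \<le> ennreal (R x y / r)" if "x \<in> D k" for k x y
    proof -
      have "exp (- (real k * (\<Sum>a\<in>UNIV. \<Sum>b\<in>UNIV. \<bar>\<Phi>1 $ a $ b\<bar> * \<bar>y b\<bar>))) \<le> ?H x y"
        using that by (intro H_fun_lower_bound) (simp add: D_def)
      then have "sqrt (?G x) / r * (exp (- (real k * (\<Sum>a\<in>UNIV. \<Sum>b\<in>UNIV. \<bar>\<Phi>1 $ a $ b\<bar> * \<bar>y b\<bar>))) * sqrt (?G y))
          \<le> sqrt (?G x) / r * (?H x y * sqrt (?G y))"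
        using r G_pos[of x] G_pos[of y] by (intro mult_left_mono mult_right_mono) auto
      also have "\<dots> = R x y / r" by (simp add: R)
      finally show ?thesis
        using r G_pos[of x] G_pos[of y] unfolding q_def g_def
        by (subst ennreal_mult[symmetric]) (auto intro!: ennreal_leI)
    qed
  qed
  then obtain \<rho> C where "0 < \<rho>" "\<rho> < 1" "0 < C" and
    "\<And>n. (\<integral>\<^sup>+x. \<integral>\<^sup>+y. ennreal (v x) * absdiff (iter_kernel n x y) (ennreal (w x) * ennreal (v y)) * ennreal (w y) \<partial>\<mu> \<partial>\<mu>)
      \<le> ennreal (C * \<rho> ^ n)" by blast
  moreover have "strictly_stationary P \<mu> X" using assms(12) by (simp add: CEStGM_process_def)
  ultimately show ?thesis by (intro geometrically_beta_mixing_ergodic)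
qed

end
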